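(* Let $c_2\neq 0$ and let $U_{c_2}(\mathcal S)$ be the (standard) quantum Schrödinger algebra, i.e. the Hopf algebra generated by $D,H,P,K,C,M$ with commutation rules $[D,P]=-P$, $[D,K]=K$, $[K,P]=\dfrac{1-e^{-2c_2M}}{2c_2}$, $[D,H]=-2H$, $[D,C]=2C$, $[H,C]=D$, $[K,H]=P$, $[K,C]=0$, $[P,C]=-K$, $[P,H]=0$, $[M,\cdot\,]=0$, and coproduct $\Delta(X)=1\otimes X+X\otimes 1$ for $X\in\{D,M,H,C\}$, $\Delta(X)=1\otimes X+X\otimes e^{-c_2M}$ for $X\in\{P,K\}$. Consider the element $$\mathcal R=\exp\{c_2\,P\wedge K\,f(M,c_2)\},\qquad f(M,c_2)=\frac{e^{c_2M/2}\otimes e^{c_2M/2}}{\sqrt{\sinh c_2M\otimes\sinh c_2M}}\arcsin\left(\frac{\sqrt{\sinh c_2M\otimes\sinh c_2M}}{\cosh\bigl((c_2/2)\Delta(M)\bigr)}\right).$$ Then $\mathcal R$ is a non-quasitriangular universal $R$-matrix for $U_{c_2}(\mathcal S)$: it is not a solution of the quantum Yang–Baxter equation, but it satisfies $$\mathcal R\,\Delta(X)\,\mathcal R^{-1}=\sigma\circ\Delta(X)$$ for every generator $X\in\{D,H,P,K,C,M\}$, where $\sigma(X\otimes Y)=Y\otimes X$. For $X\in\{D,C\}$ this relation holds because $[c_2\,P\wedge K\,f(M,c_2),\,1\otimes X+X\otimes 1]=0$. The underlying classical $r$-matrix of $\mathcal R$ is $r=c_2\,P\wedge K$.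
   Context: The counit of $U_{c_2}(\mathcal S)$ is trivial and the antipode is determined by the Hopf algebra axioms. $P\wedge K=P\otimes K-K\otimes P$, and $\Delta(M)=1\otimes M+M\otimes 1$. The quantum Yang–Baxter equation is $\mathcal R_{12}\mathcal R_{13}\mathcal R_{23}=\mathcal R_{23}\mathcal R_{13}\mathcal R_{12}$. The generators $\{K,H,P,M\}$ span a standard quantum extended Galilei Hopf subalgebra; $\mathcal R$ is the universal $R$-matrix of that subalgebra, known from earlier work, for which the failure of the quantum Yang–Baxter equation and the relation $\mathcal R\,\Delta(X)\,\mathcal R^{-1}=\sigma\circ\Delta(X)$ on $K,H,P,M$ were already proven. *)

theory Defs
  imports
    "HOL-Algebra.QuotRing"
    "HOL-Analysis.Elementary_Topology"
    "HOL-Computational_Algebra.Formal_Power_Series"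
    "HOL-Library.Poly_Mapping"
    "HOL-Library.Product_Plus"
begin

unbundle fps_syntax

text \<open>
  The quantum Schroedinger algebra is treated as a quantum universal enveloping algebra, that is,
  as an h-adically complete algebra over the formal power series \<open>k[[h]]\<close>, with \<open>k\<close> any field of
  characteristic 0. The deformation parameter is \<open>c\<^sub>2 = c h\<close> with \<open>c\<close> in \<open>k\<close>. So the exponentials,
  hyperbolic functions and the arcsine below are formal power series in \<open>h\<close>.

  For a monoid \<open>'m\<close>, written additively, \<open>('m \<Rightarrow>\<^sub>0 'k) fps\<close> is the completed monoid algebra
  \<open>k['m][[h]]\<close>. For words it is the completed free algebra; for pairs (triples) of words it is the
  completed tensor square (cube) of the completed free algebra.
\<close>

instantiation list :: (type) monoid_add
begin

definition zero_list :: "'a list" where "zero_list = []"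
definition plus_list :: "'a list \<Rightarrow> 'a list \<Rightarrow> 'a list" where "plus_list = (@)"

instance by standard (simp_all add: zero_list_def plus_list_def)

end

text \<open>
  Besides embedding the base ring \<open>k[[h]]\<close>, \<^term>\<open>scalar\<close> also turns a power series over \<open>k\<close> into
  one over the coefficient ring, so that it can be evaluated at \<open>x\<close> by composition. This is
  meaningful when \<open>x\<close> has zero constant term in \<open>h\<close>.
\<close>

definition scalar :: "'k::field_char_0 fps \<Rightarrow> ('m::monoid_add \<Rightarrow>\<^sub>0 'k) fps" where
  "scalar a = Abs_fps (\<lambda>n. Poly_Mapping.single 0 (a $ n))"

definition series_at ::
    "'k::field_char_0 fps \<Rightarrow> ('m::monoid_add \<Rightarrow>\<^sub>0 'k) fps \<Rightarrow> ('m \<Rightarrow>\<^sub>0 'k) fps" where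
  "series_at s x = scalar s oo x"

abbreviation exp_at :: "('m::monoid_add \<Rightarrow>\<^sub>0 'k::field_char_0) fps \<Rightarrow> ('m \<Rightarrow>\<^sub>0 'k) fps" where
  "exp_at \<equiv> series_at (fps_exp 1)"

definition sinh_series :: "'k::field_char_0 fps" where
  "sinh_series = fps_const (1/2) * (fps_exp 1 - fps_exp (-1))"

definition cosh_series :: "'k::field_char_0 fps" where
  "cosh_series = fps_const (1/2) * (fps_exp 1 + fps_exp (-1))"

definition arcsin_series :: "'k::field_char_0 fps" where
  "arcsin_series = fps_inv (fps_sin 1)"

text \<open>The series \<open>arcsin(\<surd>t) / \<surd>t\<close>; see the lemma \<open>arcsin_series_eq\<close> below.\<close>

definition arcsin_sqrt_series :: "'k::field_char_0 fps" where
  "arcsin_sqrt_series = Abs_fps (\<lambda>n. arcsin_series $ (2 * n + 1))"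

lemma arcsin_series_odd:
  "arcsin_series oo (- fps_X) = - (arcsin_series :: 'k::field_char_0 fps)"
proof -
  let ?S = "fps_sin 1 :: 'k fps" and ?A = "arcsin_series :: 'k fps"
  have A0: "?A $ 0 = 0" by (simp add: arcsin_series_def fps_inv_def)
  have S0: "?S $ 0 = 0" and S1: "?S $ 1 \<noteq> 0" by (simp_all add: fps_sin_def)
  have AS: "?A oo ?S = fps_X" unfolding arcsin_series_def by (rule fps_inv[OF S0 S1])
  have SA: "?S oo ?A = fps_X" unfolding arcsin_series_def by (rule fps_inv_right[OF S0 S1])
  have Sodd: "?S oo (- fps_X) = - ?S"
    by (simp add: fps_compose_uminus' fps_eq_iff fps_sin_def)
  let ?B = "- (?A oo (- fps_X))"
  have B0: "?B $ 0 = 0" by (simp add: A0)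
  have X: "fps_X oo (?A oo (- fps_X)) = ?A oo (- fps_X)"
    by (rule fps_X_fps_compose_startby0) (simp add: A0)
  have "?S oo ?B = ?S oo ((- fps_X) oo (?A oo (- fps_X)))"
    by (simp add: fps_compose_uminus X)
  also have "\<dots> = (?S oo (- fps_X)) oo (?A oo (- fps_X))"
    by (rule fps_compose_assoc) (simp_all add: A0)
  also have "\<dots> = - ((?S oo ?A) oo (- fps_X))"
    by (simp add: Sodd fps_compose_uminus fps_compose_assoc A0)
  also have "\<dots> = fps_X"
    by (simp add: SA)
  finally have SB: "?S oo ?B = fps_X" .
  have "?B = (?A oo ?S) oo ?B" by (simp only: AS fps_X_fps_compose_startby0[OF B0])
  also have "\<dots> = ?A oo (?S oo ?B)" by (rule fps_compose_assoc[symmetric]) (simp_all add: A0 S0)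
  also have "\<dots> = ?A" by (simp add: SB)
  finally show ?thesis by (metis minus_minus)
qed

lemma arcsin_series_eq:
  "arcsin_series = fps_X * (arcsin_sqrt_series oo (fps_X ^ 2) :: 'k::field_char_0 fps)"
proof (rule fps_ext)
  fix n :: nat
  have ev: "arcsin_series $ n = (0::'k)" if "even n" for n
  proof -
    have "(- 1) ^ n * (arcsin_series $ n) = - (arcsin_series $ n :: 'k)"
      using arg_cong[OF arcsin_series_odd, of "\<lambda>s. s $ n"] by (simp add: fps_compose_uminus')
    then show ?thesis using that by simp
  qed
  have comp: "(arcsin_sqrt_series oo (fps_X ^ 2)) $ m =
      (if even m then arcsin_series $ Suc m else 0 :: 'k)" for m
  proof -
    have "(arcsin_sqrt_series oo (fps_X ^ 2)) $ m =
        (\<Sum>i=0..m. if m = 2 * i then arcsin_series $ Suc (2 * i) else (0::'k))"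
      by (auto simp: fps_compose_nth arcsin_sqrt_series_def power_mult[symmetric] fps_X_power_nth
          intro!: sum.cong)
    also have "\<dots> = (\<Sum>i\<in>(if even m then {m div 2} else {}). arcsin_series $ Suc (2 * i))"
      by (rule sum.mono_neutral_cong_right) (auto split: if_splits)
    finally show ?thesis by simp
  qed
  show "arcsin_series $ n = (fps_X * (arcsin_sqrt_series oo (fps_X ^ 2)) :: 'k fps) $ n"
  proof (cases n)
    case (Suc m)
    then show ?thesis by (auto simp: comp ev)
  qed (simp add: ev)
qed

text \<open>The continuous linear map induced by a map of monoids.\<close>

definition push :: "('m \<Rightarrow> 'n) \<Rightarrow> ('m \<Rightarrow>\<^sub>0 'k::field_char_0) fps \<Rightarrow> ('n \<Rightarrow>\<^sub>0 'k) fps" where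
  "push \<phi> x = Abs_fps (\<lambda>n. \<Sum>u\<in>Poly_Mapping.keys (x $ n).
     Poly_Mapping.single (\<phi> u) (Poly_Mapping.lookup (x $ n) u))"

text \<open>The continuous algebra homomorphism on the completed free algebra that extends \<open>\<phi>\<close>.\<close>

definition free_lift ::
    "('g \<Rightarrow> ('n::monoid_add \<Rightarrow>\<^sub>0 'k::field_char_0) fps) \<Rightarrow>
     ('g list \<Rightarrow>\<^sub>0 'k) fps \<Rightarrow> ('n \<Rightarrow>\<^sub>0 'k) fps" where
  "free_lift \<phi> x = Abs_fps (\<lambda>m. \<Sum>i\<le>m.
     (\<Sum>w\<in>Poly_Mapping.keys (x $ i).
        scalar (fps_const (Poly_Mapping.lookup (x $ i) w)) * prod_list (map \<phi> w)) $ (m - i))"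

datatype generator = gD | gH | gP | gK | gC | gM

type_synonym 'k free1 = "(generator list \<Rightarrow>\<^sub>0 'k) fps"
type_synonym 'k free2 = "(generator list \<times> generator list \<Rightarrow>\<^sub>0 'k) fps"
type_synonym 'k free3 = "(generator list \<times> generator list \<times> generator list \<Rightarrow>\<^sub>0 'k) fps"

definition var :: "generator \<Rightarrow> 'k::field_char_0 free1" where
  "var g = fps_const (Poly_Mapping.single [g] 1)"

definition tensor :: "'k::field_char_0 free1 \<Rightarrow> 'k free1 \<Rightarrow> 'k free2"
    (infixl \<open>\<boxtimes>\<close> 75) where
  "x \<boxtimes> y = push (\<lambda>u. (u, 0)) x * push (\<lambda>v. (0, v)) y"

definition wedge :: "'k::field_char_0 free1 \<Rightarrow> 'k free1 \<Rightarrow> 'k free2" where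
  "wedge x y = x \<boxtimes> y - y \<boxtimes> x"

definition primitive :: "'k::field_char_0 free1 \<Rightarrow> 'k free2" where
  "primitive x = 1 \<boxtimes> x + x \<boxtimes> 1"

definition c2 :: "'k::field_char_0 \<Rightarrow> ('m::monoid_add \<Rightarrow>\<^sub>0 'k) fps" where
  "c2 c = scalar (fps_const c * fps_X)"

definition half :: "('m::monoid_add \<Rightarrow>\<^sub>0 'k::field_char_0) fps" where
  "half = scalar (fps_const (1/2))"

text \<open>
  \<open>(1 - exp (-2 c\<^sub>2 M)) / (2 c\<^sub>2)\<close>: as \<open>c\<^sub>2 = c h\<close>, this is division by \<open>2 c\<close> and by \<open>h\<close>; the latter
  is exact, the numerator having zero constant term, and is a shift of the coefficients.
\<close>

definition KP_bracket :: "'k::field_char_0 \<Rightarrow> 'k free1" where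
  "KP_bracket c =
     scalar (fps_const (inverse (2 * c))) * fps_shift 1 (1 - exp_at (- (2 * c2 c * var gM)))"

definition comm :: "'a::ring_1 \<Rightarrow> 'a \<Rightarrow> 'a" where
  "comm x y = x * y - y * x"

definition relators :: "'k::field_char_0 \<Rightarrow> 'k free1 set" where
  "relators c =
    {comm (var gD) (var gP) + var gP,
     comm (var gD) (var gK) - var gK,
     comm (var gK) (var gP) - KP_bracket c,
     comm (var gD) (var gH) + 2 * var gH,
     comm (var gD) (var gC) - 2 * var gC,
     comm (var gH) (var gC) - var gD,
     comm (var gK) (var gH) - var gP,
     comm (var gK) (var gC),
     comm (var gP) (var gC) + var gK,
     comm (var gP) (var gH)}
    \<union> {comm (var gM) (var g) | g. True}"

definition type_ring :: "'a::ring_1 ring" where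
  "type_ring = \<lparr>carrier = UNIV, monoid.mult = (*), one = 1, zero = 0, add = (+)\<rparr>"

text \<open>The h-adic topology on \<open>k['m][[h]]\<close> is the library's metric topology on \<^typ>\<open>'a fps\<close>.\<close>

definition closed_ideal :: "'a::ring_1 fps set \<Rightarrow> 'a fps set" where
  "closed_ideal S = closure (Idl\<^bsub>type_ring\<^esub> S)"

text \<open>
  The kernels of the projections from the completed free algebra and its tensor powers onto
  \<open>U\<close>, \<open>U \<otimes> U\<close> and \<open>U \<otimes> U \<otimes> U\<close> (completed tensor products): the kernel of a tensor product of
  surjections is generated by the kernels in the individual legs.
\<close>

definition I1 :: "'k::field_char_0 \<Rightarrow> 'k free1 set" where
  "I1 c = closed_ideal (relators c)"

definition I2 :: "'k::field_char_0 \<Rightarrow> 'k free2 set" where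
  "I2 c = closed_ideal ((\<lambda>x. x \<boxtimes> 1) ` I1 c \<union> (\<lambda>x. 1 \<boxtimes> x) ` I1 c)"

definition I3 :: "'k::field_char_0 \<Rightarrow> 'k free3 set" where
  "I3 c = closed_ideal
     (push (\<lambda>u. (u, 0, 0)) ` I1 c \<union> push (\<lambda>u. (0, u, 0)) ` I1 c \<union> push (\<lambda>u. (0, 0, u)) ` I1 c)"

definition U1 :: "'k::field_char_0 \<Rightarrow> 'k free1 set ring" where
  "U1 c = type_ring Quot I1 c"

definition U2 :: "'k::field_char_0 \<Rightarrow> 'k free2 set ring" where
  "U2 c = type_ring Quot I2 c"

definition U3 :: "'k::field_char_0 \<Rightarrow> 'k free3 set ring" where
  "U3 c = type_ring Quot I3 c"

definition cl1 :: "'k::field_char_0 \<Rightarrow> 'k free1 \<Rightarrow> 'k free1 set" where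
  "cl1 c x = I1 c +>\<^bsub>type_ring\<^esub> x"

definition cl2 :: "'k::field_char_0 \<Rightarrow> 'k free2 \<Rightarrow> 'k free2 set" where
  "cl2 c x = I2 c +>\<^bsub>type_ring\<^esub> x"

definition cl3 :: "'k::field_char_0 \<Rightarrow> 'k free3 \<Rightarrow> 'k free3 set" where
  "cl3 c x = I3 c +>\<^bsub>type_ring\<^esub> x"

text \<open>
  The map of quotients induced by \<open>\<phi>\<close>, where \<open>q\<close> is the projection onto the target quotient. It is
  used below only for continuous homomorphisms \<open>\<phi>\<close> that respect the defining ideals, so that \<open>q \<circ> \<phi>\<close>
  is constant on each class.
\<close>

definition induced :: "('b \<Rightarrow> 'b set) \<Rightarrow> ('a \<Rightarrow> 'b) \<Rightarrow> 'a set \<Rightarrow> 'b set" where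
  "induced q \<phi> A = the_elem ((\<lambda>x. q (\<phi> x)) ` A)"

fun coproduct_gen :: "'k::field_char_0 \<Rightarrow> generator \<Rightarrow> 'k free2" where
  "coproduct_gen c gD = primitive (var gD)"
| "coproduct_gen c gM = primitive (var gM)"
| "coproduct_gen c gH = primitive (var gH)"
| "coproduct_gen c gC = primitive (var gC)"
| "coproduct_gen c gP = 1 \<boxtimes> var gP + var gP \<boxtimes> exp_at (- (c2 c * var gM))"
| "coproduct_gen c gK = 1 \<boxtimes> var gK + var gK \<boxtimes> exp_at (- (c2 c * var gM))"

definition coproduct_free :: "'k::field_char_0 \<Rightarrow> 'k free1 \<Rightarrow> 'k free2" where
  "coproduct_free c = free_lift (coproduct_gen c)"

definition coproduct :: "'k::field_char_0 \<Rightarrow> 'k free1 set \<Rightarrow> 'k free2 set" where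
  "coproduct c = induced (cl2 c) (coproduct_free c)"

definition flip :: "'k::field_char_0 \<Rightarrow> 'k free2 set \<Rightarrow> 'k free2 set" where
  "flip c = induced (cl2 c) (push (\<lambda>(u, v). (v, u)))"

definition leg12 :: "'k::field_char_0 \<Rightarrow> 'k free2 set \<Rightarrow> 'k free3 set" where
  "leg12 c = induced (cl3 c) (push (\<lambda>(u, v). (u, v, 0)))"

definition leg13 :: "'k::field_char_0 \<Rightarrow> 'k free2 set \<Rightarrow> 'k free3 set" where
  "leg13 c = induced (cl3 c) (push (\<lambda>(u, v). (u, 0, v)))"

definition leg23 :: "'k::field_char_0 \<Rightarrow> 'k free2 set \<Rightarrow> 'k free3 set" where
  "leg23 c = induced (cl3 c) (push (\<lambda>(u, v). (0, u, v)))"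

definition solves_QYBE :: "'k::field_char_0 \<Rightarrow> 'k free2 set \<Rightarrow> bool" where
  "solves_QYBE c R \<longleftrightarrow>
     leg12 c R \<otimes>\<^bsub>U3 c\<^esub> leg13 c R \<otimes>\<^bsub>U3 c\<^esub> leg23 c R =
     leg23 c R \<otimes>\<^bsub>U3 c\<^esub> leg13 c R \<otimes>\<^bsub>U3 c\<^esub> leg12 c R"

text \<open>
  With \<open>s\<^sup>2 = sinh (c\<^sub>2 M) \<otimes> sinh (c\<^sub>2 M)\<close>, \<open>w = cosh ((c\<^sub>2/2) \<Delta>(M))\<close> and \<open>g(t) = arcsin(\<surd>t)/\<surd>t\<close>,
  one has \<open>arcsin(s/w)/s = w\<^sup>-\<^sup>1 g(s\<^sup>2 w\<^sup>-\<^sup>2)\<close>; only \<open>s\<^sup>2\<close> occurs on the right-hand side.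
\<close>

definition f_element :: "'k::field_char_0 \<Rightarrow> 'k free2" where
  "f_element c =
    (let e = exp_at (half * c2 c * var gM);
         s2 = series_at sinh_series (c2 c * var gM) \<boxtimes> series_at sinh_series (c2 c * var gM);
         winv = series_at (inverse cosh_series) (half * c2 c * coproduct_free c (var gM))
     in (e \<boxtimes> e) * (winv * series_at arcsin_sqrt_series (s2 * winv ^ 2)))"

definition R_exponent :: "'k::field_char_0 \<Rightarrow> 'k free2" where
  "R_exponent c = c2 c * wedge (var gP) (var gK) * f_element c"

definition R_matrix :: "'k::field_char_0 \<Rightarrow> 'k free2 set" where
  "R_matrix c = cl2 c (exp_at (R_exponent c))"

text \<open>
  \<open>r\<close> is the first-order term of \<open>R\<close> in the deformation parameter: \<open>r\<close> lies in \<open>h (\<s> \<otimes> \<s>)\<close>, where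
  \<open>\<s>\<close> is the Schroedinger Lie algebra spanned by the generators, and \<open>R \<equiv> 1 \<otimes> 1 + r\<close> modulo \<open>h\<^sup>2\<close>.
\<close>

definition classical_r_matrix ::
    "'k::field_char_0 \<Rightarrow> 'k free2 set \<Rightarrow> 'k free2 set \<Rightarrow> bool" where
  "classical_r_matrix c R r \<longleftrightarrow>
     (\<exists>a :: generator \<Rightarrow> generator \<Rightarrow> 'k.
        r = cl2 c (scalar fps_X * (\<Sum>g\<in>UNIV. \<Sum>g'\<in>UNIV. scalar (fps_const (a g g')) * (var g \<boxtimes> var g')))) \<and>
     (\<exists>Y\<in>carrier (U2 c). R = \<one>\<^bsub>U2 c\<^esub> \<oplus>\<^bsub>U2 c\<^esub> r \<oplus>\<^bsub>U2 c\<^esub> cl2 c (scalar (fps_X ^ 2)) \<otimes>\<^bsub>U2 c\<^esub> Y)"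

end

theory Submission
  imports Defs "HOL-Analysis.Elementary_Metric_Spaces"
begin

text \<open>
  Write \<open>X\<^sub>1 = X \<otimes> 1\<close>, \<open>X\<^sub>2 = 1 \<otimes> X\<close>, \<open>A = c\<^sub>2 (P\<^sub>1 K\<^sub>2 - K\<^sub>1 P\<^sub>2) f\<close> and \<open>z = [K, P]\<close>. As \<open>M\<close> is central, \<open>ad A\<close>
  maps \<open>X\<^sub>1\<close> to \<open>- c\<^sub>2 f z\<^sub>1 X\<^sub>2\<close> and \<open>X\<^sub>2\<close> to \<open>c\<^sub>2 f z\<^sub>2 X\<^sub>1\<close> for \<open>X\<close> in \<open>{P, K}\<close>, and it kills \<open>\<Delta>(X)\<close> for the
  other generators. Hence \<open>exp (ad A)\<close> is a rotation whose squared angle is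
  \<open>T = c\<^sub>2\<^sup>2 f\<^sup>2 z\<^sub>1 z\<^sub>2 = arcsin\<^sup>2 (\<surd>t)\<close>, where \<open>t\<close> is the argument of the arcsine in \<open>f\<close>, squared. The choice
  of \<open>f\<close> makes this rotation take \<open>\<Delta>(X)\<close> to \<open>\<sigma> (\<Delta>(X))\<close>.

  The quantum Yang--Baxter equation already fails at order \<open>h\<^sup>2\<close>, where it is the classical one for
  \<open>P \<and> K\<close>. This is detected in a four-dimensional representation in which \<open>M\<close> has square zero.
\<close>

section \<open>Finitely supported functions\<close>

text \<open>No PBW basis and no absence of h-torsion is established for the quotients. Identities
  are therefore proved in the completed free algebras modulo closed ideals, and the division by h in
  [K, P] is undone there, where h cancels. Non-membership in an ideal given by generators needs a
  model, hence the representation. The arcsine comes from solving for the rotation. Put x_i = c2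
  M_i, q_i = exp(-x_i) and d_i = (1 - q_i^2)/2. For X in {P, K} the coproduct is X_2 + q_2 X_1, and
  its flip is X_1 + q_1 X_2. With C = cos(theta) and s = f sin(theta)/theta, the rotation takes one
  to the other if C - s q_2 d_1 = q_1 and s d_2 + C q_2 = 1. The solution is s = 2/(1 + q_1 q_2) and
  C = (q_1 + q_2)/(1 + q_1 q_2), that is, C = cosh((x_1 - x_2)/2)/cosh((x_1 + x_2)/2). Then 1 - C^2
  = sinh(x_1) sinh(x_2)/cosh^2((x_1 + x_2)/2) is the square of the argument of the arcsine in f.
  Only even functions of theta occur, so they are written as series in T = theta^2 and no square
  root is ever formed.\<close>

lemma poly_mapping_sum_single:
  "p = (\<Sum>k\<in>Poly_Mapping.keys p. Poly_Mapping.single k (Poly_Mapping.lookup p k))"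
  by (rule poly_mapping_eqI)
    (auto simp: lookup_sum lookup_single when_def in_keys_iff sum.delta' intro!: sum.cong)

text \<open>A finitely supported function is a finite sum of monomials, so a property stable under
  sums needs checking on \<open>single\<close> only. Bilinear identities are reduced to monomials by
  applying this once in each argument.\<close>

lemma poly_mapping_add_induct [case_names zero single add]:
  assumes "P 0" and "\<And>k a. P (Poly_Mapping.single k a)" and "\<And>p q. P p \<Longrightarrow> P q \<Longrightarrow> P (p + q)"
  shows "P (p :: 'm \<Rightarrow>\<^sub>0 'a::comm_monoid_add)"
proof -
  have "P (\<Sum>k\<in>A. Poly_Mapping.single k (f k))" for A and f :: "'m \<Rightarrow> 'a"
    by (induction A rule: infinite_finite_induct) (auto intro: assms)
  then show ?thesis by (metis poly_mapping_sum_single)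
qed

text \<open>The common form of \<open>push\<close>, \<open>word_lift\<close> and
  \<open>rep_entry\<close>. Their targets (polynomials, power series, matrix entries) carry
  different scalar actions, so the rules ask only for additivity in the coefficient.\<close>

definition linear_ext :: "('m \<Rightarrow> 'k::ab_group_add \<Rightarrow> 'b::ab_group_add) \<Rightarrow> ('m \<Rightarrow>\<^sub>0 'k) \<Rightarrow> 'b" where
  "linear_ext h p = (\<Sum>k\<in>Poly_Mapping.keys p. h k (Poly_Mapping.lookup p k))"

context
  fixes h :: "'m \<Rightarrow> 'k::ab_group_add \<Rightarrow> 'b::ab_group_add"
  assumes h_add: "\<And>k a b. h k (a + b) = h k a + h k b"
begin

lemma h_zero: "h k 0 = 0"
  using h_add[of k 0 0] by simp

lemma linear_ext_superset:
  assumes "finite A" "Poly_Mapping.keys p \<subseteq> A"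
  shows "linear_ext h p = (\<Sum>k\<in>A. h k (Poly_Mapping.lookup p k))"
  unfolding linear_ext_def using assms
  by (intro sum.mono_neutral_left) (auto simp: in_keys_iff h_zero)

lemma linear_ext_zero: "linear_ext h 0 = 0"
  by (simp add: linear_ext_def)

lemma linear_ext_single: "linear_ext h (Poly_Mapping.single k a) = h k a"
  by (subst linear_ext_superset[of "{k}"]) (auto split: if_splits)

lemma linear_ext_add: "linear_ext h (p + q) = linear_ext h p + linear_ext h q"
proof -
  let ?A = "Poly_Mapping.keys p \<union> Poly_Mapping.keys q"
  have A: "finite ?A" "Poly_Mapping.keys p \<subseteq> ?A" "Poly_Mapping.keys q \<subseteq> ?A"
      "Poly_Mapping.keys (p + q) \<subseteq> ?A"
    using keys_add[of p q] by auto
  show ?thesis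
    unfolding linear_ext_superset[OF A(1,2)] linear_ext_superset[OF A(1,3)]
      linear_ext_superset[OF A(1,4)] by (simp add: lookup_add h_add sum.distrib)
qed

lemma linear_ext_sum: "linear_ext h (sum f A) = (\<Sum>i\<in>A. linear_ext h (f i))"
  by (induction A rule: infinite_finite_induct) (simp_all add: linear_ext_zero linear_ext_add)

end

lemma linear_ext_mult:
  fixes h :: "'m::monoid_add \<Rightarrow> 'k::ring \<Rightarrow> 'b::ring"
  assumes add: "\<And>k a b. h k (a + b) = h k a + h k b"
    and mult: "\<And>k l a b. h (k + l) (a * b) = h k a * h l b"
  shows "linear_ext h (p * q) = linear_ext h p * linear_ext h q"
proof (induction p rule: poly_mapping_add_induct)
  case (single k a)
  show ?case
    by (induction q rule: poly_mapping_add_induct)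
      (simp_all add: linear_ext_zero[OF add] linear_ext_single[OF add] linear_ext_add[OF add] mult_single
        mult algebra_simps)
qed (simp_all add: linear_ext_zero[OF add] linear_ext_add[OF add] algebra_simps)

lemma single_0_commute:
  "Poly_Mapping.single 0 a * p = p * (Poly_Mapping.single 0 a :: 'm::monoid_add \<Rightarrow>\<^sub>0 'k::comm_ring)"
  by (induction p rule: poly_mapping_add_induct) (simp_all add: mult_single algebra_simps)

section \<open>Scalars\<close>

lemma scalar_nth: "scalar a $ n = Poly_Mapping.single 0 (a $ n)"
  by (simp add: scalar_def)

lemma scalar_0 [simp]: "scalar 0 = 0"
  by (simp add: fps_eq_iff scalar_nth)

lemma scalar_1 [simp]: "scalar 1 = 1"
  by (simp add: fps_eq_iff scalar_nth)

lemma scalar_add: "scalar (a + b) = scalar a + scalar b"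
  by (simp add: fps_eq_iff scalar_nth single_add)

lemma scalar_uminus: "scalar (- a) = - scalar a"
  by (simp add: fps_eq_iff scalar_nth single_uminus)

lemma single_sum: "Poly_Mapping.single k (sum f A) = (\<Sum>i\<in>A. Poly_Mapping.single k (f i))"
  by (induction A rule: infinite_finite_induct) (simp_all add: single_add)

lemma scalar_mult: "scalar (a * b) = scalar a * scalar b"
  by (simp add: fps_eq_iff scalar_nth fps_mult_nth single_sum mult_single)

lemma scalar_power: "scalar (a ^ n) = scalar a ^ n"
  by (induction n) (simp_all add: scalar_mult)

lemma scalar_numeral [simp]: "scalar (numeral n) = numeral n"
  by (induction n) (simp_all only: numeral.simps scalar_add scalar_1)

lemma scalar_commute: "scalar a * x = x * scalar a"
proof (rule fps_ext)
  fix n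
  have "(\<Sum>i = 0..n. scalar a $ i * x $ (n - i)) = (\<Sum>i = 0..n. x $ (n - i) * scalar a $ i)"
    by (simp add: scalar_nth single_0_commute)
  also have "\<dots> = (\<Sum>i = 0..n. x $ i * scalar a $ (n - i))"
    by (rule sum.reindex_bij_witness[of _ "\<lambda>i. n - i" "\<lambda>i. n - i"]) auto
  finally show "(scalar a * x) $ n = (x * scalar a) $ n" by (simp add: fps_mult_nth)
qed

lemma scalar_left_commute: "x * (scalar a * y) = scalar a * (x * y)"
  by (metis mult.assoc scalar_commute)

lemma scalar_const_mult_nth:
  fixes x :: "('m::monoid_add \<Rightarrow>\<^sub>0 'k::field_char_0) fps"
  shows "(scalar (fps_const a) * x) $ n = Poly_Mapping.single 0 a * x $ n"
proof -
  have "scalar (fps_const a) = (fps_const (Poly_Mapping.single 0 a) :: ('m \<Rightarrow>\<^sub>0 'k) fps)"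
    by (simp add: fps_eq_iff scalar_nth fps_nth_fps_const)
  then show ?thesis by (simp only: fps_mult_left_const_nth)
qed

lemma scalar_fps_X: "scalar fps_X = (fps_X :: ('m::monoid_add \<Rightarrow>\<^sub>0 'k::field_char_0) fps)"
  by (simp add: fps_eq_iff scalar_nth fps_X_nth)

text \<open>Undoes the division by h in the bracket of K and P. It applies in the free algebras;
  cancelling h modulo an ideal would need a separate argument.\<close>

lemma fps_X_cancel_left:
  assumes "fps_X * x = fps_X * (y :: 'a::ring_1 fps)"
  shows "x = y"
proof (rule fps_ext)
  fix n
  from assms have "(fps_X * x) $ Suc n = (fps_X * y) $ Suc n" by simp
  then show "x $ n = y $ n" by simp
qed

lemma fps_X_mult_shift: "x $ 0 = 0 \<Longrightarrow> fps_X * fps_shift 1 x = (x :: 'a::ring_1 fps)"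
  by (rule fps_ext) (simp add: fps_X_mult_nth)

section \<open>Infinite sums of power series\<close>

text \<open>Orders growing at least linearly make every coefficient of the sum a finite sum.\<close>

definition fps_summable :: "(nat \<Rightarrow> 'a::zero fps) \<Rightarrow> bool" where
  "fps_summable a \<longleftrightarrow> (\<forall>k n. n < k \<longrightarrow> a k $ n = 0)"

definition fps_suminf :: "(nat \<Rightarrow> 'a::comm_monoid_add fps) \<Rightarrow> 'a fps" where
  "fps_suminf a = Abs_fps (\<lambda>n. \<Sum>k\<le>n. a k $ n)"

lemma fps_summableI: "(\<And>k n. n < k \<Longrightarrow> a k $ n = 0) \<Longrightarrow> fps_summable a"
  by (simp add: fps_summable_def)

lemma fps_suminf_nth: "fps_suminf a $ n = (\<Sum>k\<le>n. a k $ n)"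
  by (simp add: fps_suminf_def)

lemma fps_suminf_nth_ge:
  assumes "fps_summable a" "n \<le> N"
  shows "fps_suminf a $ n = (\<Sum>k\<le>N. a k) $ n"
  unfolding fps_suminf_nth fps_sum_nth using assms
  by (intro sum.mono_neutral_left) (auto simp: fps_summable_def)

lemma fps_mult_nth_cong:
  assumes "\<And>i. i \<le> n \<Longrightarrow> x $ i = x' $ i" "\<And>i. i \<le> n \<Longrightarrow> y $ i = y' $ i"
  shows "(x * y) $ n = (x' * y') $ n"
  by (simp add: fps_mult_nth assms)

lemma fps_suminf_cong: "(\<And>k. a k = b k) \<Longrightarrow> fps_suminf a = fps_suminf b"
  by (simp add: fps_suminf_def)

lemma fps_suminf_add: "fps_suminf (\<lambda>k. a k + b k) = fps_suminf a + fps_suminf b"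
  by (simp add: fps_eq_iff fps_suminf_nth sum.distrib)

lemma fps_suminf_mult_right:
  assumes "fps_summable a"
  shows "fps_suminf a * x = fps_suminf (\<lambda>k. a k * (x :: 'a::ring_1 fps))"
proof (rule fps_ext)
  fix n
  have "(fps_suminf a * x) $ n = ((\<Sum>k\<le>n. a k) * x) $ n"
    by (rule fps_mult_nth_cong) (simp_all add: fps_suminf_nth_ge[OF assms])
  then show "(fps_suminf a * x) $ n = fps_suminf (\<lambda>k. a k * x) $ n"
    by (simp add: sum_distrib_right fps_suminf_nth fps_sum_nth)
qed

lemma fps_mult_nth_eq_0:
  fixes x y :: "'a::ring_1 fps"
  assumes "\<And>i. i < k \<Longrightarrow> x $ i = 0" "\<And>i. i < l \<Longrightarrow> y $ i = 0" "n < k + l"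
  shows "(x * y) $ n = 0"
  unfolding fps_mult_nth
proof (rule sum.neutral, safe)
  fix i assume "i \<in> {0..n}"
  then show "x $ i * y $ (n - i) = 0"
    using assms by (cases "i < k") auto
qed

lemma fps_suminf_mult:
  assumes "fps_summable a" "fps_summable b"
  shows "fps_suminf a * fps_suminf b = fps_suminf (\<lambda>m. \<Sum>i\<le>m. a i * (b (m - i) :: 'a::ring_1 fps))"
proof (rule fps_ext)
  fix n
  \<comment> \<open>The orders of the factors add up, so only pairs with
    \<open>i + j \<le> n\<close> survive and the square of indices shrinks to a triangle.\<close>
  have van: "(a i * b j) $ n = 0" if "\<not> i + j \<le> n" for i j
    by (rule fps_mult_nth_eq_0[of i _ j]) (use that assms in \<open>auto simp: fps_summable_def\<close>)
  have "(fps_suminf a * fps_suminf b) $ n = ((\<Sum>k\<le>n. a k) * (\<Sum>k\<le>n. b k)) $ n"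
    by (rule fps_mult_nth_cong) (simp_all add: fps_suminf_nth_ge assms)
  also have "\<dots> = (\<Sum>(i,j)\<in>{..n} \<times> {..n}. (a i * b j) $ n)"
    by (simp add: sum_product fps_sum_nth sum.cartesian_product[symmetric])
  also have "\<dots> = (\<Sum>(i,j)\<in>{(i,j). i + j \<le> n}. (a i * b j) $ n)"
    by (rule sum.mono_neutral_right) (use van in \<open>auto dest: add_leD1 add_leD2\<close>)
  also have "\<dots> = (\<Sum>k\<le>n. \<Sum>i\<le>k. (a i * b (k - i)) $ n)"
    by (rule sum.triangle_reindex_eq)
  finally show "(fps_suminf a * fps_suminf b) $ n = fps_suminf (\<lambda>m. \<Sum>i\<le>m. a i * b (m - i)) $ n"
    by (simp add: fps_suminf_nth fps_sum_nth)
qed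

lemma fps_suminf_in_pairs:
  assumes "fps_summable a"
  shows "fps_suminf a = fps_suminf (\<lambda>k. a (2 * k) + a (Suc (2 * k)))"
proof (rule fps_ext)
  fix n
  \<comment> \<open>The bound \<open>Suc (2 * n)\<close> completes the last pair; the terms with
    index above \<open>n\<close> do not contribute in degree \<open>n\<close>.\<close>
  have "fps_suminf a $ n = (\<Sum>k\<le>Suc (2 * n). a k) $ n"
    by (rule fps_suminf_nth_ge) (simp_all add: assms)
  then show "fps_suminf a $ n = fps_suminf (\<lambda>k. a (2 * k) + a (Suc (2 * k))) $ n"
    by (simp only: fps_sum_nth sum.in_pairs_0 fps_suminf_nth fps_add_nth)
qed

lemma fps_power_nth_eq_0: "x $ 0 = 0 \<Longrightarrow> n < k \<Longrightarrow> (x ^ k :: 'a::ring_1 fps) $ n = 0"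
  by (rule startsby_zero_power_prefix[rule_format]) 

section \<open>Substitution into a power series\<close>

abbreviation const_scalar :: "'k::field_char_0 \<Rightarrow> ('m::monoid_add \<Rightarrow>\<^sub>0 'k) fps" where
  "const_scalar a \<equiv> scalar (fps_const a)"

lemma const_scalar_add: "const_scalar (a + b) = const_scalar a + const_scalar b"
  by (simp add: fps_eq_iff scalar_nth single_add fps_nth_fps_const)

lemma const_scalar_mult: "const_scalar (a * b) = const_scalar a * const_scalar b"
  by (simp flip: scalar_mult)

lemma const_scalar_sum: "const_scalar (sum f A) = (\<Sum>i\<in>A. const_scalar (f i))"
  by (induction A rule: infinite_finite_induct) (simp_all add: const_scalar_add)

context
  fixes x :: "('m::monoid_add \<Rightarrow>\<^sub>0 'k::field_char_0) fps"
  assumes x0: "x $ 0 = 0"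
begin

lemma summable_series: "fps_summable (\<lambda>k. const_scalar (s k) * x ^ k)"
  by (rule fps_summableI) (simp add: scalar_const_mult_nth fps_power_nth_eq_0 x0)

lemma series_at_eq_fps_suminf: "series_at s x = fps_suminf (\<lambda>k. const_scalar (s $ k) * x ^ k)"
  by (rule fps_ext)
    (simp add: series_at_def fps_compose_nth fps_suminf_nth scalar_const_mult_nth scalar_nth
      atLeast0AtMost)

text \<open>The coefficient ring may be noncommutative, but only powers of one \<open>x\<close> and
  central scalars are multiplied, so the Cauchy product is the ordinary product of series.\<close>

lemma series_at_mult: "series_at (s * t) x = series_at s x * series_at t x"
proof -
  have "series_at s x * series_at t x =
      fps_suminf (\<lambda>m. \<Sum>i\<le>m. const_scalar (s $ i) * x ^ i * (const_scalar (t $ (m - i)) * x ^ (m - i)))"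
    unfolding series_at_eq_fps_suminf by (rule fps_suminf_mult[OF summable_series summable_series])
  also have "\<dots> = fps_suminf (\<lambda>m. const_scalar ((s * t) $ m) * x ^ m)"
  proof (rule fps_suminf_cong)
    fix m
    have "const_scalar (s $ i) * x ^ i * (const_scalar (t $ (m - i)) * x ^ (m - i)) =
        const_scalar (s $ i * t $ (m - i)) * x ^ m" if "i \<le> m" for i
    proof -
      have "x ^ i * x ^ (m - i) = x ^ m" using that by (simp flip: power_add)
      then show ?thesis
        by (simp add: const_scalar_mult mult.assoc scalar_left_commute[of "x ^ i"])
    qed
    then show "(\<Sum>i\<le>m. const_scalar (s $ i) * x ^ i * (const_scalar (t $ (m - i)) * x ^ (m - i))) =
        const_scalar ((s * t) $ m) * x ^ m"
      by (simp add: fps_mult_nth const_scalar_sum sum_distrib_right atLeast0AtMost)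
  qed
  finally show ?thesis by (simp add: series_at_eq_fps_suminf)
qed

lemma series_at_add: "series_at (s + t) x = series_at s x + series_at t x"
  by (simp add: series_at_eq_fps_suminf const_scalar_add algebra_simps fps_suminf_add)

lemma series_at_const: "series_at (fps_const a) x = const_scalar a"
proof -
  have "(\<Sum>i = 0..n. Poly_Mapping.single 0 (if i = 0 then a else 0) * x ^ i $ n) =
      (\<Sum>i = 0..n. if i = 0 then Poly_Mapping.single 0 a * x ^ i $ n else 0)" for n
    by (rule sum.cong) auto
  then show ?thesis
    by (simp add: series_at_def fps_eq_iff fps_compose_nth scalar_nth)
qed

lemma series_at_1: "series_at 1 x = 1"
  using series_at_const[of 1] by simp

lemma series_at_uminus: "series_at (- s) x = - series_at s x"
  using series_at_add[of s "- s"] series_at_const[of 0] by (simp add: eq_neg_iff_add_eq_0 add.commute)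

lemma series_at_diff: "series_at (s - t) x = series_at s x - series_at t x"
  using series_at_add[of s "- t"] by (simp add: series_at_uminus)

lemma series_at_X: "series_at fps_X x = x"
proof (rule fps_ext)
  fix n
  have "(\<Sum>i = 0..n. (if i = Suc 0 then 1 else 0) * x ^ i $ n) =
      (\<Sum>i = 0..n. if i = Suc 0 then x ^ i $ n else 0)"
    by (rule sum.cong) auto
  then show "series_at fps_X x $ n = x $ n"
    by (cases n) (simp_all add: series_at_def fps_compose_nth scalar_fps_X x0)
qed

lemma series_at_power: "series_at (s ^ n) x = series_at s x ^ n"
  by (induction n) (simp_all add: series_at_1 series_at_mult)

lemma series_at_nth_0: "series_at s x $ 0 = Poly_Mapping.single 0 (s $ 0)"
  by (simp add: series_at_def scalar_nth)

lemma series_at_compose: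
  assumes "t $ 0 = 0"
  shows "series_at (s oo t) x = series_at s (series_at t x)"
proof (rule fps_ext)
  fix n
  have t0: "series_at t x $ 0 = 0" by (simp add: series_at_nth_0 assms)
  \<comment> \<open>As \<open>t\<close> has no constant term, \<open>t ^ k\<close> starts in degree
    \<open>k\<close>. This cuts the inner sum down to the range that occurs in the coefficient of
    \<open>s oo t\<close>.\<close>
  have van: "const_scalar (s $ k * (t ^ k) $ m) * x ^ m = 0" if "m < k" for k m
    using that assms by (simp add: fps_power_nth_eq_0)
  have "series_at s (series_at t x) $ n = (\<Sum>k\<le>n. (const_scalar (s $ k) * series_at (t ^ k) x) $ n)"
    by (simp add: series_at_def[of s] fps_compose_nth scalar_nth scalar_const_mult_nth series_at_power
        atLeast0AtMost)
  also have "\<dots> = (\<Sum>k\<le>n. \<Sum>m\<le>n. (const_scalar (s $ k * (t ^ k) $ m) * x ^ m) $ n)"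
    by (simp add: scalar_const_mult_nth series_at_eq_fps_suminf fps_suminf_nth const_scalar_mult mult.assoc
        sum_distrib_left)
  also have "\<dots> = (\<Sum>m\<le>n. \<Sum>k\<le>n. (const_scalar (s $ k * (t ^ k) $ m) * x ^ m) $ n)"
    by (rule sum.swap)
  also have "\<dots> = (\<Sum>m\<le>n. \<Sum>k\<le>m. (const_scalar (s $ k * (t ^ k) $ m) * x ^ m) $ n)"
    by (intro sum.cong refl sum.mono_neutral_right) (auto simp: van)
  also have "\<dots> = (\<Sum>m\<le>n. (const_scalar ((s oo t) $ m) * x ^ m) $ n)"
    by (simp add: fps_compose_nth const_scalar_sum sum_distrib_right fps_sum_nth
        atLeast0AtMost)
  also have "\<dots> = series_at (s oo t) x $ n"
    by (simp add: series_at_eq_fps_suminf fps_suminf_nth)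
  finally show "series_at (s oo t) x $ n = series_at s (series_at t x) $ n" by simp
qed

lemma exp_at_scale: "series_at (fps_exp a) x = exp_at (const_scalar a * x)"
proof -
  have "(const_scalar a * x) ^ n = const_scalar (a ^ n) * x ^ n" for n
    by (induction n) (simp_all add: const_scalar_mult mult.assoc scalar_left_commute[of x])
  then have "((const_scalar a * x) ^ n) $ m = Poly_Mapping.single 0 (a ^ n) * (x ^ n) $ m" for n m
    by (simp add: scalar_const_mult_nth)
  then show ?thesis
    by (simp add: series_at_def fps_eq_iff fps_compose_nth scalar_nth mult.assoc[symmetric]
        mult_single)
qed

end

section \<open>Closed ideals\<close>

text \<open>Congruence modulo \<open>h ^ (n + 1)\<close>. The bound is inclusive, to match the
  strict inequality \<open>dist x y < inverse (2 ^ n)\<close>.\<close>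

definition fps_agree :: "nat \<Rightarrow> 'a fps \<Rightarrow> 'a fps \<Rightarrow> bool" where
  "fps_agree n x y \<longleftrightarrow> (\<forall>i\<le>n. x $ i = y $ i)"

lemma fps_agree_mult:
  "fps_agree n x x' \<Longrightarrow> fps_agree n y y' \<Longrightarrow> fps_agree n (x * y) (x' * (y' :: 'a::ring_1 fps))"
  unfolding fps_agree_def by (auto intro!: fps_mult_nth_cong)

lemma fps_agree_add:
  "fps_agree n x x' \<Longrightarrow> fps_agree n y y' \<Longrightarrow> fps_agree n (x + y) (x' + (y' :: 'a::ring_1 fps))"
  by (simp add: fps_agree_def)

lemma fps_agree_diff:
  "fps_agree n x x' \<Longrightarrow> fps_agree n y y' \<Longrightarrow> fps_agree n (x - y) (x' - (y' :: 'a::ring_1 fps))"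
  by (simp add: fps_agree_def)

lemma fps_agree_refl [simp]: "fps_agree n x x"
  by (simp add: fps_agree_def)

lemma fps_agree_suminf: "fps_summable a \<Longrightarrow> fps_agree n (fps_suminf a) (\<Sum>k\<le>n. a k)"
  by (simp add: fps_agree_def fps_suminf_nth_ge)

lemma fps_dist_less_iff_agree:
  "dist x y < inverse (2 ^ n) \<longleftrightarrow> fps_agree n x (y :: 'a::group_add fps)"
proof (cases "x = y")
  case False
  then have "dist x y < inverse (2 ^ n) \<longleftrightarrow> n < subdegree (x - y)"
    by (simp add: dist_fps_def)
  also have "\<dots> \<longleftrightarrow> (\<forall>i\<le>n. (x - y) $ i = 0)"
  proof
    assume "\<forall>i\<le>n. (x - y) $ i = 0"
    then show "n < subdegree (x - y)"
      by (rule_tac subdegree_greaterI) (use False in auto)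
  qed (meson le_less_trans nth_less_subdegree_zero)
  finally show ?thesis by (simp add: fps_agree_def)
qed simp

lemma fps_closure_iff:
  "x \<in> closure S \<longleftrightarrow> (\<forall>n. \<exists>y\<in>S. fps_agree n x (y :: 'a::group_add fps))"
proof
  assume x: "x \<in> closure S"
  show "\<forall>n. \<exists>y\<in>S. fps_agree n x y"
  proof
    fix n
    have "0 < inverse (2 ^ n :: real)" by simp
    with x obtain y where "y \<in> S" "dist y x < inverse (2 ^ n)"
      unfolding closure_approachable by blast
    then show "\<exists>y\<in>S. fps_agree n x y"
      by (metis dist_commute fps_dist_less_iff_agree)
  qed
next
  assume *: "\<forall>n. \<exists>y\<in>S. fps_agree n x y"
  show "x \<in> closure S"
    unfolding closure_approachable
  proof (intro allI impI)
    fix e :: real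
    assume "0 < e"
    then obtain n where n: "inverse (2 ^ n) < e"
      using real_arch_pow_inv[of e "1 / 2"] by (auto simp: power_one_over inverse_eq_divide)
    from * obtain y where "y \<in> S" "fps_agree n x y" by blast
    with n have "y \<in> S" "dist y x < e"
      by (auto simp: dist_commute simp flip: fps_dist_less_iff_agree)
    then show "\<exists>y\<in>S. dist y x < e" by blast
  qed
qed

text \<open>An h-adically closed two-sided ideal, with closedness phrased by congruences rather than
  topology. Kernels of representations and preimages under homomorphisms are checked against these
  axioms directly; negatives come from multiplication by \<open>- 1\<close>.\<close>

locale fps_closed_ideal =
  fixes I :: "'a::ring_1 fps set"
  assumes zero_mem: "0 \<in> I"
    and add_mem: "x \<in> I \<Longrightarrow> y \<in> I \<Longrightarrow> x + y \<in> I"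
    and mult_left_mem: "x \<in> I \<Longrightarrow> y * x \<in> I"
    and mult_right_mem: "x \<in> I \<Longrightarrow> x * y \<in> I"
    and limit_mem: "(\<And>n. \<exists>y\<in>I. fps_agree n x y) \<Longrightarrow> x \<in> I"
begin

lemma uminus_mem: "x \<in> I \<Longrightarrow> - x \<in> I"
  using mult_left_mem[of x "- 1"] by simp

lemma diff_mem: "x \<in> I \<Longrightarrow> y \<in> I \<Longrightarrow> x - y \<in> I"
  using add_mem[of x "- y"] uminus_mem by simp

lemma sum_mem: "(\<And>k. k \<in> A \<Longrightarrow> f k \<in> I) \<Longrightarrow> sum f A \<in> I"
  by (induction A rule: infinite_finite_induct) (auto intro: zero_mem add_mem)

lemma suminf_mem: "fps_summable a \<Longrightarrow> (\<And>k. a k \<in> I) \<Longrightarrow> fps_suminf a \<in> I"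
  using fps_agree_suminf by (blast intro: limit_mem sum_mem)

lemmas mem_intros = zero_mem add_mem mult_left_mem mult_right_mem uminus_mem diff_mem

lemma cong_trans: "x - y \<in> I \<Longrightarrow> y - z \<in> I \<Longrightarrow> x - z \<in> I"
  using add_mem[of "x - y" "y - z"] by simp

lemma cong_sym: "x - y \<in> I \<Longrightarrow> y - x \<in> I"
  using uminus_mem[of "x - y"] by simp

lemma cong_mult:
  assumes "x - x' \<in> I" "y - y' \<in> I"
  shows "x * y - x' * y' \<in> I"
proof -
  have "x * y - x' * y' = (x - x') * y + x' * (y - y')"
    by (simp add: algebra_simps)
  then show ?thesis by (simp add: assms mem_intros)
qed

end

section \<open>Ideals and quotients in the sense of the algebra library\<close>

lemma ring_type_ring: "ring (type_ring :: 'a::ring_1 ring)"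
proof (rule ringI)
  show "abelian_group (type_ring :: 'a ring)"
    by (rule abelian_groupI) (auto simp: type_ring_def algebra_simps intro: exI[of _ "- x" for x])
  show "Group.monoid (type_ring :: 'a ring)"
    by (rule Group.monoidI) (auto simp: type_ring_def algebra_simps)
qed (auto simp: type_ring_def algebra_simps)

lemma a_inv_type_ring: "a_inv type_ring x = - (x :: 'a::ring_1)"
proof -
  interpret ring "type_ring :: 'a ring" by (rule ring_type_ring)
  have "- x \<oplus>\<^bsub>type_ring\<^esub> x = \<zero>\<^bsub>type_ring\<^esub>" "x \<in> carrier type_ring" "- x \<in> carrier type_ring"
    by (simp_all add: type_ring_def)
  then show ?thesis by (rule minus_equality)
qed

lemma ideal_type_ring_iff:
  "ideal I (type_ring :: 'a::ring_1 ring) \<longleftrightarrow>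
    0 \<in> I \<and> (\<forall>x\<in>I. \<forall>y\<in>I. x + y \<in> I) \<and> (\<forall>x\<in>I. \<forall>y. y * x \<in> I \<and> x * y \<in> I)"
  (is "?L \<longleftrightarrow> ?R")
proof
  assume ?L
  then interpret ideal I "type_ring :: 'a ring" .
  show ?R
    using additive_subgroup.a_closed[OF is_additive_subgroup] I_l_closed I_r_closed
      additive_subgroup.zero_closed[OF is_additive_subgroup]
    by (auto simp: type_ring_def)
next
  assume R: ?R
  have "- x \<in> I" if "x \<in> I" for x
    using R that by (metis mult_minus1)
  moreover have "inv\<^bsub>add_monoid (type_ring :: 'a ring)\<^esub> x = - x" for x
    using a_inv_type_ring[of x] by (simp add: a_inv_def)
  ultimately have "subgroup I (add_monoid (type_ring :: 'a ring))"
    using R by (intro group.subgroupI abelian_group.a_group ring.is_abelian_group ring_type_ring)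
      (simp_all, auto simp: type_ring_def)
  then show ?L
    by (rule idealI[OF ring_type_ring]) (use R in \<open>auto simp: type_ring_def\<close>)
qed

lemma (in fps_closed_ideal) ideal_type_ring: "ideal I type_ring"
  by (auto simp: ideal_type_ring_iff mem_intros)

lemma genideal_type_ring:
  "ideal (Idl\<^bsub>type_ring\<^esub> S) type_ring" "S \<subseteq> Idl\<^bsub>type_ring\<^esub> S"
proof -
  have "S \<subseteq> carrier type_ring" by (simp add: type_ring_def)
  then show "ideal (Idl\<^bsub>type_ring\<^esub> S) type_ring" "S \<subseteq> Idl\<^bsub>type_ring\<^esub> S"
    by (simp_all add: ring.genideal_ideal ring.genideal_self ring_type_ring)
qed

text \<open>The coefficients up to \<open>n\<close> of a sum or product depend only on the
  coefficients up to \<open>n\<close> of the arguments, so approximants from the ideal combine to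
  approximants from the ideal.\<close>

lemma fps_closed_ideal_closed_ideal: "fps_closed_ideal (closed_ideal S)"
proof
  let ?J = "Idl\<^bsub>type_ring\<^esub> S"
  have J: "0 \<in> ?J" "\<And>x y. x \<in> ?J \<Longrightarrow> y \<in> ?J \<Longrightarrow> x + y \<in> ?J"
      "\<And>x y. x \<in> ?J \<Longrightarrow> y * x \<in> ?J" "\<And>x y. x \<in> ?J \<Longrightarrow> x * y \<in> ?J"
    using genideal_type_ring(1)[of S] by (auto simp: ideal_type_ring_iff)
  show "0 \<in> closed_ideal S"
    unfolding closed_ideal_def fps_closure_iff using J(1) fps_agree_refl by blast
  show "x + y \<in> closed_ideal S" if "x \<in> closed_ideal S" "y \<in> closed_ideal S" for x y
    using that J(2) unfolding closed_ideal_def fps_closure_iff by (meson fps_agree_add)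
  show "y * x \<in> closed_ideal S" if "x \<in> closed_ideal S" for x y
    using that J(3) unfolding closed_ideal_def fps_closure_iff by (meson fps_agree_mult fps_agree_refl)
  show "x * y \<in> closed_ideal S" if "x \<in> closed_ideal S" for x y
    using that J(4) unfolding closed_ideal_def fps_closure_iff by (meson fps_agree_mult fps_agree_refl)
  show "x \<in> closed_ideal S" if "\<And>n. \<exists>y\<in>closed_ideal S. fps_agree n x y" for x
    unfolding closed_ideal_def fps_closure_iff
  proof
    fix n
    from that obtain y where "y \<in> closed_ideal S" "fps_agree n x y" by blast
    moreover from this obtain z where "z \<in> ?J" "fps_agree n y z"
      unfolding closed_ideal_def fps_closure_iff by blast
    ultimately show "\<exists>z\<in>?J. fps_agree n x z" by (auto simp: fps_agree_def)
  qed
qed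

lemma closed_ideal_superset: "S \<subseteq> closed_ideal S"
  unfolding closed_ideal_def using genideal_type_ring(2) closure_subset by blast

text \<open>The universal property by which inclusions between the ideals below are reduced to
  generators.\<close>

lemma closed_ideal_least:
  assumes "fps_closed_ideal J" "S \<subseteq> J"
  shows "closed_ideal S \<subseteq> J"
proof
  fix x assume "x \<in> closed_ideal S"
  interpret J: fps_closed_ideal J by fact
  have "Idl\<^bsub>type_ring\<^esub> S \<subseteq> J"
    by (rule ring.genideal_minimal[OF ring_type_ring J.ideal_type_ring assms(2)])
  then show "x \<in> J"
    using \<open>x \<in> closed_ideal S\<close> J.limit_mem unfolding closed_ideal_def fps_closure_iff by blast
qed

lemma coset_type_ring: "I +>\<^bsub>type_ring\<^esub> x = (\<lambda>h. h + x) ` (I :: 'a::ring_1 set)"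
  by (auto simp: a_r_coset_def r_coset_def type_ring_def)

context fps_closed_ideal
begin

interpretation ideal I "type_ring" by (rule ideal_type_ring)

lemma coset_eq_iff: "I +>\<^bsub>type_ring\<^esub> x = I +>\<^bsub>type_ring\<^esub> y \<longleftrightarrow> x - y \<in> I"
proof
  assume "I +>\<^bsub>type_ring\<^esub> x = I +>\<^bsub>type_ring\<^esub> y"
  moreover have "x \<in> I +>\<^bsub>type_ring\<^esub> x"
    unfolding coset_type_ring using zero_mem by force
  ultimately show "x - y \<in> I" by (auto simp: coset_type_ring)
next
  assume d: "x - y \<in> I"
  have "\<exists>g\<in>I. h + x = g + y" "\<exists>g\<in>I. h + y = g + x" if "h \<in> I" for h
    using that d by (auto intro: bexI[of _ "h + (x - y)"] bexI[of _ "h - (x - y)"] add_mem diff_mem)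
  then show "I +>\<^bsub>type_ring\<^esub> x = I +>\<^bsub>type_ring\<^esub> y"
    unfolding coset_type_ring by (auto simp: image_iff)
qed

lemma coset_mult:
  "(I +>\<^bsub>type_ring\<^esub> x) \<otimes>\<^bsub>type_ring Quot I\<^esub> (I +>\<^bsub>type_ring\<^esub> y) = I +>\<^bsub>type_ring\<^esub> (x * y)"
  using rcoset_mult_add[of x y] by (simp add: FactRing_def) (simp add: type_ring_def)

lemma coset_add:
  "(I +>\<^bsub>type_ring\<^esub> x) \<oplus>\<^bsub>type_ring Quot I\<^esub> (I +>\<^bsub>type_ring\<^esub> y) = I +>\<^bsub>type_ring\<^esub> (x + y)"
  using a_rcos_sum[of x y] by (simp add: FactRing_def) (simp add: type_ring_def)

lemma coset_one: "\<one>\<^bsub>type_ring Quot I\<^esub> = I +>\<^bsub>type_ring\<^esub> 1"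
  by (simp add: FactRing_def) (simp add: type_ring_def)

lemma coset_zero: "\<zero>\<^bsub>type_ring Quot I\<^esub> = I +>\<^bsub>type_ring\<^esub> 0"
  by (simp add: FactRing_def coset_type_ring)

lemma coset_carrier: "I +>\<^bsub>type_ring\<^esub> x \<in> carrier (type_ring Quot I)"
  by (auto simp: FactRing_def A_RCOSETS_def RCOSETS_def a_r_coset_def type_ring_def)

lemma monoid_quotient: "Group.monoid (type_ring Quot I)"
  using quotient_is_ring ring.is_monoid by blast

end

text \<open>Continuity is automatic, since multiples of \<open>h ^ n\<close> are mapped to multiples of \<open>h ^ n\<close>.\<close>

definition algebra_hom ::
    "(('m::monoid_add \<Rightarrow>\<^sub>0 'k::field_char_0) fps \<Rightarrow> ('n::monoid_add \<Rightarrow>\<^sub>0 'k) fps) \<Rightarrow> bool" where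
  "algebra_hom \<phi> \<longleftrightarrow> (\<forall>x y. \<phi> (x + y) = \<phi> x + \<phi> y) \<and> (\<forall>x y. \<phi> (x * y) = \<phi> x * \<phi> y) \<and>
     (\<forall>a. \<phi> (scalar a) = scalar a)"

lemma fps_eq_X_power_mult_shift:
  assumes "\<And>i. i < n \<Longrightarrow> x $ i = 0"
  shows "x = fps_X ^ n * fps_shift n (x :: 'a::ring_1 fps)"
  by (rule fps_ext) (auto simp: fps_X_power_mult_nth assms)

context
  fixes \<phi> :: "('m::monoid_add \<Rightarrow>\<^sub>0 'k::field_char_0) fps \<Rightarrow> ('n::monoid_add \<Rightarrow>\<^sub>0 'k) fps"
  assumes hom: "algebra_hom \<phi>"
begin

lemma hom_add: "\<phi> (x + y) = \<phi> x + \<phi> y"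
  and hom_mult: "\<phi> (x * y) = \<phi> x * \<phi> y"
  and hom_scalar: "\<phi> (scalar a) = scalar a"
  using hom by (auto simp: algebra_hom_def)

lemma hom_0: "\<phi> 0 = 0"
  using hom_scalar[of 0] by simp

lemma hom_1: "\<phi> 1 = 1"
  using hom_scalar[of 1] by simp

lemma hom_uminus: "\<phi> (- x) = - \<phi> x"
  using hom_add[of x "- x"] by (simp add: hom_0 eq_neg_iff_add_eq_0 add.commute)

lemma hom_diff: "\<phi> (x - y) = \<phi> x - \<phi> y"
  using hom_add[of x "- y"] by (simp add: hom_uminus)

lemma hom_numeral: "\<phi> (numeral n) = numeral n"
  using hom_scalar[of "numeral n"] by simp

lemma hom_power: "\<phi> (x ^ n) = \<phi> x ^ n"
  by (induction n) (simp_all add: hom_1 hom_mult)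

lemma hom_sum: "\<phi> (sum f A) = (\<Sum>i\<in>A. \<phi> (f i))"
  by (induction A rule: infinite_finite_induct) (simp_all add: hom_0 hom_add)

lemma hom_comm: "\<phi> (comm x y) = comm (\<phi> x) (\<phi> y)"
  by (simp add: comm_def hom_diff hom_mult)

lemma hom_fps_X: "\<phi> fps_X = fps_X"
  using hom_scalar[of fps_X] by (simp add: scalar_fps_X)

lemma hom_agree:
  assumes "fps_agree n x y"
  shows "fps_agree n (\<phi> x) (\<phi> y)"
proof -
  have "x - y = fps_X ^ Suc n * fps_shift (Suc n) (x - y)"
    by (rule fps_eq_X_power_mult_shift) (use assms in \<open>auto simp: fps_agree_def\<close>)
  then have "\<phi> x - \<phi> y = fps_X ^ Suc n * \<phi> (fps_shift (Suc n) (x - y))"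
    by (metis hom_diff hom_mult hom_power hom_fps_X)
  then have "(\<phi> x - \<phi> y) $ i = 0" if "i \<le> n" for i
    using that by (simp only: fps_X_power_mult_nth) simp
  then show ?thesis by (simp add: fps_agree_def)
qed

lemma hom_nth_0: "x $ 0 = 0 \<Longrightarrow> \<phi> x $ 0 = 0"
  using hom_agree[of 0 x 0] by (simp add: fps_agree_def hom_0)

lemma hom_series_at:
  assumes x0: "x $ 0 = 0"
  shows "\<phi> (series_at s x) = series_at s (\<phi> x)"
proof (rule fps_ext)
  fix n
  note sx = summable_series[OF x0, of "\<lambda>k. s $ k"]
    and sy = summable_series[OF hom_nth_0[OF x0], of "\<lambda>k. s $ k"]
  have "fps_agree n (\<phi> (series_at s x)) (\<phi> (\<Sum>k\<le>n. const_scalar (s $ k) * x ^ k))"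
    unfolding series_at_eq_fps_suminf[OF x0] by (intro hom_agree fps_agree_suminf sx)
  moreover have "fps_agree n (series_at s (\<phi> x)) (\<Sum>k\<le>n. const_scalar (s $ k) * \<phi> x ^ k)"
    unfolding series_at_eq_fps_suminf[OF hom_nth_0[OF x0]] by (intro fps_agree_suminf sy)
  ultimately show "\<phi> (series_at s x) $ n = series_at s (\<phi> x) $ n"
    by (auto simp: fps_agree_def hom_sum hom_mult hom_scalar hom_power)
qed

lemma closed_ideal_vimage:
  assumes "fps_closed_ideal J"
  shows "fps_closed_ideal (\<phi> -` J)"
proof -
  interpret J: fps_closed_ideal J by fact
  show ?thesis
  proof
    fix x assume x: "\<exists>y\<in>\<phi> -` J. fps_agree n x y" for n
    then have "\<exists>y\<in>J. fps_agree n (\<phi> x) y" for n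
      using hom_agree by blast
    then show "x \<in> \<phi> -` J" by (simp add: J.limit_mem)
  qed (auto simp: hom_add hom_mult hom_0 J.mem_intros)
qed

lemma closed_ideal_image:
  assumes "fps_closed_ideal J" "\<And>s. s \<in> S \<Longrightarrow> \<phi> s \<in> J" "x \<in> closed_ideal S"
  shows "\<phi> x \<in> J"
  using closed_ideal_least[OF closed_ideal_vimage[OF assms(1)], of S] assms(2,3) by blast

text \<open>Well-definedness of \<open>induced\<close>: the image of the whole coset is a single
  coset, so \<open>the_elem\<close> is applied to a singleton.\<close>

lemma induced_coset:
  assumes "fps_closed_ideal I" "fps_closed_ideal J" "\<And>x. x \<in> I \<Longrightarrow> \<phi> x \<in> J"
  shows "induced (\<lambda>y. J +>\<^bsub>type_ring\<^esub> y) \<phi> (I +>\<^bsub>type_ring\<^esub> x) = J +>\<^bsub>type_ring\<^esub> \<phi> x"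
proof -
  have "J +>\<^bsub>type_ring\<^esub> \<phi> y = J +>\<^bsub>type_ring\<^esub> \<phi> x" if "y \<in> I +>\<^bsub>type_ring\<^esub> x" for y
    unfolding fps_closed_ideal.coset_eq_iff[OF assms(2)]
    using that assms(3) by (auto simp: coset_type_ring hom_add)
  moreover have "x \<in> I +>\<^bsub>type_ring\<^esub> x"
    unfolding coset_type_ring using fps_closed_ideal.zero_mem[OF assms(1)] by force
  ultimately have "(\<lambda>y. J +>\<^bsub>type_ring\<^esub> \<phi> y) ` (I +>\<^bsub>type_ring\<^esub> x) = {J +>\<^bsub>type_ring\<^esub> \<phi> x}"
    by blast
  then show ?thesis by (simp add: induced_def)
qed

end

lemmas hom_simps = hom_add hom_mult hom_scalar hom_0 hom_1 hom_uminus hom_diff hom_numeral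
  hom_power hom_sum hom_comm

section \<open>Commutation modulo a closed ideal\<close>

lemma comm_add_left: "comm (x + y) z = comm x z + comm y (z :: 'a::ring_1)"
  and comm_mult_left: "comm (x * y) z = x * comm y z + comm x z * (y :: 'a::ring_1)"
  and comm_diff_left: "comm (x - y) z = comm x z - comm y (z :: 'a::ring_1)"
  and comm_uminus_left: "comm (- x) z = - comm x (z :: 'a::ring_1)"
  and comm_add_right: "comm z (x + y) = comm z x + comm z (y :: 'a::ring_1)"
  and comm_mult_right: "comm z (x * y) = x * comm z y + comm z x * (y :: 'a::ring_1)"
  and comm_diff_right: "comm z (x - y) = comm z x - comm z (y :: 'a::ring_1)"
  by (simp_all add: comm_def algebra_simps)

lemma comm_self: "comm x x = 0"
  by (simp add: comm_def)

context fps_closed_ideal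
begin

text \<open>In the free algebra \<open>M\<close> is not central; it commutes with the generators
  only modulo the ideal. The rules for this relation propagate that to everything built from
  \<open>M\<close>.\<close>

definition commutes :: "'a fps \<Rightarrow> 'a fps \<Rightarrow> bool" where
  "commutes x y \<longleftrightarrow> comm x y \<in> I"

lemma commutes_sym: "commutes x y \<Longrightarrow> commutes y x"
  unfolding commutes_def comm_def by (rule cong_sym)

lemma commutes_if_eq: "x * y = y * x \<Longrightarrow> commutes x y"
  by (simp add: commutes_def comm_def zero_mem)

lemma commutes_add: "commutes x z \<Longrightarrow> commutes y z \<Longrightarrow> commutes (x + y) z"
  and commutes_diff: "commutes x z \<Longrightarrow> commutes y z \<Longrightarrow> commutes (x - y) z"
  and commutes_uminus: "commutes x z \<Longrightarrow> commutes (- x) z"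
  and commutes_mult: "commutes x z \<Longrightarrow> commutes y z \<Longrightarrow> commutes (x * y) z"
  by (simp_all add: commutes_def comm_add_left comm_diff_left comm_uminus_left comm_mult_left
      mem_intros)

lemma commutes_1: "commutes 1 z"
  by (rule commutes_if_eq) simp

lemma commutes_power: "commutes x z \<Longrightarrow> commutes (x ^ n) z"
  by (induction n) (simp_all add: commutes_1 commutes_mult)

lemma commutes_sum: "(\<And>k. k \<in> A \<Longrightarrow> commutes (f k) z) \<Longrightarrow> commutes (sum f A) z"
  by (induction A rule: infinite_finite_induct)
    (auto intro: commutes_add commutes_if_eq)

lemma commutes_limit:
  assumes "\<And>n. \<exists>y. commutes y z \<and> fps_agree n x y"
  shows "commutes x z"
  unfolding commutes_def
proof (rule limit_mem)
  fix n
  from assms obtain y where "commutes y z" "fps_agree n x y" by blast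
  then show "\<exists>w\<in>I. fps_agree n (comm x z) w"
    unfolding commutes_def comm_def by (blast intro: fps_agree_diff fps_agree_mult fps_agree_refl)
qed

end

text \<open>Closedness of the ideal enters here: algebra alone gives commutation only for the
  partial sums.\<close>

lemma commutes_series_at:
  fixes x :: "('m::monoid_add \<Rightarrow>\<^sub>0 'k::field_char_0) fps"
    and J :: "('m \<Rightarrow>\<^sub>0 'k) fps set"
  assumes J: "fps_closed_ideal J" and x0: "x $ 0 = 0"
    and xz: "fps_closed_ideal.commutes J x z"
  shows "fps_closed_ideal.commutes J (series_at s x) z"
proof -
  interpret J: fps_closed_ideal J by (rule J)
  show ?thesis
  proof (rule J.commutes_limit)
    fix n
    have "J.commutes (\<Sum>k\<le>n. const_scalar (s $ k) * x ^ k) z"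
      by (intro J.commutes_sum J.commutes_mult J.commutes_power xz J.commutes_if_eq scalar_commute)
    moreover have "fps_agree n (series_at s x) (\<Sum>k\<le>n. const_scalar (s $ k) * x ^ k)"
      unfolding series_at_eq_fps_suminf[OF x0] by (intro fps_agree_suminf summable_series x0)
    ultimately show "\<exists>y. J.commutes y z \<and> fps_agree n (series_at s x) y" by blast
  qed
qed

section \<open>Products of exponentials\<close>

text \<open>
  Applied to the divided powers \<open>a k = (ad A)\<^sup>k(u) / k!\<close> and \<open>b k = A\<^sup>k / k!\<close>, this is the inductive step
  of the noncommutative binomial theorem.
\<close>

lemma convolution_Suc:
  fixes a b :: "nat \<Rightarrow> 'a::ring_1"
  assumes "\<And>k. of_nat (Suc k) * a (Suc k) = a' k" "\<And>k. of_nat (Suc k) * b (Suc k) = b' k"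
    and "\<And>i j. a' i * b j + a i * b' j = z * (a i * b j)"
  shows "of_nat (Suc m) * (\<Sum>i\<le>Suc m. a i * b (Suc m - i)) = z * (\<Sum>i\<le>m. a i * b (m - i))"
proof -
  \<comment> \<open>A Leibniz rule on indices: \<open>Suc m\<close> is split as
    \<open>i + (Suc m - i)\<close>, one summand for each factor.\<close>
  have split: "of_nat (Suc m) * (a i * b (Suc m - i)) =
      of_nat i * a i * b (Suc m - i) + a i * (of_nat (Suc m - i) * b (Suc m - i))"
    if "i \<le> Suc m" for i
  proof -
    have "a i * (of_nat (Suc m - i) * b (Suc m - i)) = of_nat (Suc m - i) * (a i * b (Suc m - i))"
      by (metis mult.assoc mult_of_nat_commute)
    moreover have "of_nat (Suc m) = (of_nat i + of_nat (Suc m - i) :: 'a)"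
      using that by (simp flip: of_nat_add del: of_nat_Suc)
    ultimately show ?thesis by (simp only: distrib_right mult.assoc)
  qed
  have "of_nat (Suc m) * (\<Sum>i\<le>Suc m. a i * b (Suc m - i)) =
      (\<Sum>i\<le>Suc m. of_nat i * a i * b (Suc m - i)) +
      (\<Sum>i\<le>Suc m. a i * (of_nat (Suc m - i) * b (Suc m - i)))"
    unfolding sum_distrib_left sum.distrib[symmetric]
    by (rule sum.cong[OF refl], rule split) simp
  also have "(\<Sum>i\<le>Suc m. of_nat i * a i * b (Suc m - i)) = (\<Sum>i\<le>m. a' i * b (m - i))"
    by (subst sum.atMost_Suc_shift) (simp add: assms(1) del: of_nat_Suc)
  also have "(\<Sum>i\<le>Suc m. a i * (of_nat (Suc m - i) * b (Suc m - i))) = (\<Sum>i\<le>m. a i * b' (m - i))"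
    by (simp add: assms(2)[symmetric] Suc_diff_le del: of_nat_Suc of_nat_diff)
  also have "(\<Sum>i\<le>m. a' i * b (m - i)) + (\<Sum>i\<le>m. a i * b' (m - i)) =
      (\<Sum>i\<le>m. a' i * b (m - i) + a i * b' (m - i))"
    by (simp add: sum.distrib)
  also have "\<dots> = z * (\<Sum>i\<le>m. a i * b (m - i))"
    by (simp add: assms(3) sum_distrib_left)
  finally show ?thesis .
qed

abbreviation inv_fact :: "nat \<Rightarrow> ('m::monoid_add \<Rightarrow>\<^sub>0 'k::field_char_0) fps" where
  "inv_fact k \<equiv> const_scalar (1 / fact k)"

lemma of_nat_eq_const_scalar: "of_nat n = (const_scalar (of_nat n) :: ('m::monoid_add \<Rightarrow>\<^sub>0 'k::field_char_0) fps)"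
  by (induction n) (simp_all add: const_scalar_add del: fps_const_add)

lemma inv_fact_Suc:
  fixes x :: "('m::monoid_add \<Rightarrow>\<^sub>0 'k::field_char_0) fps"
  shows "of_nat (Suc k) * (inv_fact (Suc k) * x) = inv_fact k * x"
proof -
  have "of_nat (Suc k) * (1 / fact (Suc k)) = (1 / fact k :: 'k)"
    by (simp add: field_simps del: of_nat_Suc)
  then show ?thesis
    unfolding of_nat_eq_const_scalar mult.assoc[symmetric] const_scalar_mult[symmetric] by simp
qed

lemma of_nat_Suc_mult_cancel:
  assumes "of_nat (Suc n) * x = of_nat (Suc n) * (y :: ('m::monoid_add \<Rightarrow>\<^sub>0 'k::field_char_0) fps)"
  shows "x = y"
proof -
  let ?c = "const_scalar (inverse (of_nat (Suc n))) :: ('m \<Rightarrow>\<^sub>0 'k) fps"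
  have "?c * of_nat (Suc n) = 1"
    unfolding of_nat_eq_const_scalar const_scalar_mult[symmetric] by (simp del: of_nat_Suc)
  then have "x = ?c * (of_nat (Suc n) * x)" "y = ?c * (of_nat (Suc n) * y)"
    by (simp_all only: mult.assoc[symmetric] mult_1_left)
  then show ?thesis using assms by simp
qed

text \<open>The recursion for the convolution determines it, since \<open>Suc m\<close> can be
  cancelled in characteristic 0. For commuting x and y it gives the addition theorem of the
  exponential; for ad A it gives conjugation by exp(A).\<close>

lemma convolution_eq_power:
  fixes a b :: "nat \<Rightarrow> ('m::monoid_add \<Rightarrow>\<^sub>0 'k::field_char_0) fps"
  assumes "\<And>k. of_nat (Suc k) * a (Suc k) = a' k" "\<And>k. of_nat (Suc k) * b (Suc k) = b' k"
    and "\<And>i j. a' i * b j + a i * b' j = z * (a i * b j)"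
  shows "(\<Sum>i\<le>m. a i * b (m - i)) = inv_fact m * z ^ m * (a 0 * b 0)"
proof (induction m)
  case (Suc m)
  have "of_nat (Suc m) * (\<Sum>i\<le>Suc m. a i * b (Suc m - i)) = z * (inv_fact m * z ^ m * (a 0 * b 0))"
    unfolding convolution_Suc[OF assms] Suc.IH ..
  also have "\<dots> = inv_fact m * z ^ Suc m * (a 0 * b 0)"
    by (simp add: mult.assoc scalar_left_commute[of z])
  also have "\<dots> = of_nat (Suc m) * (inv_fact (Suc m) * z ^ Suc m * (a 0 * b 0))"
    by (simp only: mult.assoc inv_fact_Suc)
  finally show ?case by (rule of_nat_Suc_mult_cancel)
qed simp

lemma exp_at_eq_suminf:
  "x $ 0 = 0 \<Longrightarrow> exp_at x = fps_suminf (\<lambda>k. inv_fact k * x ^ k)"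
  by (simp add: series_at_eq_fps_suminf fps_exp_def)

lemma exp_at_add:
  fixes x y :: "('m::monoid_add \<Rightarrow>\<^sub>0 'k::field_char_0) fps"
  assumes x0: "x $ 0 = 0" and y0: "y $ 0 = 0" and xy: "x * y = y * x"
  shows "exp_at (x + y) = exp_at x * exp_at y"
proof -
  let ?a = "\<lambda>k. inv_fact k * x ^ k" and ?b = "\<lambda>k. inv_fact k * y ^ k"
  have conv: "(\<Sum>i\<le>m. ?a i * ?b (m - i)) = inv_fact m * (x + y) ^ m * (?a 0 * ?b 0)" for m
  proof (rule convolution_eq_power)
    fix i j
    have "x ^ i * y = y * x ^ i"
      by (metis xy power_commuting_commutes)
    then have "?a i * y = y * ?a i"
      by (simp add: mult.assoc scalar_left_commute[of y])
    then have "?a i * (y * ?b j) = y * (?a i * ?b j)"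
      by (simp only: mult.assoc[symmetric])
    then show "x * ?a i * ?b j + ?a i * (y * ?b j) = (x + y) * (?a i * ?b j)"
      by (simp only: distrib_right mult.assoc)
  next
    show "of_nat (Suc k) * ?a (Suc k) = x * ?a k" "of_nat (Suc k) * ?b (Suc k) = y * ?b k" for k
      by (simp_all only: inv_fact_Suc power_Suc scalar_left_commute[of x] scalar_left_commute[of y])
  qed
  have "exp_at x * exp_at y = fps_suminf (\<lambda>m. \<Sum>i\<le>m. ?a i * ?b (m - i))"
    unfolding exp_at_eq_suminf[OF x0] exp_at_eq_suminf[OF y0]
    by (rule fps_suminf_mult; rule summable_series; fact)
  also have "\<dots> = exp_at (x + y)"
    by (subst exp_at_eq_suminf) (simp_all add: conv x0 y0)
  finally show ?thesis by simp
qed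

lemma exp_at_nth_0: "exp_at x $ 0 = 1"
  by (simp add: series_at_def scalar_nth)

lemma exp_at_0: "exp_at (0 :: ('b::monoid_add \<Rightarrow>\<^sub>0 'a::field_char_0) fps) = 1"
proof (rule fps_ext)
  fix n
  have "(\<Sum>k\<le>n. (inv_fact k * 0 ^ k :: ('b \<Rightarrow>\<^sub>0 'a) fps) $ n) = (\<Sum>k\<le>n. if k = 0 then 1 $ n else 0)"
    by (rule sum.cong) (auto simp: power_0_left)
  then show "exp_at (0 :: ('b \<Rightarrow>\<^sub>0 'a) fps) $ n = 1 $ n"
    by (simp add: exp_at_eq_suminf fps_suminf_nth)
qed

lemma exp_at_uminus:
  assumes "x $ 0 = 0"
  shows "exp_at x * exp_at (- x) = 1" "exp_at (- x) * exp_at x = 1"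
  using exp_at_add[of x "- x"] exp_at_add[of "- x" x] assms by (simp_all add: exp_at_0)

lemma funpow_comm_nth_eq_0:
  assumes "A $ 0 = 0" "n < k"
  shows "((comm A ^^ k) u :: 'a::ring_1 fps) $ n = 0"
  using assms(2)
proof (induction k arbitrary: n)
  case (Suc k)
  have "(A * (comm A ^^ k) u) $ n = 0" "((comm A ^^ k) u * A) $ n = 0"
    using Suc assms(1) by (auto intro: fps_mult_nth_eq_0[of 1 _ k] fps_mult_nth_eq_0[of k _ 1])
  then show ?case by (simp add: comm_def[of A "(comm A ^^ k) u"])
qed simp

lemma summable_funpow_comm:
  assumes "A $ 0 = 0"
  shows "fps_summable (\<lambda>k. const_scalar (s k) * (comm A ^^ k) u)"
  by (rule fps_summableI) (simp add: scalar_const_mult_nth funpow_comm_nth_eq_0 assms)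

text \<open>The identity exp(A) u exp(-A) = exp(ad A)(u), with exp(A) moved to the right. The
  hypothesis of the convolution lemma becomes [A, a] b + a A b = A a b.\<close>

lemma exp_at_conjugation:
  fixes A :: "('m::monoid_add \<Rightarrow>\<^sub>0 'k::field_char_0) fps"
  assumes A0: "A $ 0 = 0"
  shows "exp_at A * u = fps_suminf (\<lambda>k. inv_fact k * (comm A ^^ k) u) * exp_at A"
proof -
  let ?a = "\<lambda>k. inv_fact k * (comm A ^^ k) u" and ?b = "\<lambda>k. inv_fact k * A ^ k"
  have conv: "(\<Sum>i\<le>m. ?a i * ?b (m - i)) = inv_fact m * A ^ m * (?a 0 * ?b 0)" for m
  proof (rule convolution_eq_power)
    fix i j
    show "comm A (?a i) * ?b j + ?a i * (A * ?b j) = A * (?a i * ?b j)"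
      by (simp add: comm_def algebra_simps)
  next
    fix k
    show "of_nat (Suc k) * ?a (Suc k) = comm A (?a k)"
      by (simp only: inv_fact_Suc funpow.simps o_apply)
        (simp add: comm_def algebra_simps scalar_left_commute[of A])
    show "of_nat (Suc k) * ?b (Suc k) = A * ?b k"
      by (simp only: inv_fact_Suc power_Suc scalar_left_commute[of A])
  qed
  have "fps_suminf ?a * exp_at A = fps_suminf (\<lambda>m. \<Sum>i\<le>m. ?a i * ?b (m - i))"
    unfolding exp_at_eq_suminf[OF A0]
    by (rule fps_suminf_mult) (rule summable_funpow_comm summable_series, fact)+
  also have "\<dots> = fps_suminf (\<lambda>m. ?b m * u)"
    by (simp add: conv)
  also have "\<dots> = exp_at A * u"
    unfolding exp_at_eq_suminf[OF A0]
    by (rule fps_suminf_mult_right[symmetric]) (rule summable_series, fact)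
  finally show ?thesis by simp
qed

text \<open>The series \<open>cos (\<surd>t)\<close> and \<open>sin (\<surd>t) / \<surd>t\<close>.\<close>

definition cos_sqrt_series :: "'k::field_char_0 fps" where
  "cos_sqrt_series = Abs_fps (\<lambda>n. (- 1) ^ n / fact (2 * n))"

definition sinc_sqrt_series :: "'k::field_char_0 fps" where
  "sinc_sqrt_series = Abs_fps (\<lambda>n. (- 1) ^ n / fact (Suc (2 * n)))"

text \<open>Modulo the ideal, ad A maps u to v and v to - T u, and it kills T. Hence exp(ad A) acts
  on u as cos(sqrt T) u + (sin(sqrt T)/sqrt T) v, with both coefficients being power series in T
  itself.\<close>

lemma exp_at_rotation:
  fixes A :: "('m::monoid_add \<Rightarrow>\<^sub>0 'k::field_char_0) fps"
  assumes I: "fps_closed_ideal I" and A0: "A $ 0 = 0" and T0: "T $ 0 = 0"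
    and u: "comm A u - v \<in> I" and v: "comm A v + T * u \<in> I" and T: "comm A T \<in> I"
  shows "exp_at A * u - (series_at cos_sqrt_series T * u + series_at sinc_sqrt_series T * v) * exp_at A \<in> I"
proof -
  interpret fps_closed_ideal I by (rule I)
  have "commutes T A" using T by (simp add: commutes_def commutes_sym[unfolded commutes_def])
  then have "commutes ((- T) ^ k) A" for k by (intro commutes_power commutes_uminus)
  then have T': "comm A ((- T) ^ k) \<in> I" for k
    by (metis commutes_def commutes_sym)
  let ?r = "\<lambda>k. (comm A ^^ k) u"
  have step: "comm A x - comm A y \<in> I" if "x - y \<in> I" for x y
  proof -
    have "comm A x - comm A y = A * (x - y) - (x - y) * A" by (simp add: comm_def algebra_simps)
    then show ?thesis by (simp add: that mem_intros)
  qed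
  \<comment> \<open>Every second application of ad A reproduces the vector up to the factor - T, so
    even powers give multiples of \<open>u\<close> and odd powers multiples of
    \<open>v\<close>.\<close>
  have even: "?r (2 * k) - (- T) ^ k * u \<in> I" and odd: "?r (Suc (2 * k)) - (- T) ^ k * v \<in> I" for k
  proof (induction k)
    case 0
    { case 1 show ?case by (simp add: zero_mem) }
    { case 2 show ?case by (simp add: u) }
  next
    case (Suc k)
    have mult: "comm A ((- T) ^ j * x) - (- T) ^ j * y \<in> I" if "comm A x - y \<in> I" for j x y
    proof -
      have "comm A ((- T) ^ j * x) - (- T) ^ j * y = (- T) ^ j * (comm A x - y) + comm A ((- T) ^ j) * x"
        by (simp add: comm_mult_right algebra_simps)
      then show ?thesis by (simp add: T' that mem_intros)
    qed
    have "comm A (?r (Suc (2 * k))) - comm A ((- T) ^ k * v) \<in> I" by (rule step) (rule Suc)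
    moreover have "comm A ((- T) ^ k * v) - (- T) ^ k * (- T * u) \<in> I"
      by (rule mult) (use v in simp)
    ultimately have ev: "comm A (?r (Suc (2 * k))) - (- T) ^ k * (- T * u) \<in> I" by (rule cong_trans)
    { case 1 show ?case using ev by (simp add: mult.assoc power_Suc2 del: power_Suc) }
    note 1 = this
    { case 2
      have "comm A (?r (2 * Suc k)) - comm A ((- T) ^ Suc k * u) \<in> I" by (rule step) (rule 1)
      moreover have "comm A ((- T) ^ Suc k * u) - (- T) ^ Suc k * v \<in> I" by (rule mult) (rule u)
      ultimately have "comm A (?r (2 * Suc k)) - (- T) ^ Suc k * v \<in> I" by (rule cong_trans)
      then show ?case by simp }
  qed
  let ?C = "\<lambda>k. const_scalar (cos_sqrt_series $ k) * T ^ k"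
  let ?S = "\<lambda>k. const_scalar (sinc_sqrt_series $ k) * T ^ k"
  let ?d = "\<lambda>k. inv_fact (2 * k) * ?r (2 * k) + inv_fact (Suc (2 * k)) * ?r (Suc (2 * k))"
  let ?w = "\<lambda>k. ?C k * u + ?S k * v"
  have sums: "fps_summable ?C" "fps_summable ?S" by (rule summable_series, fact)+
  have C: "?C k = inv_fact (2 * k) * (- T) ^ k" and S: "?S k = inv_fact (Suc (2 * k)) * (- T) ^ k" for k
  proof -
    have "(- T) ^ k = const_scalar ((- 1) ^ k) * T ^ k"
      by (cases "even k") (simp_all add: scalar_uminus flip: fps_const_neg)
    then show "?C k = inv_fact (2 * k) * (- T) ^ k" "?S k = inv_fact (Suc (2 * k)) * (- T) ^ k"
      by (simp_all add: cos_sqrt_series_def sinc_sqrt_series_def mult.assoc[symmetric]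
          const_scalar_mult[symmetric] del: fact_Suc)
  qed
  have sum_d: "fps_suminf (\<lambda>k. inv_fact k * ?r k) = fps_suminf ?d"
    by (rule fps_suminf_in_pairs) (rule summable_funpow_comm, fact)
  have sum_w: "series_at cos_sqrt_series T * u + series_at sinc_sqrt_series T * v = fps_suminf ?w"
    unfolding series_at_eq_fps_suminf[OF T0] fps_suminf_add
    by (simp only: fps_suminf_mult_right sums)
  have diff: "fps_suminf ?d - fps_suminf ?w = fps_suminf (\<lambda>k. ?d k - ?w k)"
    by (simp add: fps_eq_iff fps_suminf_nth sum_subtractf)
  \<comment> \<open>The series agree modulo the ideal term by term. Closedness lets this pass to the
    sums, as the differences form a summable family.\<close>
  have "fps_suminf (\<lambda>k. ?d k - ?w k) \<in> I"
  proof (rule suminf_mem)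
    show "fps_summable (\<lambda>k. ?d k - ?w k)"
    proof (rule fps_summableI)
      fix k n :: nat assume "n < k"
      then have "?r (2 * k) $ n = 0" "?r (Suc (2 * k)) $ n = 0"
        by (intro funpow_comm_nth_eq_0 A0; simp)+
      moreover have "(?C k * u) $ n = 0" "(?S k * v) $ n = 0"
        by (rule fps_mult_nth_eq_0[of k _ 0]; use sums \<open>n < k\<close> in \<open>simp add: fps_summable_def\<close>)+
      ultimately show "(?d k - ?w k) $ n = 0"
        by (simp only: scalar_const_mult_nth fps_add_nth fps_sub_nth) simp
    qed
    fix k
    have "?d k - ?w k = inv_fact (2 * k) * (?r (2 * k) - (- T) ^ k * u) +
        inv_fact (Suc (2 * k)) * (?r (Suc (2 * k)) - (- T) ^ k * v)"
      unfolding C S by (simp only: algebra_simps)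
    then show "?d k - ?w k \<in> I" using even[of k] odd[of k] by (simp only: mem_intros)
  qed
  then have "(fps_suminf ?d - fps_suminf ?w) * exp_at A \<in> I"
    unfolding diff by (rule mult_right_mem)
  then show ?thesis
    unfolding exp_at_conjugation[OF A0] sum_d sum_w left_diff_distrib .
qed

section \<open>Homomorphisms induced by maps of monoids and of generators\<close>

lemma push_nth: "push \<phi> x $ n = linear_ext (\<lambda>u. Poly_Mapping.single (\<phi> u)) (x $ n)"
  by (simp add: push_def linear_ext_def)

lemma algebra_hom_push:
  fixes \<phi> :: "'m::monoid_add \<Rightarrow> 'n::monoid_add"
  assumes "\<phi> 0 = 0" "\<And>u v. \<phi> (u + v) = \<phi> u + \<phi> v"
  shows "algebra_hom (push \<phi> :: ('m \<Rightarrow>\<^sub>0 'k::field_char_0) fps \<Rightarrow> _)"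
  unfolding algebra_hom_def
  by (auto simp: fps_eq_iff push_nth linear_ext_add single_add fps_mult_nth linear_ext_sum
      linear_ext_mult mult_single assms scalar_nth linear_ext_single)

lemma push_push:
  fixes x :: "('m \<Rightarrow>\<^sub>0 'k::field_char_0) fps"
  shows "push \<phi> (push \<psi> x) = push (\<lambda>u. \<phi> (\<psi> u)) x"
proof -
  have "linear_ext (\<lambda>u. Poly_Mapping.single (\<phi> u)) (linear_ext (\<lambda>u. Poly_Mapping.single (\<psi> u)) p) =
      linear_ext (\<lambda>u. Poly_Mapping.single (\<phi> (\<psi> u))) p" for p :: "'m \<Rightarrow>\<^sub>0 'k"
    by (induction p rule: poly_mapping_add_induct)
      (simp_all add: linear_ext_zero linear_ext_add linear_ext_single single_add)
  then show ?thesis by (simp add: fps_eq_iff push_nth)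
qed

lemma push_const: "push \<phi> (fps_const (Poly_Mapping.single u a)) = fps_const (Poly_Mapping.single (\<phi> u) a)"
  by (simp add: fps_eq_iff push_nth linear_ext_single linear_ext_zero single_add)

section \<open>Homomorphisms out of the completed free algebra\<close>

definition word_lift ::
    "('g \<Rightarrow> ('n::monoid_add \<Rightarrow>\<^sub>0 'k::field_char_0) fps) \<Rightarrow> ('g list \<Rightarrow>\<^sub>0 'k) \<Rightarrow> ('n \<Rightarrow>\<^sub>0 'k) fps" where
  "word_lift \<phi> = linear_ext (\<lambda>w a. const_scalar a * prod_list (map \<phi> w))"

lemma word_lift_add: "word_lift \<phi> (p + q) = word_lift \<phi> p + word_lift \<phi> q"
  unfolding word_lift_def by (rule linear_ext_add) (simp only: const_scalar_add distrib_right)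

lemma word_lift_zero: "word_lift \<phi> 0 = 0"
  by (simp add: word_lift_def linear_ext_def)

lemma word_lift_single: "word_lift \<phi> (Poly_Mapping.single w a) = const_scalar a * prod_list (map \<phi> w)"
  unfolding word_lift_def by (rule linear_ext_single) (simp only: const_scalar_add distrib_right)

lemma word_lift_sum: "word_lift \<phi> (sum f A) = (\<Sum>i\<in>A. word_lift \<phi> (f i))"
  by (induction A rule: infinite_finite_induct) (simp_all add: word_lift_zero word_lift_add)

lemma word_lift_mult: "word_lift \<phi> (p * q) = word_lift \<phi> p * word_lift \<phi> q"
  unfolding word_lift_def
proof (rule linear_ext_mult)
  show "const_scalar (a * b) * prod_list (map \<phi> (k + l)) =
      const_scalar a * prod_list (map \<phi> k) * (const_scalar b * prod_list (map \<phi> l))" for k l a b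
    by (simp only: plus_list_def map_append prod_list.append const_scalar_mult mult.assoc
        scalar_left_commute[of "prod_list (map \<phi> k)"])
qed (simp only: const_scalar_add distrib_right)

lemma free_lift_eq_suminf: "free_lift \<phi> x = fps_suminf (\<lambda>i. fps_X ^ i * word_lift \<phi> (x $ i))"
  by (simp add: fps_eq_iff free_lift_def fps_suminf_nth fps_X_power_mult_nth word_lift_def linear_ext_def)

lemma free_lift_var: "free_lift \<phi> (var g) = \<phi> g"
proof (rule fps_ext)
  fix n
  have "free_lift \<phi> (var g) $ n = (\<Sum>i\<le>n. if i = 0 then \<phi> g $ n else 0)"
    unfolding free_lift_eq_suminf fps_suminf_nth
    by (rule sum.cong) (auto simp: var_def word_lift_single word_lift_zero)
  then show "free_lift \<phi> (var g) $ n = \<phi> g $ n" by simp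
qed

lemma algebra_hom_free_lift:
  "algebra_hom (free_lift \<phi> :: ('g list \<Rightarrow>\<^sub>0 'k::field_char_0) fps \<Rightarrow> ('n::monoid_add \<Rightarrow>\<^sub>0 'k) fps)"
  unfolding algebra_hom_def
proof (intro conjI allI)
  fix x y :: "('g list \<Rightarrow>\<^sub>0 'k) fps" and a :: "'k fps"
  show "free_lift \<phi> (x + y) = free_lift \<phi> x + free_lift \<phi> y"
    by (simp add: free_lift_eq_suminf word_lift_add distrib_left fps_suminf_add)
  have summ: "fps_summable (\<lambda>i. fps_X ^ i * word_lift \<phi> (x $ i))" for x
    by (rule fps_summableI) (simp add: fps_X_power_mult_nth)
  have "free_lift \<phi> x * free_lift \<phi> y =
      fps_suminf (\<lambda>m. \<Sum>i\<le>m. fps_X ^ i * word_lift \<phi> (x $ i) *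
        (fps_X ^ (m - i) * word_lift \<phi> (y $ (m - i))))"
    unfolding free_lift_eq_suminf by (rule fps_suminf_mult[OF summ summ])
  also have "\<dots> = fps_suminf (\<lambda>m. fps_X ^ m * word_lift \<phi> ((x * y) $ m))"
  proof (rule fps_suminf_cong)
    fix m
    have "fps_X ^ i * p * (fps_X ^ (m - i) * q) = fps_X ^ m * (p * q)"
      if "i \<le> m" for i and p q :: "('n \<Rightarrow>\<^sub>0 'k) fps"
    proof -
      have "p * (fps_X ^ (m - i) * q) = fps_X ^ (m - i) * (p * q)"
        unfolding scalar_fps_X[symmetric] scalar_power[symmetric] by (rule scalar_left_commute)
      then show ?thesis using that by (simp add: mult.assoc) (simp add: mult.assoc[symmetric] flip: power_add)
    qed
    then show "(\<Sum>i\<le>m. fps_X ^ i * word_lift \<phi> (x $ i) * (fps_X ^ (m - i) * word_lift \<phi> (y $ (m - i)))) =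
        fps_X ^ m * word_lift \<phi> ((x * y) $ m)"
      by (simp add: fps_mult_nth word_lift_sum word_lift_mult sum_distrib_left atLeast0AtMost)
  qed
  finally show "free_lift \<phi> (x * y) = free_lift \<phi> x * free_lift \<phi> y"
    by (simp add: free_lift_eq_suminf)
  show "free_lift \<phi> (scalar a) = scalar a"
  proof (rule fps_ext)
    fix n
    have "free_lift \<phi> (scalar a) $ n = (\<Sum>i\<le>n. if i = n then Poly_Mapping.single 0 (a $ n) else 0)"
      unfolding free_lift_eq_suminf fps_suminf_nth
      by (rule sum.cong) (auto simp: scalar_nth word_lift_single zero_list_def fps_X_power_mult_nth)
    then show "free_lift \<phi> (scalar a) $ n = scalar a $ n" by (simp add: scalar_nth)
  qed
qed

section \<open>The arcsine identities\<close>

lemma compose_fps_X_square_nth: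
  "(s oo (fps_X ^ 2 :: 'k::field_char_0 fps)) $ m = (if even m then s $ (m div 2) else 0)"
proof -
  have "(s oo (fps_X ^ 2)) $ m = (\<Sum>i=0..m. if m = 2 * i then s $ i else 0)"
    by (auto simp: fps_compose_nth power_mult[symmetric] fps_X_power_nth intro!: sum.cong)
  also have "\<dots> = (\<Sum>i\<in>(if even m then {m div 2} else {}). s $ i)"
    by (rule sum.mono_neutral_cong_right) (auto split: if_splits)
  finally show ?thesis by simp
qed

lemma fps_cos_eq: "fps_cos 1 = (cos_sqrt_series oo fps_X ^ 2 :: 'k::field_char_0 fps)"
  by (auto simp: fps_eq_iff compose_fps_X_square_nth fps_cos_def cos_sqrt_series_def)

lemma fps_sin_eq: "fps_sin 1 = fps_X * (sinc_sqrt_series oo fps_X ^ 2 :: 'k::field_char_0 fps)"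
proof (rule fps_ext)
  fix n
  show "fps_sin 1 $ n = (fps_X * (sinc_sqrt_series oo fps_X ^ 2) :: 'k fps) $ n"
    by (cases n) (auto simp: compose_fps_X_square_nth fps_sin_def sinc_sqrt_series_def algebra_simps
        elim!: evenE)
qed

text \<open>Lets an identity between series in t be proved after t = y^2, where sine, cosine and
  arcsine of y = sqrt t are genuine power series.\<close>

lemma compose_fps_X_square_inj:
  assumes "s oo fps_X ^ 2 = t oo (fps_X ^ 2 :: 'k::field_char_0 fps)"
  shows "s = t"
proof (rule fps_ext)
  fix n
  have "(s oo fps_X ^ 2) $ (2 * n) = (t oo fps_X ^ 2) $ (2 * n)" by (simp add: assms)
  then show "s $ n = t $ n" by (simp add: compose_fps_X_square_nth)
qed

text \<open>The series arcsin(sqrt t)^2.\<close>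

abbreviation arcsin_square :: "'k::field_char_0 fps" where
  "arcsin_square \<equiv> fps_X * arcsin_sqrt_series ^ 2"

text \<open>This is sin(arcsin y) = y with y = sqrt t, after division by y.\<close>

lemma sinc_arcsin:
  "(sinc_sqrt_series oo arcsin_square) * arcsin_sqrt_series = (1 :: 'k::field_char_0 fps)"
proof -
  let ?S = "fps_sin 1 :: 'k fps" and ?A = "arcsin_series :: 'k fps"
    and ?Q = "fps_X ^ 2 :: 'k fps" and ?G = "arcsin_sqrt_series :: 'k fps"
  have A0: "?A $ 0 = 0" by (simp add: arcsin_series_def fps_inv_def)
  have Q0: "?Q $ 0 = 0" by simp
  have "?A ^ 2 = ?Q * (?G oo ?Q) ^ 2"
    by (subst arcsin_series_eq) (simp add: power_mult_distrib)
  also have "\<dots> = arcsin_square oo ?Q"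
    by (simp add: fps_compose_mult_distrib fps_compose_power)
  finally have A2: "?A ^ 2 = arcsin_square oo ?Q" .
  have "fps_X = ?S oo ?A"
    unfolding arcsin_series_def by (rule fps_inv_right[symmetric]) (simp_all add: fps_sin_def)
  also have "\<dots> = ?A * ((sinc_sqrt_series oo ?Q) oo ?A)"
    unfolding fps_sin_eq by (simp add: fps_compose_mult_distrib A0)
  also have "(sinc_sqrt_series oo ?Q) oo ?A = sinc_sqrt_series oo (?Q oo ?A)"
    by (rule fps_compose_assoc[symmetric]) (simp_all add: A0)
  also have "?Q oo ?A = arcsin_square oo ?Q"
    by (simp add: fps_compose_power[symmetric] A0 A2)
  also have "sinc_sqrt_series oo (arcsin_square oo ?Q) = (sinc_sqrt_series oo arcsin_square) oo ?Q"
    by (rule fps_compose_assoc) simp_all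
  also have "?A * \<dots> = fps_X * (((sinc_sqrt_series oo arcsin_square) * ?G) oo ?Q)"
    by (subst arcsin_series_eq) (simp add: fps_compose_mult_distrib mult.assoc mult.commute)
  finally have "((sinc_sqrt_series oo arcsin_square) * ?G) oo ?Q = 1"
    using fps_X_cancel_left[of "((sinc_sqrt_series oo arcsin_square) * ?G) oo ?Q" 1] by simp
  then show ?thesis
    by (simp add: compose_fps_X_square_inj)
qed

text \<open>Follows from cos^2 + sin^2 = 1 and sin(arcsin(sqrt t))^2 = t. It fixes the cosine up to
  sign; the sign is settled later by a constant term.\<close>

lemma cos_arcsin:
  "(cos_sqrt_series oo arcsin_square) ^ 2 = (1 - fps_X :: 'k::field_char_0 fps)"
proof -
  let ?C = "cos_sqrt_series :: 'k fps" and ?S = "sinc_sqrt_series :: 'k fps"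
  have "(?C ^ 2 + fps_X * ?S ^ 2) oo fps_X ^ 2 = fps_cos 1 ^ 2 + fps_sin 1 ^ 2"
    unfolding fps_sin_eq fps_cos_eq
    by (simp add: fps_compose_add_distrib fps_compose_mult_distrib fps_compose_power power_mult_distrib)
  also have "\<dots> = 1 oo fps_X ^ 2"
    by (simp add: fps_sin_cos_sum_of_squares)
  finally have "?C ^ 2 + fps_X * ?S ^ 2 = 1" by (rule compose_fps_X_square_inj)
  then have "(?C ^ 2 + fps_X * ?S ^ 2) oo arcsin_square = 1 oo arcsin_square" by simp
  then have "(?C oo arcsin_square) ^ 2 + arcsin_square * (?S oo arcsin_square) ^ 2 = 1"
    by (simp add: fps_compose_add_distrib fps_compose_mult_distrib fps_compose_power)
  moreover have "arcsin_square * (?S oo arcsin_square) ^ 2 =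
      fps_X * ((?S oo arcsin_square) * arcsin_sqrt_series) ^ 2"
    by (simp add: power_mult_distrib mult_ac)
  ultimately show ?thesis by (simp only: sinc_arcsin) (simp add: algebra_simps)
qed

lemma half_add_half: "half + half = 1"
  by (simp add: half_def flip: scalar_add)

lemma series_at_sinh:
  "x $ 0 = 0 \<Longrightarrow> series_at sinh_series x = half * (exp_at x - exp_at (- x))"
  and series_at_cosh:
  "x $ 0 = 0 \<Longrightarrow> series_at cosh_series x = half * (exp_at x + exp_at (- x))"
  using exp_at_scale[of x "- 1"]
  by (simp_all add: sinh_series_def cosh_series_def half_def series_at_mult series_at_const
      series_at_add series_at_diff scalar_uminus flip: fps_const_neg)

lemma series_at_inverse:
  assumes "x $ 0 = 0" "s $ 0 \<noteq> 0"
  shows "series_at (inverse s) x * series_at s x = 1"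
  by (simp add: assms inverse_mult_eq_1 series_at_1 flip: series_at_mult)

text \<open>A series with constant term 1 is invertible: its inverse is 1/(1 + X) evaluated at
  \<open>y - 1\<close>.\<close>

lemma fps_mult_cancel_const_1:
  fixes x y :: "('m::monoid_add \<Rightarrow>\<^sub>0 'k::field_char_0) fps"
  assumes "y $ 0 = 1" "x * y = 0"
  shows "x = 0"
proof -
  have n: "(y - 1) $ 0 = 0" by (simp add: assms)
  have "series_at (1 + fps_X) (y - 1) * series_at (inverse (1 + fps_X)) (y - 1) = 1"
    unfolding series_at_mult[OF n, symmetric] by (simp add: series_at_1[OF n] inverse_mult_eq_1')
  then have "y * series_at (inverse (1 + fps_X)) (y - 1) = 1"
    by (simp add: series_at_add[OF n] series_at_1[OF n] series_at_X[OF n])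
  then have "x = x * y * series_at (inverse (1 + fps_X)) (y - 1)"
    by (simp add: mult.assoc)
  then show ?thesis using assms(2) by simp
qed

text \<open>In (x - y)(x + y)/2 = 0 the factor (x + y)/2 has constant term 1 and can be cancelled.
  The monoid is commutative here, so the difference of squares factors.\<close>

lemma sqrt_unique:
  fixes x y :: "('m::comm_monoid_add \<Rightarrow>\<^sub>0 'k::field_char_0) fps"
  assumes "x ^ 2 = y ^ 2" "x $ 0 = 1" "y $ 0 = 1"
  shows "x = y"
proof -
  have "half $ 0 * 2 = (1 :: 'm \<Rightarrow>\<^sub>0 'k)"
    using arg_cong[OF half_add_half, of "\<lambda>z :: ('m \<Rightarrow>\<^sub>0 'k) fps. z $ 0"] by (simp add: algebra_simps)
  then have "(half * (x + y)) $ 0 = 1" by (simp add: assms fps_mult_nth)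
  moreover have "(x - y) * (half * (x + y)) = half * (x ^ 2 - y ^ 2)"
    by (simp add: algebra_simps power2_eq_square)
  ultimately show ?thesis
    using fps_mult_cancel_const_1[of "half * (x + y)" "x - y"] assms by simp
qed

text \<open>
  Over the commuting elements \<open>x\<^sub>i = c\<^sub>2 M\<^sub>i\<close>: here \<open>d\<^sub>i = c\<^sub>2 [K, P]\<^sub>i\<close>, \<open>q\<^sub>i = e\<^bsup>-x\<^sub>i\<^esup>\<close>, and \<open>T = t g\<^sup>2\<close> is the
  square of the rotation angle \<open>arcsin (\<surd>t)\<close>.
\<close>

lemma arcsin_rotation:
  fixes x1 x2 :: "('m::comm_monoid_add \<Rightarrow>\<^sub>0 'k::field_char_0) fps"
  assumes x1: "x1 $ 0 = 0" and x2: "x2 $ 0 = 0"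
  defines "q1 \<equiv> exp_at (- x1)" and "q2 \<equiv> exp_at (- x2)"
    and "s2 \<equiv> series_at sinh_series x1 * series_at sinh_series x2"
    and "winv \<equiv> series_at (inverse cosh_series) (half * (x1 + x2))"
  defines "f \<equiv> exp_at (half * x1) * exp_at (half * x2) *
      (winv * series_at arcsin_sqrt_series (s2 * winv ^ 2))"
    and "d1 \<equiv> half * (1 - q1 ^ 2)" and "d2 \<equiv> half * (1 - q2 ^ 2)"
  defines "T \<equiv> f ^ 2 * d1 * d2"
  shows "T $ 0 = 0"
    and "series_at cos_sqrt_series T - series_at sinc_sqrt_series T * (q2 * f * d1) = q1"
    and "series_at sinc_sqrt_series T * (f * d2) + series_at cos_sqrt_series T * q2 = 1"
proof -
  \<comment> \<open>Here \<open>h\<close> is one half, not the deformation parameter. In terms of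
    half-angle exponentials with inverses \<open>a2\<close> and \<open>b2\<close>, the hyperbolic
    identities become polynomial; \<open>w\<close> is cosh((x1 + x2)/2) and \<open>v\<close> is
    cosh((x1 - x2)/2).\<close>
  define h :: "('m \<Rightarrow>\<^sub>0 'k) fps" where "h = half"
  define a1 where "a1 = exp_at (h * x1)"
  define b1 where "b1 = exp_at (h * x2)"
  define a2 where "a2 = exp_at (- (h * x1))"
  define b2 where "b2 = exp_at (- (h * x2))"
  define w where "w = h * (a1 * b1 + a2 * b2)"
  define v where "v = h * (a1 * b2 + a2 * b1)"
  define t where "t = s2 * winv ^ 2"
  define g where "g = series_at arcsin_sqrt_series t"
  have hh: "h + h = 1" unfolding h_def by (rule half_add_half)
  have h0: "(h * x1) $ 0 = 0" "(h * x2) $ 0 = 0" using x1 x2 by simp_all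
  have e: "a1 * a2 = 1" "b1 * b2 = 1"
    using h0 by (simp_all add: a1_def a2_def b1_def b2_def exp_at_uminus)
  have e': "a1 * (a2 * y) = y" "b1 * (b2 * y) = y" for y
    using e by (simp_all flip: mult.assoc)
  note cancel = power2_eq_square power4_eq_xxxx algebra_simps e e'
  have dbl: "exp_at x = exp_at (h * x) ^ 2" if "x $ 0 = 0" for x
  proof -
    have "x = h * x + h * x" using hh by (metis distrib_right mult_1_left)
    then show ?thesis
      using exp_at_add[of "h * x" "h * x"] that by (simp add: power2_eq_square)
  qed
  have q: "q1 = a2 ^ 2" "q2 = b2 ^ 2"
    using dbl[of "- x1"] dbl[of "- x2"] x1 x2 by (simp_all add: q1_def q2_def a2_def b2_def)
  have s2: "s2 = h * (a1 ^ 2 - a2 ^ 2) * (h * (b1 ^ 2 - b2 ^ 2))"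
    using dbl[of "x1"] dbl[of "x2"] dbl[of "- x1"] dbl[of "- x2"] x1 x2
    by (simp add: s2_def series_at_sinh a1_def b1_def a2_def b2_def flip: h_def)
  have "exp_at (h * (x1 + x2)) = a1 * b1"
    using exp_at_add[of "h * x1" "h * x2"] h0 by (simp add: a1_def b1_def distrib_left mult.commute)
  moreover have "exp_at (- (h * (x1 + x2))) = a2 * b2"
    using exp_at_add[of "- (h * x1)" "- (h * x2)"] h0
    by (simp add: a2_def b2_def distrib_left mult.commute)
  ultimately have "series_at cosh_series (h * (x1 + x2)) = w"
    using x1 x2 by (simp add: series_at_cosh w_def flip: h_def)
  then have ww: "winv * w = 1"
    using series_at_inverse[of "h * (x1 + x2)" cosh_series] x1 x2
    by (simp add: winv_def cosh_series_def flip: h_def)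
  have f: "f = a1 * b1 * winv * g"
    by (simp add: f_def a1_def b1_def g_def t_def mult.assoc flip: h_def)
  have d: "d1 = h * (1 - a2 ^ 4)" "d2 = h * (1 - b2 ^ 4)"
    by (simp_all add: d1_def d2_def q flip: h_def power_mult)
  \<comment> \<open>The identity cosh^2((x1 + x2)/2) - sinh(x1) sinh(x2) = cosh^2((x1 - x2)/2). It
    makes \<open>1 - t\<close> a perfect square, namely \<open>(v * winv) ^ 2\<close>.\<close>
  have vw: "w ^ 2 - s2 = v ^ 2"
    by (simp add: w_def v_def s2 cancel)
  \<comment> \<open>The exponential prefactor of \<open>f\<close>, squared, is exp(x1) exp(x2); it
    turns \<open>d1 * d2\<close> into sinh(x1) sinh(x2).\<close>
  have T: "T = t * g ^ 2"
    by (simp add: T_def f d t_def s2 cancel)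
  have s20: "s2 $ 0 = 0"
    using x1 by (simp add: s2_def series_at_nth_0 sinh_series_def)
  then have t0: "t $ 0 = 0" by (simp add: t_def)
  then show T0: "T $ 0 = 0" by (simp add: T)
  have Ts: "T = series_at arcsin_square t"
    using t0 by (simp add: T g_def series_at_mult series_at_X series_at_power)
  have sinc: "series_at sinc_sqrt_series T * g = 1"
    using t0 sinc_arcsin[where 'k='k]
    by (simp add: Ts g_def series_at_1 flip: series_at_compose series_at_mult)
  have "series_at cos_sqrt_series T ^ 2 = 1 - t"
    using t0 cos_arcsin[where 'k='k]
    by (simp add: Ts series_at_1 series_at_X series_at_diff flip: series_at_compose series_at_power)
  also have "\<dots> = (v * winv) ^ 2"
  proof -
    have "(v * winv) ^ 2 = (winv * w) ^ 2 - t"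
      by (simp add: t_def power_mult_distrib vw[symmetric] algebra_simps)
    then show ?thesis by (simp add: ww)
  qed
  finally have "series_at cos_sqrt_series T ^ 2 = (v * winv) ^ 2" .
  \<comment> \<open>At order 0 the two hyperbolic cosines agree. This selects the positive square
    root as the cosine.\<close>
  moreover have "(v * winv) $ 0 = 1"
  proof -
    have "a1 $ 0 = 1" "b1 $ 0 = 1" "a2 $ 0 = 1" "b2 $ 0 = 1"
      by (simp_all add: a1_def b1_def a2_def b2_def exp_at_nth_0)
    then have "v $ 0 = w $ 0" by (simp add: v_def w_def fps_mult_nth)
    then show ?thesis
      using arg_cong[OF ww, of "\<lambda>z. z $ 0"] by (simp add: fps_mult_nth mult.commute)
  qed
  moreover have "series_at cos_sqrt_series T $ 0 = 1"
    by (simp add: series_at_nth_0[OF T0] cos_sqrt_series_def)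
  ultimately have cos: "series_at cos_sqrt_series T = v * winv" by - (rule sqrt_unique)
  \<comment> \<open>The factor \<open>g\<close> of \<open>f\<close> is cancelled by the sine series,
    so no arcsine remains and the two equations reduce to multiples of
    \<open>winv * w\<close>.\<close>
  have sf: "series_at sinc_sqrt_series T * f = a1 * b1 * winv"
  proof -
    have "series_at sinc_sqrt_series T * f = a1 * b1 * winv * (series_at sinc_sqrt_series T * g)"
      by (simp add: f mult_ac)
    then show ?thesis by (simp add: sinc)
  qed
  have "series_at cos_sqrt_series T - series_at sinc_sqrt_series T * (q2 * f * d1) =
      series_at cos_sqrt_series T - series_at sinc_sqrt_series T * f * (q2 * d1)"
    by (simp add: mult_ac)
  also have "\<dots> = a2 ^ 2 * (winv * w)"
    unfolding sf cos q d by (simp add: v_def w_def cancel)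
  finally show "series_at cos_sqrt_series T - series_at sinc_sqrt_series T * (q2 * f * d1) = q1"
    by (simp add: ww q)
  have "series_at sinc_sqrt_series T * (f * d2) + series_at cos_sqrt_series T * q2 =
      series_at sinc_sqrt_series T * f * d2 + series_at cos_sqrt_series T * q2"
    by (simp add: mult_ac)
  also have "\<dots> = winv * w"
    unfolding sf cos q d by (simp add: v_def w_def cancel)
  finally show "series_at sinc_sqrt_series T * (f * d2) + series_at cos_sqrt_series T * q2 = 1"
    by (simp add: ww)
qed

section \<open>The two legs of the tensor square\<close>

definition emb1 :: "'k::field_char_0 free1 \<Rightarrow> 'k free2" where
  "emb1 = push (\<lambda>u. (u, 0))"

definition emb2 :: "'k::field_char_0 free1 \<Rightarrow> 'k free2" where
  "emb2 = push (\<lambda>v. (0, v))"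

lemma algebra_hom_emb1: "algebra_hom emb1" and algebra_hom_emb2: "algebra_hom emb2"
  unfolding emb1_def emb2_def by (rule algebra_hom_push; simp add: zero_prod_def)+

lemmas emb_simps = hom_simps[OF algebra_hom_emb1] hom_simps[OF algebra_hom_emb2]

lemma tensor_eq_emb: "x \<boxtimes> y = emb1 x * emb2 y"
  by (simp add: tensor_def emb1_def emb2_def)

text \<open>For words, (u, 0) + (0, v) and (0, v) + (u, 0) both equal (u, v), so the legs commute
  exactly. Reversing the summation index in the Cauchy product carries this over to series.\<close>

lemma emb_commute: "emb2 y * emb1 x = emb1 x * emb2 (y :: 'k::field_char_0 free1)"
proof -
  let ?h1 = "\<lambda>u. Poly_Mapping.single (u, 0 :: generator list) :: 'k \<Rightarrow> _"
    and ?h2 = "\<lambda>v. Poly_Mapping.single (0 :: generator list, v) :: 'k \<Rightarrow> _"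
  have *: "linear_ext ?h2 q * linear_ext ?h1 p = linear_ext ?h1 p * linear_ext ?h2 q" for p q
  proof (induction p rule: poly_mapping_add_induct)
    case (single k a)
    show ?case
      by (induction q rule: poly_mapping_add_induct)
        (simp_all add: linear_ext_zero linear_ext_single linear_ext_add single_add mult_single
          algebra_simps)
  qed (simp_all add: linear_ext_zero linear_ext_add single_add algebra_simps)
  show ?thesis
  proof (rule fps_ext)
    fix n
    show "(emb2 y * emb1 x) $ n = (emb1 x * emb2 y) $ n"
      unfolding fps_mult_nth emb1_def emb2_def push_nth *
      by (rule sum.reindex_bij_witness[of _ "\<lambda>i. n - i" "\<lambda>i. n - i"]) auto
  qed
qed

lemma emb_left_commute: "emb2 y * (emb1 x * z) = emb1 x * (emb2 y * z)"
  by (simp add: emb_commute flip: mult.assoc)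

lemma comm_emb12: "comm (emb1 x) (emb2 y) = 0" and comm_emb21: "comm (emb2 y) (emb1 x) = 0"
  by (simp_all add: comm_def emb_commute)

lemma primitive_eq: "primitive x = emb2 x + emb1 x"
  by (simp add: primitive_def tensor_eq_emb emb_simps)

lemma fps_closed_ideal_I1: "fps_closed_ideal (I1 c)"
  and fps_closed_ideal_I2: "fps_closed_ideal (I2 c)"
  and fps_closed_ideal_I3: "fps_closed_ideal (I3 c)"
  by (simp_all add: I1_def I2_def I3_def fps_closed_ideal_closed_ideal)

lemma emb_mem_I2: assumes "x \<in> I1 c" shows "emb1 x \<in> I2 c" "emb2 x \<in> I2 c"
proof -
  have "x \<boxtimes> 1 \<in> I2 c" "1 \<boxtimes> x \<in> I2 c"
    unfolding I2_def using assms by (auto intro: closed_ideal_superset[THEN subsetD])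
  then show "emb1 x \<in> I2 c" "emb2 x \<in> I2 c" by (simp_all add: tensor_eq_emb emb_simps)
qed

text \<open>For a homomorphism out of the tensor square, compatibility with the ideals has to be
  checked only on the two legs.\<close>

lemma I2_image_mem:
  assumes "algebra_hom \<phi>" "fps_closed_ideal J"
    and "\<And>x. x \<in> I1 c \<Longrightarrow> \<phi> (emb1 x) \<in> J" "\<And>x. x \<in> I1 c \<Longrightarrow> \<phi> (emb2 x) \<in> J" "x \<in> I2 c"
  shows "\<phi> x \<in> J"
  by (rule closed_ideal_image[OF assms(1,2) _ assms(5)[unfolded I2_def]])
    (auto simp: tensor_eq_emb emb_simps assms(3,4))

abbreviation swap2 :: "'k::field_char_0 free2 \<Rightarrow> 'k free2" where
  "swap2 \<equiv> push (\<lambda>(u, v). (v, u))"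

lemma algebra_hom_swap2: "algebra_hom swap2"
  by (rule algebra_hom_push) (auto simp: zero_prod_def)

lemma swap2_emb [simp]: "swap2 (emb1 x) = emb2 x" "swap2 (emb2 x) = emb1 x"
  by (simp_all add: emb1_def emb2_def push_push)

lemma cl2_eq_iff: "cl2 c x = cl2 c y \<longleftrightarrow> x - y \<in> I2 c"
  by (simp add: cl2_def fps_closed_ideal.coset_eq_iff[OF fps_closed_ideal_I2])

lemma flip_cl2: "flip c (cl2 c x) = cl2 c (swap2 x)"
  unfolding flip_def cl2_def[abs_def]
  by (rule induced_coset[OF algebra_hom_swap2 fps_closed_ideal_I2 fps_closed_ideal_I2])
    (auto elim!: I2_image_mem[OF algebra_hom_swap2 fps_closed_ideal_I2, rotated -1] simp: emb_mem_I2)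

section \<open>The coproduct respects the relations\<close>

lemma c2_commute: "c2 c * x = x * c2 c"
  by (simp add: c2_def scalar_commute)

lemma c2_nth_0 [simp]: "c2 c $ 0 = 0"
  by (simp add: c2_def scalar_nth)

lemma hom_c2: "algebra_hom \<phi> \<Longrightarrow> \<phi> (c2 c) = c2 c"
  by (simp add: c2_def hom_scalar)

lemma hom_half: "algebra_hom \<phi> \<Longrightarrow> \<phi> half = half"
  by (simp add: half_def hom_scalar)

abbreviation qM :: "'k::field_char_0 \<Rightarrow> 'k free1" where
  "qM c \<equiv> exp_at (- (c2 c * var gM))"

lemma relators_mem_I1: "r \<in> relators c \<Longrightarrow> r \<in> I1 c"
  unfolding I1_def using closed_ideal_superset by blast

lemma comm_M_mem: "comm (var gM) (var g) \<in> I1 c"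
  by (rule relators_mem_I1) (auto simp: relators_def)

lemma comm_mem_I1:
  "comm (var gD) (var gP) + var gP \<in> I1 c"
  "comm (var gD) (var gK) - var gK \<in> I1 c"
  "comm (var gK) (var gP) - KP_bracket c \<in> I1 c"
  "comm (var gK) (var gH) - var gP \<in> I1 c"
  "comm (var gK) (var gC) \<in> I1 c"
  "comm (var gP) (var gC) + var gK \<in> I1 c"
  "comm (var gP) (var gH) \<in> I1 c"
  by (rule relators_mem_I1; simp add: relators_def)+

lemma commutes_qM: "comm (qM c) (var g) \<in> I1 c" "comm (var g) (qM c) \<in> I1 c"
proof -
  interpret fps_closed_ideal "I1 c" by (rule fps_closed_ideal_I1)
  have "commutes (- (c2 c * var gM)) (var g)"
    by (intro commutes_uminus commutes_mult commutes_if_eq[OF c2_commute])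
      (simp add: commutes_def comm_M_mem)
  then have "commutes (qM c) (var g)"
    by (intro commutes_series_at fps_closed_ideal_I1) simp_all
  then show "comm (qM c) (var g) \<in> I1 c" "comm (var g) (qM c) \<in> I1 c"
    using commutes_sym by (auto simp: commutes_def)
qed

text \<open>Removes the shift from the bracket by multiplying with h; what remains is a polynomial
  in \<open>qM c\<close>, on which homomorphisms are easily evaluated.\<close>

lemma fps_X_KP_bracket:
  "fps_X * KP_bracket c = const_scalar (inverse (2 * c)) * (1 - qM c * qM c)"
proof -
  let ?y = "- (c2 c * var gM)"
  have "exp_at (?y + ?y) = qM c * qM c" by (rule exp_at_add) simp_all
  moreover have "- (2 * c2 c * var gM) = ?y + ?y" by (simp add: mult_2 distrib_right)
  ultimately have "exp_at (- (2 * c2 c * var gM)) = qM c * qM c" by simp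
  moreover have "(1 - exp_at (- (2 * c2 c * var gM))) $ 0 = 0"
    by (simp add: exp_at_nth_0)
  ultimately have "fps_X * fps_shift 1 (1 - exp_at (- (2 * c2 c * var gM))) = 1 - qM c * qM c"
    by (metis fps_X_mult_shift)
  then show ?thesis
    unfolding KP_bracket_def by (simp only: scalar_left_commute[of fps_X])
qed

lemma c2_KP_bracket: "c \<noteq> 0 \<Longrightarrow> c2 c * KP_bracket c = half * (1 - qM c ^ 2)"
proof -
  assume "c \<noteq> 0"
  have "c2 c * KP_bracket c = const_scalar c * (fps_X * KP_bracket c)"
    by (simp add: c2_def scalar_mult scalar_fps_X mult.assoc)
  also have "\<dots> = const_scalar (c * inverse (2 * c)) * (1 - qM c ^ 2)"
    by (simp only: fps_X_KP_bracket const_scalar_mult mult.assoc power2_eq_square)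
  also have "c * inverse (2 * c) = 1 / 2" using \<open>c \<noteq> 0\<close> by simp
  finally show ?thesis by (simp add: half_def)
qed

lemma algebra_hom_coproduct_free: "algebra_hom (coproduct_free c)"
  unfolding coproduct_free_def by (rule algebra_hom_free_lift)

lemma coproduct_free_var: "coproduct_free c (var g) = coproduct_gen c g"
  by (simp add: coproduct_free_def free_lift_var)

lemma coproduct_gen_PK:
  "g \<in> {gP, gK} \<Longrightarrow> coproduct_gen c g = emb2 (var g) + emb1 (var g) * emb2 (qM c)"
  by (auto simp: tensor_eq_emb emb_simps)

lemma hom_qM: "algebra_hom \<phi> \<Longrightarrow> \<phi> (qM c) = exp_at (- (c2 c * \<phi> (var gM)))"
  by (simp add: hom_series_at hom_uminus hom_mult hom_c2)

lemma coproduct_qM: "coproduct_free c (qM c) = emb1 (qM c) * emb2 (qM c)"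
proof -
  have "coproduct_free c (qM c) =
      exp_at (- (c2 c * emb1 (var gM)) + - (c2 c * emb2 (var gM)))"
    by (simp add: hom_qM algebra_hom_coproduct_free coproduct_free_var primitive_eq algebra_simps)
  also have "\<dots> = exp_at (- (c2 c * emb1 (var gM))) * exp_at (- (c2 c * emb2 (var gM)))"
  proof (rule exp_at_add)
    have "c2 c * emb1 (var gM) * (c2 c * emb2 (var gM)) =
        c2 c * emb2 (var gM) * (c2 c * emb1 (var gM))"
      by (simp add: c2_def mult.assoc scalar_left_commute[of "emb1 (var gM)"]
          scalar_left_commute[of "emb2 (var gM)"] emb_commute)
    then show "- (c2 c * emb1 (var gM)) * - (c2 c * emb2 (var gM)) =
        - (c2 c * emb2 (var gM)) * - (c2 c * emb1 (var gM))" by simp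
  qed simp_all
  finally show ?thesis by (simp add: hom_qM algebra_hom_emb1 algebra_hom_emb2)
qed

text \<open>\<open>qM c\<close> is grouplike, and for commuting p = q_1 and q = q_2 one has 1 - p^2
  q^2 = (1 - q^2) + (1 - p^2) q^2. The common factor h is cancelled at the outset.\<close>

lemma coproduct_KP_bracket:
  "coproduct_free c (KP_bracket c) =
    emb2 (KP_bracket c) + emb1 (KP_bracket c) * emb2 (qM c * qM c)"
proof (rule fps_X_cancel_left)
  let ?s = "const_scalar (inverse (2 * c)) :: 'a free2"
    and ?p = "emb1 (qM c)" and ?q = "emb2 (qM c)"
  have X: "fps_X * \<phi> (KP_bracket c) = ?s * (1 - \<phi> (qM c) * \<phi> (qM c))"
    if "algebra_hom \<phi>" for \<phi> :: "'a free1 \<Rightarrow> 'a free2"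
    using arg_cong[OF fps_X_KP_bracket[of c], of \<phi>]
    by (simp add: hom_mult[OF that] hom_fps_X[OF that] hom_scalar[OF that] hom_diff[OF that] hom_1[OF that])
  have "fps_X * (emb2 (KP_bracket c) + emb1 (KP_bracket c) * emb2 (qM c * qM c)) =
      ?s * (1 - ?q * ?q) + ?s * (1 - ?p * ?p) * (?q * ?q)"
    by (simp add: distrib_left X[OF algebra_hom_emb1] X[OF algebra_hom_emb2] emb_simps
        flip: mult.assoc)
  also have "\<dots> = ?s * (1 - ?p * ?p * (?q * ?q))"
    by (simp add: algebra_simps)
  also have "?p * ?p * (?q * ?q) = ?p * ?q * (?p * ?q)"
    by (simp add: mult.assoc emb_left_commute)
  also have "?s * (1 - ?p * ?q * (?p * ?q)) = fps_X * coproduct_free c (KP_bracket c)"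
    by (simp add: X[OF algebra_hom_coproduct_free] coproduct_qM)
  finally show "fps_X * coproduct_free c (KP_bracket c) =
      fps_X * (emb2 (KP_bracket c) + emb1 (KP_bracket c) * emb2 (qM c * qM c))" ..
qed

lemma comm_primitive_primitive:
  "comm (emb2 x + emb1 x) (emb2 y + emb1 y) = emb2 (comm x y) + emb1 (comm x y)"
  by (simp add: emb_simps comm_add_left comm_add_right comm_emb12 comm_emb21)

text \<open>The twists \<open>p\<close> and \<open>q\<close> are left arbitrary, so that taking one
  of them to be 1 covers the brackets of a primitive generator with P or K.\<close>

lemma comm_twisted_twisted:
  "comm (emb2 x + emb1 x * emb2 p) (emb2 y + emb1 y * emb2 q) =
    emb2 (comm x y) + emb1 (comm x y) * emb2 (p * q) + emb1 y * emb2 (comm x q) +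
    emb1 x * emb2 (comm p y) + emb1 (y * x) * emb2 (comm p q)"
  by (simp add: emb_simps comm_def algebra_simps emb_commute emb_left_commute)

lemma coproduct_free_relators:
  assumes "r \<in> relators c"
  shows "coproduct_free c r \<in> I2 c"
proof -
  interpret fps_closed_ideal "I2 c" by (rule fps_closed_ideal_I2)
  interpret I1: fps_closed_ideal "I1 c" by (rule fps_closed_ideal_I1)
  let ?\<Delta> = "coproduct_free c"
  let ?q = "qM c"
  have prim: "?\<Delta> (var g) = emb2 (var g) + emb1 (var g)" if "g \<notin> {gP, gK}" for g
    using that by (cases g) (simp_all add: coproduct_free_var primitive_eq)
  have tw: "?\<Delta> (var g) = emb2 (var g) + emb1 (var g) * emb2 ?q" if "g \<in> {gP, gK}" for g
    using that by (simp only: coproduct_free_var coproduct_gen_PK)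
  have pp: "?\<Delta> (comm (var g) (var h)) - (emb2 y + emb1 y) \<in> I2 c"
    if "g \<notin> {gP, gK}" "h \<notin> {gP, gK}" "comm (var g) (var h) - y \<in> I1 c" for g h y
  proof -
    have "?\<Delta> (comm (var g) (var h)) - (emb2 y + emb1 y) =
        emb2 (comm (var g) (var h) - y) + emb1 (comm (var g) (var h) - y)"
      by (simp only: hom_comm[OF algebra_hom_coproduct_free] prim[OF that(1)] prim[OF that(2)]
          comm_primitive_primitive) (simp add: emb_simps)
    then show ?thesis using that(3) by (simp only: mem_intros emb_mem_I2)
  qed
  \<comment> \<open>Apart from the relator itself, the error terms are commutators of the twists
    with generators or with each other. They lie in the ideal because \<open>M\<close> is central
    modulo it.\<close>
  have tt: "?\<Delta> (comm (var g) (var h)) - (emb2 y + emb1 y * emb2 (p * q)) \<in> I2 c"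
    if g: "?\<Delta> (var g) = emb2 (var g) + emb1 (var g) * emb2 p"
      and h: "?\<Delta> (var h) = emb2 (var h) + emb1 (var h) * emb2 q"
      and p: "p = 1 \<or> p = ?q" and q: "q = 1 \<or> q = ?q"
      and y: "comm (var g) (var h) - y \<in> I1 c" for g h y p q
  proof -
    have m: "comm (var g) q \<in> I1 c" "comm p (var h) \<in> I1 c" "comm p q \<in> I1 c"
      using p q by (auto simp: commutes_qM comm_self) (auto simp: comm_def I1.zero_mem)
    have "?\<Delta> (comm (var g) (var h)) - (emb2 y + emb1 y * emb2 (p * q)) =
        emb2 (comm (var g) (var h) - y) + emb1 (comm (var g) (var h) - y) * emb2 (p * q) +
        emb1 (var h) * emb2 (comm (var g) q) + emb1 (var g) * emb2 (comm p (var h)) +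
        emb1 (var h * var g) * emb2 (comm p q)"
      unfolding hom_comm[OF algebra_hom_coproduct_free] g h comm_twisted_twisted
      by (simp only: hom_diff[OF algebra_hom_emb1] hom_diff[OF algebra_hom_emb2] left_diff_distrib)
        simp
    then show ?thesis using m y by (simp only: mem_intros emb_mem_I2)
  qed
  have p1: "?\<Delta> (var g) = emb2 (var g) + emb1 (var g) * emb2 1" if "g \<notin> {gP, gK}" for g
    using prim[OF that] by (simp add: emb_simps)
  have pt: "?\<Delta> (comm (var g) (var h)) - (emb2 y + emb1 y * emb2 ?q) \<in> I2 c"
    if "g \<notin> {gP, gK}" "h \<in> {gP, gK}" "comm (var g) (var h) - y \<in> I1 c" for g h y
    using tt[OF p1[OF that(1)] tw[OF that(2)] _ _ that(3)] by simp
  have tp: "?\<Delta> (comm (var g) (var h)) - (emb2 y + emb1 y * emb2 ?q) \<in> I2 c"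
    if "g \<in> {gP, gK}" "h \<notin> {gP, gK}" "comm (var g) (var h) - y \<in> I1 c" for g h y
    using tt[OF tw[OF that(1)] p1[OF that(2)] _ _ that(3)] by simp
  have M: "?\<Delta> (comm (var gM) (var g)) \<in> I2 c" for g
  proof (cases "g \<in> {gP, gK}")
    case True
    then show ?thesis using pt[of gM g 0] comm_M_mem[of g c] by (auto simp: hom_0[OF algebra_hom_emb1] hom_0[OF algebra_hom_emb2])
  next
    case False
    then show ?thesis using pp[of gM g 0] comm_M_mem[of g c] by (simp add: emb_simps)
  qed
  have mem: "?\<Delta> (comm (var gD) (var gP) + var gP) \<in> I2 c"
    "?\<Delta> (comm (var gD) (var gK) - var gK) \<in> I2 c"
    "?\<Delta> (comm (var gK) (var gP) - KP_bracket c) \<in> I2 c"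
    "?\<Delta> (comm (var gD) (var gH) + 2 * var gH) \<in> I2 c"
    "?\<Delta> (comm (var gD) (var gC) - 2 * var gC) \<in> I2 c"
    "?\<Delta> (comm (var gH) (var gC) - var gD) \<in> I2 c"
    "?\<Delta> (comm (var gK) (var gH) - var gP) \<in> I2 c"
    "?\<Delta> (comm (var gK) (var gC)) \<in> I2 c"
    "?\<Delta> (comm (var gP) (var gC) + var gK) \<in> I2 c"
    "?\<Delta> (comm (var gP) (var gH)) \<in> I2 c"
  proof -
    note R = relators_mem_I1[of _ c]
    note h\<Delta> = hom_add[OF algebra_hom_coproduct_free] hom_diff[OF algebra_hom_coproduct_free]
      hom_mult[OF algebra_hom_coproduct_free] hom_numeral[OF algebra_hom_coproduct_free]
    show "?\<Delta> (comm (var gD) (var gP) + var gP) \<in> I2 c"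
      using pt[of gD gP "- var gP"] R by (simp add: relators_def h\<Delta> tw emb_simps algebra_simps)
    show "?\<Delta> (comm (var gD) (var gK) - var gK) \<in> I2 c"
      using pt[of gD gK "var gK"] R by (simp add: relators_def h\<Delta> tw emb_simps)
    \<comment> \<open>Both generators are twisted, so the bracket gets the squared twist, which is
      exactly that of the coproduct of \<open>KP_bracket c\<close>.\<close>
    show "?\<Delta> (comm (var gK) (var gP) - KP_bracket c) \<in> I2 c"
      using tt[OF tw tw, of gK gP "KP_bracket c"] R
      by (simp add: relators_def hom_diff[OF algebra_hom_coproduct_free] coproduct_KP_bracket)
    show "?\<Delta> (comm (var gD) (var gH) + 2 * var gH) \<in> I2 c"
      using pp[of gD gH "- (2 * var gH)"] R
      by (simp add: relators_def h\<Delta> prim emb_simps algebra_simps distrib_left)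
    show "?\<Delta> (comm (var gD) (var gC) - 2 * var gC) \<in> I2 c"
      using pp[of gD gC "2 * var gC"] R
      by (simp add: relators_def h\<Delta> prim emb_simps distrib_left)
    show "?\<Delta> (comm (var gH) (var gC) - var gD) \<in> I2 c"
      using pp[of gH gC "var gD"] R
      by (simp add: relators_def h\<Delta> prim emb_simps)
    show "?\<Delta> (comm (var gK) (var gH) - var gP) \<in> I2 c"
      using tp[of gK gH "var gP"] R by (simp add: relators_def h\<Delta> tw emb_simps)
    show "?\<Delta> (comm (var gK) (var gC)) \<in> I2 c"
      using tp[of gK gC 0] R by (simp add: relators_def emb_simps)
    show "?\<Delta> (comm (var gP) (var gC) + var gK) \<in> I2 c"
      using tp[of gP gC "- var gK"] R by (simp add: relators_def h\<Delta> tw emb_simps algebra_simps)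
    show "?\<Delta> (comm (var gP) (var gH)) \<in> I2 c"
      using tp[of gP gH 0] R by (simp add: relators_def emb_simps)
  qed
  from assms show ?thesis
    unfolding relators_def using mem M by blast
qed

lemma coproduct_cl1: "coproduct c (cl1 c (var g)) = cl2 c (coproduct_gen c g)"
proof -
  have "coproduct_free c x \<in> I2 c" if "x \<in> I1 c" for x
    by (rule closed_ideal_image[OF algebra_hom_coproduct_free fps_closed_ideal_I2 _ that[unfolded I1_def]])
      (rule coproduct_free_relators)
  then show ?thesis
    unfolding coproduct_def cl1_def cl2_def[abs_def]
    by (simp only: induced_coset[OF algebra_hom_coproduct_free fps_closed_ideal_I1 fps_closed_ideal_I2]
        coproduct_free_var)
qed

section \<open>Conjugation by the R-matrix\<close>

text \<open>
  All functions of \<open>M \<otimes> 1\<close> and \<open>1 \<otimes> M\<close> are images of elements of the commutative ring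
  \<open>k[M\<^sub>1, M\<^sub>2][[h]]\<close>, so their identities can be proved there.
\<close>

definition central_embedding :: "(nat \<times> nat \<Rightarrow>\<^sub>0 'k::field_char_0) fps \<Rightarrow> 'k free2" where
  "central_embedding = push (\<lambda>(i, j). (replicate i gM, replicate j gM))"

lemma algebra_hom_central_embedding: "algebra_hom central_embedding"
  unfolding central_embedding_def
  by (rule algebra_hom_push) (auto simp: zero_prod_def zero_list_def plus_list_def replicate_add)

abbreviation M1 :: "'k::field_char_0 free2" where "M1 \<equiv> emb1 (var gM)"
abbreviation M2 :: "'k::field_char_0 free2" where "M2 \<equiv> emb2 (var gM)"

lemma f_element_eq:
  "f_element c = exp_at (half * (c2 c * M1)) * exp_at (half * (c2 c * M2)) *
     (series_at (inverse cosh_series) (half * (c2 c * M1 + c2 c * M2)) *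
      series_at arcsin_sqrt_series
       (series_at sinh_series (c2 c * M1) * series_at sinh_series (c2 c * M2) *
        series_at (inverse cosh_series) (half * (c2 c * M1 + c2 c * M2)) ^ 2))"
proof -
  have "half * c2 c * coproduct_free c (var gM) = half * (c2 c * M1 + c2 c * M2)"
    by (simp add: coproduct_free_var primitive_eq algebra_simps)
  then show ?thesis
    by (simp add: f_element_def Let_def tensor_eq_emb hom_series_at algebra_hom_emb1 algebra_hom_emb2
        emb_simps hom_half hom_c2 mult.assoc)
qed

text \<open>Images of the identities in the commutative ring. They hold exactly in the free tensor
  square, not merely modulo the ideal.\<close>

lemma rotation_identities:
  fixes c :: "'k::field_char_0"
  defines "q1 \<equiv> emb1 (qM c)" and "q2 \<equiv> emb2 (qM c)" and "f \<equiv> f_element c"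
  defines "d1 \<equiv> half * (1 - q1 ^ 2)" and "d2 \<equiv> half * (1 - q2 ^ 2)"
  defines "T \<equiv> f ^ 2 * d1 * d2"
  shows "T $ 0 = 0"
    and "series_at cos_sqrt_series T - series_at sinc_sqrt_series T * (q2 * f * d1) = q1"
    and "series_at sinc_sqrt_series T * (f * d2) + series_at cos_sqrt_series T * q2 = 1"
proof -
  define y1 y2 :: "(nat \<times> nat \<Rightarrow>\<^sub>0 'k) fps" where
    "y1 = c2 c * fps_const (Poly_Mapping.single (1, 0) 1)" and
    "y2 = c2 c * fps_const (Poly_Mapping.single (0, 1) 1)"
  let ?\<pi> = "central_embedding :: _ \<Rightarrow> 'k free2"
  note hom = algebra_hom_central_embedding
  have y0: "y1 $ 0 = 0" "y2 $ 0 = 0" by (simp_all add: y1_def y2_def)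
  have y: "?\<pi> y1 = c2 c * M1" "?\<pi> y2 = c2 c * M2"
    by (simp_all add: y1_def y2_def hom_mult[OF hom] hom_c2[OF hom])
      (simp_all add: central_embedding_def emb1_def emb2_def var_def push_const zero_list_def)
  have q: "?\<pi> (exp_at (- y1)) = q1" "?\<pi> (exp_at (- y2)) = q2"
    by (simp_all add: hom_series_at[OF hom] y0 hom_uminus[OF hom] y q1_def q2_def hom_qM
        algebra_hom_emb1 algebra_hom_emb2)
  define f' where "f' = exp_at (half * y1) * exp_at (half * y2) *
     (series_at (inverse cosh_series) (half * (y1 + y2)) *
      series_at arcsin_sqrt_series (series_at sinh_series y1 * series_at sinh_series y2 *
        series_at (inverse cosh_series) (half * (y1 + y2)) ^ 2))"
  note rot = arcsin_rotation[OF y0, folded f'_def]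
  have s0: "series_at sinh_series y1 $ 0 = 0"
    by (simp add: series_at_nth_0[OF y0(1)] sinh_series_def)
  have f: "?\<pi> f' = f"
    by (simp add: f'_def f_def f_element_eq hom_mult[OF hom] hom_power[OF hom] hom_add[OF hom]
        hom_series_at[OF hom] y0 y hom_half[OF hom] s0)
  let ?d1 = "half * (1 - exp_at (- y1) ^ 2)" and ?d2 = "half * (1 - exp_at (- y2) ^ 2)"
  have d: "?\<pi> ?d1 = d1" "?\<pi> ?d2 = d2"
    by (simp_all add: hom_mult[OF hom] hom_half[OF hom] hom_diff[OF hom] hom_1[OF hom]
        hom_power[OF hom] q d1_def d2_def)
  have T: "?\<pi> (f' ^ 2 * ?d1 * ?d2) = T"
    unfolding T_def f[symmetric] d[symmetric] by (simp only: hom_mult[OF hom] hom_power[OF hom])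
  show "T $ 0 = 0"
    using hom_nth_0[OF hom rot(1)] by (simp only: T)
  show "series_at cos_sqrt_series T - series_at sinc_sqrt_series T * (q2 * f * d1) = q1"
    using arg_cong[OF rot(2), of ?\<pi>]
    unfolding T[symmetric] f[symmetric] d[symmetric] q[symmetric]
    by (simp only: hom_mult[OF hom] hom_diff[OF hom] hom_series_at[OF hom rot(1)])
  show "series_at sinc_sqrt_series T * (f * d2) + series_at cos_sqrt_series T * q2 = 1"
    using arg_cong[OF rot(3), of ?\<pi>]
    unfolding T[symmetric] f[symmetric] d[symmetric] q[symmetric]
    by (simp only: hom_mult[OF hom] hom_add[OF hom] hom_1[OF hom] hom_series_at[OF hom rot(1)])
qed

lemma KP_bracket_commute_M: "var gM * KP_bracket c = KP_bracket c * var gM"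
proof (rule fps_X_cancel_left)
  let ?y = "- (c2 c * var gM)"
  \<comment> \<open>Modulo the zero ideal, commuting means being equal, so the general rule for
    series yields an exact identity.\<close>
  interpret zero: fps_closed_ideal "{0} :: 'a free1 set"
  proof
    fix x :: "'a free1"
    assume "\<And>n. \<exists>y\<in>{0}. fps_agree n x y"
    then show "x \<in> {0}" by (auto simp: fps_agree_def fps_eq_iff)
  qed auto
  have "zero.commutes ?y (var gM)"
    by (intro zero.commutes_uminus zero.commutes_mult zero.commutes_if_eq[OF c2_commute])
      (simp add: zero.commutes_def comm_self)
  then have "zero.commutes (qM c) (var gM)"
    by (intro commutes_series_at zero.fps_closed_ideal_axioms) simp_all
  then have q: "qM c * var gM = var gM * qM c" by (simp add: zero.commutes_def comm_def)
  then have "var gM * (1 - qM c * qM c) = (1 - qM c * qM c) * var gM"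
    by (simp add: algebra_simps) (simp add: q flip: mult.assoc)
  moreover have "fps_X * (var gM * KP_bracket c) = var gM * (fps_X * KP_bracket c)"
    using scalar_left_commute[of "var gM" fps_X "KP_bracket c"] by (simp only: scalar_fps_X)
  moreover have "var gM * (const_scalar (inverse (2 * c)) * (1 - qM c * qM c)) =
      const_scalar (inverse (2 * c)) * (var gM * (1 - qM c * qM c))"
    by (rule scalar_left_commute)
  ultimately show "fps_X * (var gM * KP_bracket c) = fps_X * (KP_bracket c * var gM)"
    by (simp only: mult.assoc[of fps_X, symmetric] fps_X_KP_bracket) (simp only: mult.assoc)
qed

context
  fixes c :: "'k::field_char_0"
begin

interpretation fps_closed_ideal "I2 c" by (rule fps_closed_ideal_I2)

lemma commutes_f_element:
  assumes "commutes M1 z" "commutes M2 z"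
  shows "commutes (f_element c) z"
proof -
  have half: "commutes half z" for z
    by (rule commutes_if_eq) (simp add: half_def scalar_commute)
  have y: "commutes (c2 c * M1) z" "commutes (c2 c * M2) z"
    by (intro commutes_mult commutes_if_eq[OF c2_commute] assms)+
  have s: "(series_at sinh_series (c2 c * M1)) $ 0 = 0"
    by (subst series_at_nth_0) (simp_all add: sinh_series_def)
  show ?thesis
    unfolding f_element_eq
    by (intro commutes_mult commutes_power commutes_series_at[OF fps_closed_ideal_I2] commutes_add half y)
      (simp_all add: s)
qed

lemma commutes_M_emb:
  "commutes M1 (emb1 (var g))" "commutes M1 (emb2 x)"
  "commutes M2 (emb2 (var g))" "commutes M2 (emb1 x)"
  using emb_mem_I2[OF comm_M_mem[of g c]]
  by (simp_all add: commutes_def emb_simps comm_emb12 comm_emb21 zero_mem)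

lemma commutes_f_var: "commutes (f_element c) (emb1 (var g))" "commutes (f_element c) (emb2 (var g))"
  by (intro commutes_f_element commutes_M_emb)+

lemma commutes_f_KP_bracket:
  "commutes (f_element c) (emb1 (KP_bracket c))" "commutes (f_element c) (emb2 (KP_bracket c))"
proof -
  have "commutes M1 (emb1 (KP_bracket c))" "commutes M2 (emb2 (KP_bracket c))"
    by (rule commutes_if_eq;
        simp only: KP_bracket_commute_M flip: hom_mult[OF algebra_hom_emb1] hom_mult[OF algebra_hom_emb2])+
  then show "commutes (f_element c) (emb1 (KP_bracket c))" "commutes (f_element c) (emb2 (KP_bracket c))"
    by (auto intro: commutes_f_element commutes_M_emb)
qed

abbreviation (input) "P1 \<equiv> emb1 (var gP) :: 'k free2"
abbreviation (input) "P2 \<equiv> emb2 (var gP) :: 'k free2"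
abbreviation (input) "K1 \<equiv> emb1 (var gK) :: 'k free2"
abbreviation (input) "K2 \<equiv> emb2 (var gK) :: 'k free2"
abbreviation (input) "PK \<equiv> wedge (var gP) (var gK) :: 'k free2"

lemma wedge_eq: "PK = P1 * K2 - K1 * P2"
  by (simp add: wedge_def tensor_eq_emb)

text \<open>For X in {P, K}, only the term of the wedge with the other generator in the same leg
  contributes, and it leaves X in the opposite leg. Antisymmetry of the wedge gives P and K the same
  sign.\<close>

lemma comm_wedge_PK:
  assumes "g \<in> {gP, gK}"
  shows "comm PK (emb1 (var g)) + emb1 (KP_bracket c) * emb2 (var g) \<in> I2 c"
    and "comm PK (emb2 (var g)) - emb2 (KP_bracket c) * emb1 (var g) \<in> I2 c"
proof -
  let ?r = "comm (var gK) (var gP) - KP_bracket c"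
  have r: "emb1 ?r \<in> I2 c" "emb2 ?r \<in> I2 c" by (rule emb_mem_I2[OF comm_mem_I1(3)])+
  have "comm PK (emb1 (var g)) + emb1 (KP_bracket c) * emb2 (var g) = - (emb1 ?r * emb2 (var g))"
    using assms by (auto simp: wedge_eq emb_simps comm_def algebra_simps emb_commute emb_left_commute)
  then show "comm PK (emb1 (var g)) + emb1 (KP_bracket c) * emb2 (var g) \<in> I2 c"
    using r by (simp only: mem_intros)
  have "comm PK (emb2 (var g)) - emb2 (KP_bracket c) * emb1 (var g) = emb1 (var g) * emb2 ?r"
    using assms by (auto simp: wedge_eq emb_simps comm_def algebra_simps emb_commute emb_left_commute)
  then show "comm PK (emb2 (var g)) - emb2 (KP_bracket c) * emb1 (var g) \<in> I2 c"
    using r by (simp only: mem_intros)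
qed

text \<open>D, H and C act on the span of P and K by traceless matrices and therefore annihilate its
  second exterior power; M acts by zero.\<close>

lemma comm_wedge_primitive:
  assumes "g \<notin> {gP, gK}"
  shows "comm PK (primitive (var g)) \<in> I2 c"
proof -
  have expand: "comm PK (primitive (var g)) =
      P1 * emb2 (comm (var gK) (var g)) + emb1 (comm (var gP) (var g)) * K2 -
      K1 * emb2 (comm (var gP) (var g)) - emb1 (comm (var gK) (var g)) * P2"
    by (simp add: wedge_eq primitive_eq emb_simps comm_def algebra_simps emb_commute emb_left_commute)
  \<comment> \<open>With \<open>p\<close> and \<open>k\<close> standing for the brackets of P and K
    with the generator, the last premise says that p \<and> K + P \<and> k vanishes.\<close>
  have cancel: "comm PK (primitive (var g)) \<in> I2 c"
    if "comm (var gP) (var g) - p \<in> I1 c" "comm (var gK) (var g) - k \<in> I1 c"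
      "P1 * emb2 k + emb1 p * K2 = K1 * emb2 p + emb1 k * P2" for p k
  proof -
    have "comm PK (primitive (var g)) =
        P1 * emb2 (comm (var gK) (var g) - k) + emb1 (comm (var gP) (var g) - p) * K2 -
        K1 * emb2 (comm (var gP) (var g) - p) - emb1 (comm (var gK) (var g) - k) * P2"
      unfolding expand using that(3)
      by (simp add: hom_diff[OF algebra_hom_emb1] hom_diff[OF algebra_hom_emb2] algebra_simps)
    then show ?thesis using that(1,2) by (simp only: mem_intros emb_mem_I2)
  qed
  interpret I1: fps_closed_ideal "I1 c" by (rule fps_closed_ideal_I1)
  show ?thesis
  proof (cases g)
    case gD
    have e: "comm (var gP) (var gD) - var gP = - (comm (var gD) (var gP) + var gP)"
      "comm (var gK) (var gD) - (- var gK) = - (comm (var gD) (var gK) - var gK)"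
      by (simp_all add: comm_def)
    have "comm (var gP) (var gD) - var gP \<in> I1 c" "comm (var gK) (var gD) - (- var gK) \<in> I1 c"
      unfolding e by (rule I1.uminus_mem, rule comm_mem_I1)+
    then show ?thesis
      unfolding gD by (intro cancel[unfolded gD]) (assumption, assumption, simp add: emb_simps)
  next
    case gH
    then show ?thesis
      using comm_mem_I1(4,7)[of c] by (intro cancel[of 0 "var gP"]) (simp_all add: emb_simps emb_commute)
  next
    case gC
    then show ?thesis
      using comm_mem_I1(5,6)[of c] by (intro cancel[of "- var gK" 0]) (simp_all add: emb_simps emb_commute)
  next
    case gM
    have e: "comm (var gP) (var gM) - 0 = - comm (var gM) (var gP)"
      "comm (var gK) (var gM) - 0 = - comm (var gM) (var gK)"
      by (simp_all add: comm_def)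
    have "comm (var gP) (var gM) - 0 \<in> I1 c" "comm (var gK) (var gM) - 0 \<in> I1 c"
      unfolding e by (rule I1.uminus_mem, rule comm_M_mem)+
    then show ?thesis
      unfolding gM by (intro cancel[unfolded gM]) (assumption, assumption, simp add: emb_simps)
  qed (use assms in auto)
qed

section \<open>The adjoint action of the exponent of R\<close>

lemma R_exponent_nth_0: "R_exponent c $ 0 = 0"
  by (simp add: R_exponent_def)

lemma comm_R_exponent:
  "comm (R_exponent c) z = c2 c * (PK * comm (f_element c) z) + c2 c * (comm PK z * f_element c)"
proof -
  have "comm (c2 c) z = 0" by (simp add: comm_def c2_commute)
  then show ?thesis
    by (simp add: R_exponent_def comm_mult_left mult.assoc distrib_left)
qed

lemma comm_R_exponent_primitive:
  assumes "g \<notin> {gP, gK}"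
  shows "comm (R_exponent c) (primitive (var g)) \<in> I2 c"
proof -
  have "commutes (f_element c) (primitive (var g))"
    using commutes_f_var[of g] unfolding primitive_eq by (meson commutes_add commutes_sym)
  then show ?thesis
    unfolding comm_R_exponent commutes_def using comm_wedge_primitive[OF assms]
    by (intro mem_intros)
qed

lemma comm_R_exponent_emb1:
  assumes "g \<in> {gP, gK}"
  shows "comm (R_exponent c) (emb1 (var g)) +
      f_element c * (c2 c * emb1 (KP_bracket c)) * emb2 (var g) \<in> I2 c"
proof -
  let ?f = "f_element c" and ?z = "emb1 (KP_bracket c)" and ?x1 = "emb1 (var g)" and ?x2 = "emb2 (var g)"
  have "comm (R_exponent c) ?x1 + ?f * (c2 c * ?z) * ?x2 =
      c2 c * (PK * comm ?f ?x1) + c2 c * ((comm PK ?x1 + ?z * ?x2) * ?f) + c2 c * comm ?f (?z * ?x2)"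
    unfolding comm_R_exponent
    by (simp add: comm_def[of ?f "?z * ?x2"] algebra_simps scalar_left_commute[of ?f] c2_def)
  moreover have "comm ?f (?z * ?x2) \<in> I2 c"
    using commutes_f_KP_bracket(1) commutes_f_var(2) commutes_mult commutes_sym
    unfolding commutes_def by blast
  ultimately show ?thesis
    using comm_wedge_PK(1)[OF assms] commutes_f_var(1)[of g] unfolding commutes_def
    by (simp only: mem_intros)
qed

lemma comm_R_exponent_emb2:
  assumes "g \<in> {gP, gK}"
  shows "comm (R_exponent c) (emb2 (var g)) -
      f_element c * (c2 c * emb2 (KP_bracket c)) * emb1 (var g) \<in> I2 c"
proof -
  let ?f = "f_element c" and ?z = "emb2 (KP_bracket c)" and ?x1 = "emb1 (var g)" and ?x2 = "emb2 (var g)"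
  have "comm (R_exponent c) ?x2 - ?f * (c2 c * ?z) * ?x1 =
      c2 c * (PK * comm ?f ?x2) + c2 c * ((comm PK ?x2 - ?z * ?x1) * ?f) - c2 c * comm ?f (?z * ?x1)"
    unfolding comm_R_exponent
    by (simp add: comm_def[of ?f "?z * ?x1"] algebra_simps scalar_left_commute[of ?f] c2_def)
  moreover have "comm ?f (?z * ?x1) \<in> I2 c"
    using commutes_f_KP_bracket(2) commutes_f_var(1) commutes_mult commutes_sym
    unfolding commutes_def by blast
  ultimately show ?thesis
    using comm_wedge_PK(2)[OF assms] commutes_f_var(2)[of g] unfolding commutes_def
    by (simp only: mem_intros)
qed

lemma commutes_R_exponent:
  assumes "commutes M1 z" "commutes M2 z" "commutes P1 z" "commutes P2 z" "commutes K1 z" "commutes K2 z"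
  shows "commutes (R_exponent c) z"
  unfolding R_exponent_def wedge_eq using assms
  by (intro commutes_mult commutes_diff commutes_f_element commutes_if_eq[OF c2_commute])

lemma commutes_qM_any:
  shows "commutes (emb1 (qM c)) (emb1 (var g))" "commutes (emb2 (qM c)) (emb2 (var g))"
    "commutes (emb1 (qM c)) (emb2 x)" "commutes (emb2 (qM c)) (emb1 x)"
  using emb_mem_I2[OF commutes_qM(1)[of c g]]
  by (simp_all add: commutes_def emb_simps comm_emb12 comm_emb21 zero_mem)

lemma R_exponent_conjugation_PK:
  assumes c: "c \<noteq> 0" and g: "g \<in> {gP, gK}"
  shows "exp_at (R_exponent c) * coproduct_gen c g -
      swap2 (coproduct_gen c g) * exp_at (R_exponent c) \<in> I2 c"
proof -
  let ?A = "R_exponent c" and ?x1 = "emb1 (var g)" and ?x2 = "emb2 (var g)"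
  let ?f = "f_element c" and ?q1 = "emb1 (qM c)" and ?q2 = "emb2 (qM c)"
  define d1 where "d1 = half * (1 - ?q1 ^ 2)"
  define d2 where "d2 = half * (1 - ?q2 ^ 2)"
  define T where "T = ?f ^ 2 * d1 * d2"
  note rot = rotation_identities[of c, folded d1_def d2_def, folded T_def]
  let ?C = "series_at cos_sqrt_series T" and ?S = "series_at sinc_sqrt_series T"
  have d: "c2 c * emb1 (KP_bracket c) = d1" "c2 c * emb2 (KP_bracket c) = d2"
    using arg_cong[OF c2_KP_bracket[OF c], of emb1] arg_cong[OF c2_KP_bracket[OF c], of emb2]
    by (simp_all add: emb_simps hom_c2 hom_half algebra_hom_emb1 algebra_hom_emb2 d1_def d2_def)
  have a1: "comm ?A ?x1 + ?f * d1 * ?x2 \<in> I2 c" and a2: "comm ?A ?x2 - ?f * d2 * ?x1 \<in> I2 c"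
    using comm_R_exponent_emb1[OF g] comm_R_exponent_emb2[OF g] by (simp_all only: d)
  have half: "commutes half z" for z
    by (rule commutes_if_eq) (simp add: half_def scalar_commute)
  have q_var: "commutes ?q1 (emb1 (var h))" "commutes ?q1 (emb2 (var h))"
      "commutes ?q2 (emb1 (var h))" "commutes ?q2 (emb2 (var h))" for h
    by (intro commutes_qM_any)+
  have qA: "commutes ?q1 ?A" "commutes ?q2 ?A"
    by (rule commutes_sym, intro commutes_R_exponent commutes_sym[OF q_var(1)]
        commutes_sym[OF q_var(2)] commutes_sym[OF q_var(3)] commutes_sym[OF q_var(4)])+
  have dz: "commutes d1 z" "commutes d2 z" if "commutes ?q1 z" "commutes ?q2 z" for z
    unfolding d1_def d2_def by (intro commutes_mult commutes_diff commutes_power half commutes_1 that)+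
  have fq: "commutes ?f ?q1" "commutes ?f ?q2"
    by (intro commutes_f_element; intro commutes_sym[OF q_var(1)] commutes_sym[OF q_var(2)]
        commutes_sym[OF q_var(3)] commutes_sym[OF q_var(4)])+
  have f_M: "commutes ?f M1" "commutes ?f M2" by (rule commutes_f_var)+
  have fA: "commutes ?f ?A"
    by (rule commutes_sym, intro commutes_R_exponent) (intro commutes_sym[OF commutes_f_var(1)]
        commutes_sym[OF commutes_f_var(2)])+
  have df: "commutes d1 ?f" "commutes d2 ?f" by (intro dz commutes_sym[OF fq(1)] commutes_sym[OF fq(2)])+
  have dA: "commutes d1 ?A" "commutes d2 ?A" by (intro dz qA)+
  have dd: "commutes d1 d2" "commutes d1 ?q2" "commutes ?q2 ?f"
  proof -
    have q12: "commutes ?q1 ?q2" "commutes ?q2 ?q1" "commutes ?q1 ?q1" "commutes ?q2 ?q2"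
      by (simp_all add: commutes_def comm_emb12 comm_emb21 comm_self zero_mem)
    show "commutes d1 ?q2" by (rule dz(1)[OF q12(1,4)])
    show "commutes d1 d2"
      by (rule dz(1)[OF commutes_sym[OF dz(2)[OF q12(3,2)]] commutes_sym[OF dz(2)[OF q12(1,4)]]])
    show "commutes ?q2 ?f" by (rule commutes_sym[OF fq(2)])
  qed
  have TA: "commutes T ?A"
    unfolding T_def by (intro commutes_mult commutes_power fA dA)
  \<comment> \<open>\<open>?u\<close> is the coproduct of X with its factors reordered, and
    \<open>?v\<close> is its image under ad A, by the rules for the two legs.\<close>
  let ?u = "?x2 + ?q2 * ?x1" and ?v = "?f * d2 * ?x1 - ?q2 * ?f * d1 * ?x2"
  have u: "comm ?A ?u - ?v \<in> I2 c"
  proof -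
    have "comm ?A ?u - ?v = (comm ?A ?x2 - ?f * d2 * ?x1) + ?q2 * (comm ?A ?x1 + ?f * d1 * ?x2) +
        comm ?A ?q2 * ?x1"
      by (simp add: comm_add_right comm_mult_right algebra_simps)
    moreover have "comm ?A ?q2 \<in> I2 c" using commutes_sym[OF qA(2)] by (simp add: commutes_def)
    ultimately show ?thesis using a1 a2 by (simp only: mem_intros)
  qed
  \<comment> \<open>The second application of ad A closes up to \<open>- T * ?u\<close>. The
    remaining differences come from reordering \<open>f\<close>, \<open>d1\<close>,
    \<open>d2\<close> and \<open>q2\<close>, which are handled modulo the ideal.\<close>
  have v: "comm ?A ?v + T * ?u \<in> I2 c"
  proof -
    have fd: "commutes (?f * d2) ?A" "commutes (?q2 * ?f * d1) ?A"
      by (intro commutes_mult fA dA qA)+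
    have "comm ?A ?v + T * ?u =
        ?f * d2 * (comm ?A ?x1 + ?f * d1 * ?x2) + comm ?A (?f * d2) * ?x1
        - ?q2 * ?f * d1 * (comm ?A ?x2 - ?f * d2 * ?x1) - comm ?A (?q2 * ?f * d1) * ?x2
        - (?f * d2 * (?f * d1) - T) * ?x2 - (?q2 * ?f * d1 * (?f * d2) - T * ?q2) * ?x1"
      by (simp only: comm_diff_right comm_mult_right) (simp add: algebra_simps)
    moreover have "?f * d2 * (?f * d1) - T \<in> I2 c"
    proof -
      have "?f * d2 * (?f * d1) - T = ?f * comm d2 ?f * d1 - ?f * ?f * comm d1 d2"
        by (simp add: T_def comm_def algebra_simps power2_eq_square)
      then show ?thesis using df(2) dd(1) by (simp only: commutes_def mem_intros)
    qed
    moreover have "?q2 * ?f * d1 * (?f * d2) - T * ?q2 \<in> I2 c"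
    proof -
      have "commutes ?q2 T"
        unfolding T_def
        by (rule commutes_sym, intro commutes_mult commutes_power fq(2) dd(2) dz(2))
          (simp_all add: commutes_def comm_emb12 comm_emb21 comm_self zero_mem)
      moreover have "?q2 * ?f * d1 * (?f * d2) - T * ?q2 =
          ?q2 * ?f * comm d1 ?f * d2 + comm ?q2 T"
        by (simp add: T_def comm_def algebra_simps power2_eq_square)
      ultimately show ?thesis using df(1) by (simp only: commutes_def mem_intros)
    qed
    ultimately show ?thesis
      using a1 a2 commutes_sym[OF fd(1)] commutes_sym[OF fd(2)]
      by (simp only: commutes_def mem_intros)
  qed
  have "exp_at ?A * ?u - (?C * ?u + ?S * ?v) * exp_at ?A \<in> I2 c"
    using exp_at_rotation[OF fps_closed_ideal_I2 R_exponent_nth_0 rot(1) u v] commutes_sym[OF TA]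
    by (simp add: commutes_def)
  \<comment> \<open>By the rotation identities the coefficients of \<open>?x2\<close> and
    \<open>?x1\<close> are \<open>q1\<close> and 1, as in the flipped coproduct.\<close>
  moreover have "?C * ?u + ?S * ?v = (?C - ?S * (?q2 * ?f * d1)) * ?x2 + (?S * (?f * d2) + ?C * ?q2) * ?x1"
    by (simp add: algebra_simps)
  then have "?C * ?u + ?S * ?v = swap2 (coproduct_gen c g)"
    unfolding rot by (simp add: coproduct_gen_PK[OF g] hom_add[OF algebra_hom_swap2]
        hom_mult[OF algebra_hom_swap2] emb_commute)
  moreover have "coproduct_gen c g = ?u"
    by (simp add: coproduct_gen_PK[OF g] emb_commute)
  ultimately show ?thesis by simp
qed

lemma R_exponent_conjugation:
  assumes c: "c \<noteq> 0"
  shows "exp_at (R_exponent c) * coproduct_gen c g -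
      swap2 (coproduct_gen c g) * exp_at (R_exponent c) \<in> I2 c"
proof (cases "g \<in> {gP, gK}")
  case False
  then have "coproduct_gen c g = primitive (var g)" "swap2 (coproduct_gen c g) = primitive (var g)"
    by (cases g; simp add: primitive_eq hom_add[OF algebra_hom_swap2])+
  moreover have "commutes (exp_at (R_exponent c)) (primitive (var g))"
    using comm_R_exponent_primitive[OF False]
    by (intro commutes_series_at fps_closed_ideal_I2 R_exponent_nth_0) (simp add: commutes_def)
  ultimately show ?thesis by (simp add: commutes_def comm_def)
qed (rule R_exponent_conjugation_PK[OF c])

end

section \<open>Failure of the quantum Yang--Baxter equation\<close>

definition matrix_rep :: "('m::monoid_add \<Rightarrow> 'i::finite \<Rightarrow> 'i \<Rightarrow> 'k::comm_ring_1) \<Rightarrow> bool" where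
  "matrix_rep m \<longleftrightarrow> (\<forall>u v i j. m (u + v) i j = (\<Sum>l\<in>UNIV. m u i l * m v l j))"

definition rep_entry :: "('m \<Rightarrow> 'i \<Rightarrow> 'i \<Rightarrow> 'k::comm_ring_1) \<Rightarrow> ('m \<Rightarrow>\<^sub>0 'k) \<Rightarrow> 'i \<Rightarrow> 'i \<Rightarrow> 'k" where
  "rep_entry m p i j = linear_ext (\<lambda>u a. a * m u i j) p"

lemma rep_entry_zero: "rep_entry m 0 i j = 0"
  and rep_entry_add: "rep_entry m (p + q) i j = rep_entry m p i j + rep_entry m q i j"
  and rep_entry_single: "rep_entry m (Poly_Mapping.single u a) i j = a * m u i j"
  unfolding rep_entry_def
  by (rule linear_ext_zero linear_ext_add linear_ext_single; simp add: distrib_right)+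

lemma rep_entry_uminus: "rep_entry m (- p) i j = - rep_entry m p i j"
  using rep_entry_add[of m p "- p" i j] by (simp add: rep_entry_zero eq_neg_iff_add_eq_0 add.commute)

lemma rep_entry_diff: "rep_entry m (p - q) i j = rep_entry m p i j - rep_entry m q i j"
  using rep_entry_add[of m p "- q" i j] by (simp add: rep_entry_uminus)

lemma rep_entry_sum: "rep_entry m (sum f A) i j = (\<Sum>x\<in>A. rep_entry m (f x) i j)"
  by (induction A rule: infinite_finite_induct) (simp_all add: rep_entry_zero rep_entry_add)

lemmas rep_entry_simps =
  rep_entry_zero rep_entry_add rep_entry_single rep_entry_uminus rep_entry_diff rep_entry_sum

lemma rep_entry_mult:
  assumes "matrix_rep m"
  shows "rep_entry m (p * q) i j = (\<Sum>l\<in>UNIV. rep_entry m p i l * rep_entry m q l j)"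
proof (induction p rule: poly_mapping_add_induct)
  case (single u a)
  show ?case
  proof (induction q rule: poly_mapping_add_induct)
    case (single v b)
    show ?case
      using assms by (simp add: mult_single rep_entry_single matrix_rep_def sum_distrib_left mult_ac)
  qed (simp_all add: rep_entry_simps algebra_simps sum.distrib)
qed (simp_all add: rep_entry_simps algebra_simps sum.distrib)

text \<open>The kernel of the representation extended linearly over k[[h]]; matrices over k[[h]]
  vanish coefficient by coefficient.\<close>

definition rep_kernel :: "('m \<Rightarrow> 'i \<Rightarrow> 'i \<Rightarrow> 'k::comm_ring_1) \<Rightarrow> ('m \<Rightarrow>\<^sub>0 'k) fps set" where
  "rep_kernel m = {x. \<forall>n i j. rep_entry m (x $ n) i j = 0}"

lemma fps_closed_ideal_rep_kernel:
  assumes "matrix_rep m"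
  shows "fps_closed_ideal (rep_kernel m)"
proof
  fix x assume x: "\<exists>y\<in>rep_kernel m. fps_agree n x y" for n
  show "x \<in> rep_kernel m"
    unfolding rep_kernel_def
  proof safe
    fix n i j
    from x[of n] show "rep_entry m (x $ n) i j = 0"
      by (auto simp: rep_kernel_def fps_agree_def)
  qed
qed (auto simp: rep_kernel_def rep_entry_simps fps_mult_nth rep_entry_mult[OF assms])

text \<open>Matrices over k[[h]] have no h-torsion. So h can be cancelled modulo this kernel, which
  the bracket of K and P requires.\<close>

lemma rep_kernel_fps_X_mult: "fps_X * x \<in> rep_kernel m \<Longrightarrow> x \<in> rep_kernel m"
  unfolding rep_kernel_def
proof safe
  fix n i j
  assume "\<forall>n i j. rep_entry m ((fps_X * x) $ n) i j = 0"
  then have "rep_entry m ((fps_X * x) $ Suc n) i j = 0" by blast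
  then show "rep_entry m (x $ n) i j = 0" by simp
qed

lemma fps_const_mem_rep_kernel:
  "fps_const p \<in> rep_kernel m \<longleftrightarrow> (\<forall>i j. rep_entry m p i j = 0)"
  by (auto simp: rep_kernel_def rep_entry_zero split: if_splits)

text \<open>
  The four-dimensional representation of the undeformed Schroedinger algebra. Since \<open>M\<close> acts with
  square zero, \<open>[K, P]\<close> acts as \<open>M\<close>, and it is a representation of the deformed algebra, too.
\<close>

datatype index = B0 | B1 | B2 | B3

lemma UNIV_index: "(UNIV :: index set) = {B0, B1, B2, B3}"
  by (auto intro: index.exhaust)

instance index :: finite
  by standard (simp add: UNIV_index)

text \<open>D, H and C form the two-dimensional representation of sl(2) on the indices
  \<open>B1\<close> and \<open>B2\<close>; P and K connect this block with \<open>B0\<close> and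
  \<open>B3\<close>. At (\<open>B0\<close>, \<open>B3\<close>) the products KP and PK have entries
  1/2 and - 1/2, so their difference is M.\<close>

fun schroedinger_matrix :: "generator \<Rightarrow> index \<Rightarrow> index \<Rightarrow> 'k::field_char_0" where
  "schroedinger_matrix gM B0 B3 = 1"
| "schroedinger_matrix gP B0 B1 = 1"
| "schroedinger_matrix gP B2 B3 = 1 / 2"
| "schroedinger_matrix gK B0 B2 = 1"
| "schroedinger_matrix gK B1 B3 = - 1 / 2"
| "schroedinger_matrix gD B1 B1 = 1"
| "schroedinger_matrix gD B2 B2 = - 1"
| "schroedinger_matrix gH B2 B1 = 1"
| "schroedinger_matrix gC B1 B2 = - 1"
| "schroedinger_matrix _ _ _ = 0"

fun word_matrix :: "generator list \<Rightarrow> index \<Rightarrow> index \<Rightarrow> 'k::field_char_0" where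
  "word_matrix [] i j = (if i = j then 1 else 0)"
| "word_matrix (g # w) i j = (\<Sum>l\<in>UNIV. schroedinger_matrix g i l * word_matrix w l j)"

lemma matrix_rep_word: "matrix_rep (word_matrix :: _ \<Rightarrow> _ \<Rightarrow> _ \<Rightarrow> 'k::field_char_0)"
  unfolding matrix_rep_def
proof (intro allI)
  fix u v i j
  show "word_matrix (u + v) i j = (\<Sum>l\<in>UNIV. word_matrix u i l * word_matrix v l j :: 'k)"
  proof (induction u arbitrary: i)
    case (Cons g u)
    have "word_matrix ((g # u) + v) i j =
        (\<Sum>k\<in>UNIV. \<Sum>l\<in>UNIV. schroedinger_matrix g i k * word_matrix u k l * word_matrix v l j :: 'k)"
      using Cons by (simp add: plus_list_def sum_distrib_left mult.assoc)
    also have "\<dots> = (\<Sum>l\<in>UNIV. \<Sum>k\<in>UNIV. schroedinger_matrix g i k * word_matrix u k l * word_matrix v l j)"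
      by (rule sum.swap)
    finally show ?case by (simp add: sum_distrib_right)
  qed (simp add: plus_list_def if_distrib[of "\<lambda>x. x * _"] cong: if_cong)
qed

fun triple_matrix ::
    "generator list \<times> generator list \<times> generator list \<Rightarrow> index \<times> index \<times> index \<Rightarrow>
     index \<times> index \<times> index \<Rightarrow> 'k::field_char_0" where
  "triple_matrix (u, v, w) (i, j, k) (i', j', k') =
     word_matrix u i i' * word_matrix v j j' * word_matrix w k k'"

lemma matrix_rep_triple: "matrix_rep (triple_matrix :: _ \<Rightarrow> _ \<Rightarrow> _ \<Rightarrow> 'k::field_char_0)"
  unfolding matrix_rep_def
proof (intro allI)
  fix s t :: "generator list \<times> generator list \<times> generator list"
    and a b :: "index \<times> index \<times> index"
  obtain u v w u' v' w' where st: "s = (u, v, w)" "t = (u', v', w')" by (metis surj_pair)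
  obtain i j k i' j' k' where ab: "a = (i, j, k)" "b = (i', j', k')" by (metis surj_pair)
  have "triple_matrix (s + t) a b = (\<Sum>l\<in>UNIV. word_matrix u i l * word_matrix u' l i') *
      ((\<Sum>m\<in>UNIV. word_matrix v j m * word_matrix v' m j') *
       (\<Sum>n\<in>UNIV. word_matrix w k n * (word_matrix w' n k' :: 'k)))"
    using matrix_rep_word[where 'k='k] by (simp add: st ab matrix_rep_def mult.assoc)
  also have "\<dots> = (\<Sum>(l, m, n)\<in>UNIV \<times> UNIV \<times> UNIV. word_matrix u i l * word_matrix u' l i' *
      (word_matrix v j m * word_matrix v' m j' * (word_matrix w k n * word_matrix w' n k')))"
    by (simp only: sum_product sum.cartesian_product case_prod_unfold fst_conv snd_conv)
  also have "\<dots> = (\<Sum>l\<in>UNIV. triple_matrix s a l * triple_matrix t l b)"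
    by (simp add: st ab case_prod_unfold mult_ac) (auto intro!: sum.cong)
  finally show "triple_matrix (s + t) a b = (\<Sum>l\<in>UNIV. triple_matrix s a l * triple_matrix t l b :: 'k)" .
qed

lemma rep_entry_push: "rep_entry m (push \<phi> x $ n) i j = rep_entry (\<lambda>u. m (\<phi> u)) (x $ n) i j"
proof -
  have "rep_entry m (linear_ext (\<lambda>u. Poly_Mapping.single (\<phi> u)) p) i j =
      rep_entry (\<lambda>u. m (\<phi> u)) p i j" for p
    by (induction p rule: poly_mapping_add_induct)
      (simp_all add: rep_entry_simps linear_ext_zero linear_ext_add linear_ext_single single_add)
  then show ?thesis by (simp add: push_nth)
qed

lemma leg_mem_rep_kernel:
  fixes x :: "'k::field_char_0 free1"
  assumes "x \<in> rep_kernel word_matrix"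
  shows "push (\<lambda>u. (u, 0, 0)) x \<in> rep_kernel triple_matrix"
    and "push (\<lambda>u. (0, u, 0)) x \<in> rep_kernel triple_matrix"
    and "push (\<lambda>u. (0, 0, u)) x \<in> rep_kernel triple_matrix"
proof -
  \<comment> \<open>An entry of a triple with words in one leg only is an entry of that leg times
    the constant \<open>d\<close> coming from the two empty words.\<close>
  have *: "rep_entry m p a b = 0"
    if "\<And>u. m u a b = word_matrix u i j * d" "\<And>i j. rep_entry word_matrix p i j = 0"
    for m :: "generator list \<Rightarrow> index \<times> index \<times> index \<Rightarrow> _ \<Rightarrow> 'k" and p a b i j d
  proof -
    have "rep_entry m p a b = rep_entry word_matrix p i j * d"
      by (induction p rule: poly_mapping_add_induct) (simp_all add: rep_entry_simps algebra_simps that(1))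
    then show ?thesis by (simp add: that)
  qed
  from assms have x: "rep_entry word_matrix (x $ n) i j = 0" for n i j
    by (simp add: rep_kernel_def)
  show "push (\<lambda>u. (u, 0, 0)) x \<in> rep_kernel triple_matrix"
    unfolding rep_kernel_def mem_Collect_eq rep_entry_push
  proof (safe, goal_cases)
    case (1 n i j k i' j' k')
    show ?case
      by (rule *[where i = i and j = "i'" and d = "word_matrix 0 j j' * word_matrix 0 k k'"]) (simp_all add: mult_ac x)
  qed
  show "push (\<lambda>u. (0, u, 0)) x \<in> rep_kernel triple_matrix"
    unfolding rep_kernel_def mem_Collect_eq rep_entry_push
  proof (safe, goal_cases)
    case (1 n i j k i' j' k')
    show ?case
      by (rule *[where i = j and j = "j'" and d = "word_matrix 0 i i' * word_matrix 0 k k'"]) (simp_all add: mult_ac x)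
  qed
  show "push (\<lambda>u. (0, 0, u)) x \<in> rep_kernel triple_matrix"
    unfolding rep_kernel_def mem_Collect_eq rep_entry_push
  proof (safe, goal_cases)
    case (1 n i j k i' j' k')
    show ?case
      by (rule *[where i = k and j = "k'" and d = "word_matrix 0 i i' * word_matrix 0 j j'"]) (simp_all add: mult_ac x)
  qed
qed

lemma fps_exp_decompose:
  "fps_exp 1 = 1 + fps_X + fps_X ^ 2 * fps_shift 2 (fps_exp (1 :: 'k::field_char_0))"
proof (rule fps_ext)
  fix n
  show "fps_exp 1 $ n = (1 + fps_X + fps_X ^ 2 * fps_shift 2 (fps_exp (1 :: 'k))) $ n"
  proof (cases "n < 2")
    case True
    then show ?thesis by (auto simp: less_2_cases_iff fps_X_power_mult_nth)
  next
    case False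
    then obtain m where "n = m + 2" by (metis le_add_diff_inverse2 not_less)
    then show ?thesis by (simp add: fps_X_power_mult_nth)
  qed
qed

text \<open>With y = - c2 M, exp(y) is 1 + y plus a multiple of y^2, and y^2 acts as zero. Hence 1 -
  exp(y)^2 acts as - 2 y = 2 c2 M, and dividing by 2 c2 leaves M.\<close>

lemma KP_bracket_rep:
  assumes "c \<noteq> 0"
  shows "KP_bracket c - var gM \<in> rep_kernel (word_matrix :: _ \<Rightarrow> _ \<Rightarrow> _ \<Rightarrow> 'k::field_char_0)"
proof (rule rep_kernel_fps_X_mult)
  let ?J = "rep_kernel (word_matrix :: _ \<Rightarrow> _ \<Rightarrow> _ \<Rightarrow> 'k)"
  interpret fps_closed_ideal ?J by (rule fps_closed_ideal_rep_kernel[OF matrix_rep_word])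
  let ?y = "- (c2 c * var gM)" and ?t = "const_scalar (inverse (2 * c)) :: 'k free1"
  let ?E = "series_at (fps_shift 2 (fps_exp 1)) ?y"
  have y0: "?y $ 0 = 0" by simp
  have "var gM * var gM \<in> ?J"
    by (simp add: var_def mult_single plus_list_def fps_const_mem_rep_kernel rep_entry_single)
      (auto simp: UNIV_index intro: index.exhaust elim!: schroedinger_matrix.elims)
  moreover have "?y ^ 2 = c2 c * c2 c * (var gM * var gM)"
    by (simp add: power2_eq_square mult.assoc c2_def scalar_left_commute[of "var gM"])
  ultimately have y2: "?y ^ 2 \<in> ?J" by (simp only: mem_intros)
  have q: "qM c = 1 + ?y + ?y ^ 2 * ?E"
    by (subst fps_exp_decompose)
      (simp only: series_at_add[OF y0] series_at_mult[OF y0] series_at_power[OF y0] series_at_X[OF y0]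
        series_at_1[OF y0])
  have "qM c - (1 + ?y) \<in> ?J"
    using mult_right_mem[OF y2] unfolding q by simp
  then have "qM c * qM c - (1 + ?y) * (1 + ?y) \<in> ?J" by (intro cong_mult)
  moreover have "(1 + ?y) * (1 + ?y) - (1 + 2 * ?y) \<in> ?J"
  proof -
    have "(1 + z) * (1 + z) - (1 + 2 * z) = z ^ 2" for z :: "'k free1"
      by (simp add: algebra_simps power2_eq_square mult_2)
    then show ?thesis by (simp only: y2)
  qed
  ultimately have "qM c * qM c - (1 + 2 * ?y) \<in> ?J" by (rule cong_trans)
  then have "- ?t * (qM c * qM c - (1 + 2 * ?y)) \<in> ?J" by (rule mult_left_mem)
  moreover have "- ?t * (qM c * qM c - (1 + 2 * ?y)) = fps_X * (KP_bracket c - var gM)"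
  proof -
    have "?t * (2 * c2 c) = scalar (fps_const (inverse (2 * c)) * (2 * (fps_const c * fps_X)))"
      by (simp add: c2_def scalar_mult)
    also have "fps_const (inverse (2 * c)) * (2 * (fps_const c * fps_X)) =
        fps_const (inverse (2 * c) * (2 * c)) * fps_X"
      by (simp only: fps_const_mult[symmetric] fps_numeral_fps_const mult.assoc)
    finally have "?t * (2 * c2 c) = fps_X"
      using assms by (simp add: scalar_fps_X)
    then have "?t * (2 * c2 c * var gM) = fps_X * var gM"
      by (simp flip: mult.assoc)
    then show ?thesis
      by (simp add: right_diff_distrib fps_X_KP_bracket algebra_simps)
  qed
  ultimately show "fps_X * (KP_bracket c - var gM) \<in> ?J" by simp
qed

lemma I1_subset_rep_kernel:
  assumes "c \<noteq> 0"
  shows "I1 c \<subseteq> rep_kernel (word_matrix :: _ \<Rightarrow> _ \<Rightarrow> _ \<Rightarrow> 'k::field_char_0)"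
  unfolding I1_def
proof (rule closed_ideal_least[OF fps_closed_ideal_rep_kernel[OF matrix_rep_word]])
  let ?J = "rep_kernel (word_matrix :: _ \<Rightarrow> _ \<Rightarrow> _ \<Rightarrow> 'k)"
  interpret fps_closed_ideal ?J by (rule fps_closed_ideal_rep_kernel[OF matrix_rep_word])
  have comm: "comm (var g) (var h) =
      (fps_const (Poly_Mapping.single [g, h] 1 - Poly_Mapping.single [h, g] 1) :: 'k free1)" for g h
    by (simp add: comm_def var_def mult_single plus_list_def)
  have two: "2 * var g = (fps_const (Poly_Mapping.single [g] 2) :: 'k free1)" for g
    by (simp add: mult_2 var_def single_add[symmetric])
  have mem: "comm (var g) (var h) - y \<in> ?J"
    if "\<And>n. n > 0 \<Longrightarrow> y $ n = 0"
      "\<And>i j. rep_entry word_matrix (Poly_Mapping.single [g, h] 1 - Poly_Mapping.single [h, g] 1 - y $ 0) i j = 0"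
    for g h and y :: "'k free1"
    unfolding rep_kernel_def mem_Collect_eq
  proof (intro allI)
    fix n i j
    show "rep_entry word_matrix ((comm (var g) (var h) - y) $ n) i j = 0"
      using that by (cases "n = 0") (simp_all add: comm rep_entry_zero)
  qed
  have brackets: "comm (var gD) (var gP) - (- var gP) \<in> ?J" "comm (var gD) (var gK) - var gK \<in> ?J"
      "comm (var gK) (var gP) - var gM \<in> ?J" "comm (var gD) (var gH) - (- (2 * var gH)) \<in> ?J"
      "comm (var gD) (var gC) - 2 * var gC \<in> ?J" "comm (var gH) (var gC) - var gD \<in> ?J"
      "comm (var gK) (var gH) - var gP \<in> ?J" "comm (var gK) (var gC) - 0 \<in> ?J"
      "comm (var gP) (var gC) - (- var gK) \<in> ?J" "comm (var gP) (var gH) - 0 \<in> ?J"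
    by (rule mem, simp add: two[unfolded var_def] var_def, rename_tac i j, case_tac i; case_tac j;
        simp add: two[unfolded var_def] var_def rep_entry_simps UNIV_index)+
  have "comm (var gM) (var g) - 0 \<in> ?J" for g
    by (rule mem, simp, rename_tac i j, cases g; case_tac i; case_tac j;
        simp add: rep_entry_simps UNIV_index)
  moreover have "comm (var gK) (var gP) - KP_bracket c \<in> ?J"
    by (rule cong_trans[OF brackets(3) cong_sym[OF KP_bracket_rep[OF assms]]])
  ultimately show "relators c \<subseteq> ?J"
    using brackets by (auto simp: relators_def)
qed

lemma I3_subset_rep_kernel:
  assumes "c \<noteq> 0"
  shows "I3 c \<subseteq> rep_kernel (triple_matrix :: _ \<Rightarrow> _ \<Rightarrow> _ \<Rightarrow> 'k::field_char_0)"
  unfolding I3_def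
  by (rule closed_ideal_least[OF fps_closed_ideal_rep_kernel[OF matrix_rep_triple]])
    (use I1_subset_rep_kernel[OF assms] leg_mem_rep_kernel in blast)

section \<open>The legs in the tensor cube and the lowest coefficients of R\<close>

definition push12 :: "'k::field_char_0 free2 \<Rightarrow> 'k free3" where
  "push12 = push (\<lambda>(u, v). (u, v, 0))"

definition push13 :: "'k::field_char_0 free2 \<Rightarrow> 'k free3" where
  "push13 = push (\<lambda>(u, v). (u, 0, v))"

definition push23 :: "'k::field_char_0 free2 \<Rightarrow> 'k free3" where
  "push23 = push (\<lambda>(u, v). (0, u, v))"

lemma algebra_hom_push_legs: "algebra_hom push12" "algebra_hom push13" "algebra_hom push23"
  unfolding push12_def push13_def push23_def by (rule algebra_hom_push; auto simp: zero_prod_def)+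

lemma push_legs_mem:
  assumes "x \<in> I2 c"
  shows "push12 x \<in> I3 c" "push13 x \<in> I3 c" "push23 x \<in> I3 c"
proof -
  have I3: "push (\<lambda>u. (u, 0, 0)) x \<in> I3 c" "push (\<lambda>u. (0, u, 0)) x \<in> I3 c" "push (\<lambda>u. (0, 0, u)) x \<in> I3 c"
    if "x \<in> I1 c" for x
    unfolding I3_def using that by (auto intro: closed_ideal_superset[THEN subsetD])
  show "push12 x \<in> I3 c"
    by (rule I2_image_mem[OF algebra_hom_push_legs(1) fps_closed_ideal_I3 _ _ assms])
      (simp_all add: push12_def emb1_def emb2_def push_push I3)
  show "push13 x \<in> I3 c"
    by (rule I2_image_mem[OF algebra_hom_push_legs(2) fps_closed_ideal_I3 _ _ assms])
      (simp_all add: push13_def emb1_def emb2_def push_push I3)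
  show "push23 x \<in> I3 c"
    by (rule I2_image_mem[OF algebra_hom_push_legs(3) fps_closed_ideal_I3 _ _ assms])
      (simp_all add: push23_def emb1_def emb2_def push_push I3)
qed

lemma legs_cl2:
  "leg12 c (cl2 c x) = cl3 c (push12 x)"
  "leg13 c (cl2 c x) = cl3 c (push13 x)"
  "leg23 c (cl2 c x) = cl3 c (push23 x)"
  unfolding leg12_def leg13_def leg23_def cl2_def cl3_def[abs_def]
    push12_def[symmetric] push13_def[symmetric] push23_def[symmetric]
  by (rule induced_coset[OF _ fps_closed_ideal_I2 fps_closed_ideal_I3],
      rule algebra_hom_push_legs, rule push_legs_mem, assumption)+

lemma cl3_mult: "cl3 c x \<otimes>\<^bsub>U3 c\<^esub> cl3 c y = cl3 c (x * y)"
  unfolding cl3_def U3_def by (rule fps_closed_ideal.coset_mult[OF fps_closed_ideal_I3])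

lemma solves_QYBE_cl2:
  "solves_QYBE c (cl2 c a) \<longleftrightarrow>
    push12 a * push13 a * push23 a - push23 a * push13 a * push12 a \<in> I3 c"
  unfolding solves_QYBE_def legs_cl2 cl3_mult
  by (simp add: cl3_def fps_closed_ideal.coset_eq_iff[OF fps_closed_ideal_I3])

lemma f_element_nth_0: "f_element c $ 0 = 1"
proof -
  \<comment> \<open>The arcsine is defined only as a compositional inverse, so the first coefficient
    is read off from the sine identity.\<close>
  have "(sinc_sqrt_series oo arcsin_square) $ 0 * arcsin_sqrt_series $ 0 = (1 :: 'a)"
    using arg_cong[OF sinc_arcsin[where 'k='a], of "\<lambda>s. s $ 0"] by simp
  then have "arcsin_sqrt_series $ 0 = (1 :: 'a)" by (simp add: sinc_sqrt_series_def)
  then show ?thesis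
    by (simp add: f_element_def Let_def series_at_def scalar_nth cosh_series_def tensor_eq_emb
        hom_series_at)
      (simp add: emb1_def emb2_def push_nth linear_ext_single single_add scalar_nth series_at_def
        mult_single zero_prod_def flip: single_one)
qed

lemma wedge_PK_eq:
  "wedge (var gP) (var gK) =
    fps_const (Poly_Mapping.single ([gP], [gK]) 1 - Poly_Mapping.single ([gK], [gP]) 1)"
  by (simp add: wedge_def tensor_eq_emb emb1_def emb2_def var_def push_const mult_single
      zero_list_def plus_list_def)

lemma exp_at_nth_1: "x $ 0 = 0 \<Longrightarrow> exp_at x $ 1 = x $ 1"
  by (simp add: series_at_def fps_compose_nth scalar_nth)

text \<open>Since \<open>f\<close> has constant term 1, it does not affect the first order. The
  result serves both the classical Yang--Baxter expression and the classical r-matrix.\<close>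

lemma exp_R_exponent_nth_1:
  "exp_at (R_exponent c) $ 1 =
    Poly_Mapping.single ([gP], [gK]) c - Poly_Mapping.single ([gK], [gP]) c"
proof -
  have "R_exponent c = fps_X * (const_scalar c * (wedge (var gP) (var gK) * f_element c))"
    by (simp add: R_exponent_def c2_def mult.commute[of "fps_const c"] scalar_mult scalar_fps_X mult.assoc)
  then have "R_exponent c $ 0 = 0" "R_exponent c $ 1 = Poly_Mapping.single 0 c * (wedge (var gP) (var gK)) $ 0"
    by (simp_all add: scalar_nth f_element_nth_0)
  moreover from this(1) have "exp_at (R_exponent c) $ 1 = R_exponent c $ 1" by (rule exp_at_nth_1)
  ultimately show ?thesis
    by (simp add: wedge_PK_eq algebra_simps mult_single zero_prod_def zero_list_def plus_list_def)
qed

text \<open>The coefficient at \<open>h\<^sup>2\<close> is the left-hand side of the classical Yang--Baxter equation.\<close>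

lemma QYBE_nth_2:
  fixes x y z :: "'a::ring_1 fps"
  assumes "x $ 0 = 1" "y $ 0 = 1" "z $ 0 = 1"
  shows "(x * y * z - z * y * x) $ 2 =
    comm (x $ 1) (y $ 1) + comm (x $ 1) (z $ 1) + comm (y $ 1) (z $ 1)"
  using assms by (simp add: fps_mult_nth numeral_2_eq_2 comm_def algebra_simps)

lemma not_solves_QYBE_R_matrix:
  assumes "c \<noteq> (0 :: 'k::field_char_0)"
  shows "\<not> solves_QYBE c (R_matrix c)"
proof
  let ?R = "exp_at (R_exponent c)"
  let ?d = "push12 ?R * push13 ?R * push23 ?R - push23 ?R * push13 ?R * push12 ?R"
  assume "solves_QYBE c (R_matrix c)"
  then have "?d \<in> rep_kernel triple_matrix"
    using I3_subset_rep_kernel[OF assms] by (auto simp: R_matrix_def solves_QYBE_cl2)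
  \<comment> \<open>At this entry M \<otimes> K \<otimes> P, which occurs in the commutator of legs
    12 and 13, has value 1; all other terms of the classical Yang--Baxter expression vanish there,
    so what remains is \<open>c * c\<close>.\<close>
  then have zero: "rep_entry triple_matrix (?d $ 2) (B0, B0, B0) (B3, B2, B1) = 0"
    by (simp add: rep_kernel_def)
  have R0: "\<phi> ?R $ 0 = 1" if "algebra_hom \<phi>" for \<phi> :: "'k free2 \<Rightarrow> 'k free3"
  proof -
    have "(?R - 1) $ 0 = 0" by (simp add: exp_at_nth_0)
    from hom_nth_0[OF that this] show ?thesis by (simp add: hom_diff[OF that] hom_1[OF that])
  qed
  have R1: "push12 ?R $ 1 = Poly_Mapping.single ([gP], [gK], []) c - Poly_Mapping.single ([gK], [gP], []) c"
    "push13 ?R $ 1 = Poly_Mapping.single ([gP], [], [gK]) c - Poly_Mapping.single ([gK], [], [gP]) c"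
    "push23 ?R $ 1 = Poly_Mapping.single ([], [gP], [gK]) c - Poly_Mapping.single ([], [gK], [gP]) c"
    unfolding push12_def push13_def push23_def push_nth exp_R_exponent_nth_1 diff_conv_add_uminus
      single_uminus[symmetric]
    by (simp_all add: linear_ext_add linear_ext_single single_add zero_list_def)
  have "rep_entry triple_matrix (?d $ 2) (B0, B0, B0) (B3, B2, B1) = c * c"
    unfolding QYBE_nth_2[OF R0[OF algebra_hom_push_legs(1)] R0[OF algebra_hom_push_legs(2)]
        R0[OF algebra_hom_push_legs(3)]] R1 comm_def
    by (simp add: algebra_simps mult_single plus_list_def rep_entry_simps UNIV_index)
  with zero assms show False by simp
qed

section \<open>The R-matrix in the quotient\<close>

lemma cl2_quotient:
  "cl2 c x \<otimes>\<^bsub>U2 c\<^esub> cl2 c y = cl2 c (x * y)"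
  "cl2 c x \<oplus>\<^bsub>U2 c\<^esub> cl2 c y = cl2 c (x + y)"
  "\<one>\<^bsub>U2 c\<^esub> = cl2 c 1" "\<zero>\<^bsub>U2 c\<^esub> = cl2 c 0" "cl2 c x \<in> carrier (U2 c)"
  unfolding cl2_def U2_def
  by (rule fps_closed_ideal.coset_mult fps_closed_ideal.coset_add fps_closed_ideal.coset_one
      fps_closed_ideal.coset_zero fps_closed_ideal.coset_carrier, rule fps_closed_ideal_I2)+

lemma R_matrix_inverse:
  "R_matrix c \<in> Units (U2 c)" "inv\<^bsub>U2 c\<^esub> R_matrix c = cl2 c (exp_at (- R_exponent c))"
proof -
  interpret Group.monoid "U2 c"
    unfolding U2_def by (rule fps_closed_ideal.monoid_quotient[OF fps_closed_ideal_I2])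
  let ?S = "cl2 c (exp_at (- R_exponent c))"
  have RS: "R_matrix c \<otimes>\<^bsub>U2 c\<^esub> ?S = \<one>\<^bsub>U2 c\<^esub>" "?S \<otimes>\<^bsub>U2 c\<^esub> R_matrix c = \<one>\<^bsub>U2 c\<^esub>"
    by (simp_all add: R_matrix_def cl2_quotient exp_at_uminus R_exponent_nth_0)
  have carrier: "R_matrix c \<in> carrier (U2 c)" "?S \<in> carrier (U2 c)"
    by (simp_all add: R_matrix_def cl2_quotient)
  show "R_matrix c \<in> Units (U2 c)"
    using RS carrier unfolding Units_def by blast
  show "inv\<^bsub>U2 c\<^esub> R_matrix c = ?S"
    using inv_char[OF carrier RS] .
qed

lemma R_matrix_conjugation:
  assumes "c \<noteq> 0"
  shows "R_matrix c \<otimes>\<^bsub>U2 c\<^esub> coproduct c (cl1 c (var g)) \<otimes>\<^bsub>U2 c\<^esub> inv\<^bsub>U2 c\<^esub> R_matrix c =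
    flip c (coproduct c (cl1 c (var g)))"
proof -
  interpret fps_closed_ideal "I2 c" by (rule fps_closed_ideal_I2)
  let ?R = "exp_at (R_exponent c)" and ?S = "exp_at (- R_exponent c)"
  let ?u = "coproduct_gen c g" and ?v = "swap2 (coproduct_gen c g)"
  have "(?R * ?u - ?v * ?R) * ?S \<in> I2 c"
    by (rule mult_right_mem[OF R_exponent_conjugation[OF assms]])
  moreover have "(?R * ?u - ?v * ?R) * ?S = ?R * ?u * ?S - ?v"
    by (simp add: left_diff_distrib mult.assoc exp_at_uminus R_exponent_nth_0)
  ultimately have "cl2 c (?R * ?u * ?S) = cl2 c ?v" by (simp add: cl2_eq_iff)
  then show ?thesis
    by (simp add: R_matrix_inverse coproduct_cl1 flip_cl2 cl2_quotient) (simp add: R_matrix_def cl2_quotient)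
qed

lemma classical_r_matrix_R_matrix:
  "classical_r_matrix c (R_matrix c) (cl2 c (c2 c * wedge (var gP) (var gK)))"
  unfolding classical_r_matrix_def
proof (intro conjI bexI)
  let ?a = "\<lambda>g g'. if g = gP \<and> g' = gK then c else if g = gK \<and> g' = gP then - c else 0"
  let ?W = "wedge (var gP) (var gK) :: 'a free2"
  have UNIV: "(UNIV :: generator set) = {gD, gH, gP, gK, gC, gM}"
    by (auto intro: generator.exhaust)
  have "(\<Sum>g\<in>UNIV. \<Sum>g'\<in>UNIV. const_scalar (?a g g') * (var g \<boxtimes> var g')) = const_scalar c * ?W"
    by (simp add: UNIV wedge_def scalar_uminus right_diff_distrib flip: fps_const_neg)
  then show "\<exists>a. cl2 c (c2 c * ?W) =
      cl2 c (scalar fps_X * (\<Sum>g\<in>UNIV. \<Sum>g'\<in>UNIV. const_scalar (a g g') * (var g \<boxtimes> var g')))"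
    by (intro exI[of _ ?a])
      (simp add: c2_def scalar_mult mult.commute[of "fps_const c"] mult.assoc)
  let ?R = "exp_at (R_exponent c)"
  \<comment> \<open>The remainder after first order, divided by \<open>h ^ 2\<close>; the shift is
    exact because the coefficients of degree 0 and 1 cancel.\<close>
  let ?y = "fps_shift 2 (?R - 1 - c2 c * ?W)"
  show "cl2 c ?y \<in> carrier (U2 c)" by (rule cl2_quotient)
  have "(?R - 1 - c2 c * ?W) $ i = 0" if "i < 2" for i
  proof -
    from that consider "i = 0" | "i = 1" by linarith
    then show ?thesis
    proof cases
      case 2
      have "c2 c * ?W = fps_X * (const_scalar c * ?W)"
        by (simp add: c2_def scalar_mult mult.commute[of "fps_const c"] scalar_fps_X mult.assoc)
      then have "(c2 c * ?W) $ 1 = Poly_Mapping.single 0 c * ?W $ 0"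
        by (simp add: scalar_nth)
      also have "\<dots> = ?R $ 1"
        by (simp only: exp_R_exponent_nth_1)
          (simp add: wedge_PK_eq algebra_simps mult_single zero_prod_def zero_list_def plus_list_def)
      finally show ?thesis by (simp add: 2)
    qed (simp add: exp_at_nth_0)
  qed
  then have "?R - 1 - c2 c * ?W = fps_X ^ 2 * ?y" by (rule fps_eq_X_power_mult_shift)
  then have "?R = 1 + c2 c * ?W + scalar (fps_X ^ 2) * ?y"
    by (simp add: scalar_power scalar_fps_X algebra_simps)
  then show "R_matrix c = \<one>\<^bsub>U2 c\<^esub> \<oplus>\<^bsub>U2 c\<^esub> cl2 c (c2 c * ?W) \<oplus>\<^bsub>U2 c\<^esub>
      cl2 c (scalar (fps_X ^ 2)) \<otimes>\<^bsub>U2 c\<^esub> cl2 c ?y"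
    by (simp add: R_matrix_def cl2_quotient)
qed

theorem mainTheorem8:
  fixes c :: "'k::field_char_0"
  assumes "c \<noteq> 0"
  shows
    "\<not> solves_QYBE c (R_matrix c)
     \<and> R_matrix c \<in> Units (U2 c)
     \<and> (\<forall>g. R_matrix c \<otimes>\<^bsub>U2 c\<^esub> coproduct c (cl1 c (var g)) \<otimes>\<^bsub>U2 c\<^esub> inv\<^bsub>U2 c\<^esub> R_matrix c
            = flip c (coproduct c (cl1 c (var g))))
     \<and> (\<forall>g\<in>{gD, gC}. cl2 c (comm (R_exponent c) (primitive (var g))) = \<zero>\<^bsub>U2 c\<^esub>)
     \<and> classical_r_matrix c (R_matrix c) (cl2 c (c2 c * wedge (var gP) (var gK)))"
proof (intro conjI allI ballI)
  fix g assume "g \<in> {gD, gC}"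
  then show "cl2 c (comm (R_exponent c) (primitive (var g))) = \<zero>\<^bsub>U2 c\<^esub>"
    using comm_R_exponent_primitive[of g c] by (auto simp: cl2_quotient cl2_eq_iff)
qed (fact not_solves_QYBE_R_matrix[OF assms] R_matrix_inverse(1) R_matrix_conjugation[OF assms]
    classical_r_matrix_R_matrix)+

end
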